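(* Let $n\ge2$ and $0<\alpha_0<1$. There exist an unbounded set $\widetilde E_{\alpha_0}\subset\mathbb Z^n$ with $\overline{\dim}_{LG}\widetilde E_{\alpha_0}=n-2\alpha_0$ but $\overline{\dim}_L\widetilde E_{\alpha_0}=0$, and a quasiconformal, Lipschitz mapping $f:\mathbb R^n\to\mathbb R^n$ with $J_f\in A_1(\mathbb R^n;\widetilde E_{\alpha_0})$, for which ${\bf C}_f$ is not bounded on $Q_\alpha(\mathbb R^n)$ for any $\alpha\in(\alpha_0,1)$.
   Context: Quasiconformal: a homeomorphism $f:\mathbb R^n\to\mathbb R^n$, $n\ge2$, is quasiconformal if $f\in W^{1,1}_{\rm loc}(\mathbb R^n;\mathbb R^n)$ and there is $K\ge1$ with $|Df(x)|^n\le K J_f(x)$ for a.e. $x\in\mathbb R^n$, where $J_f$ is the Jacobian determinant of $f$. $Q$-spaces: for $\alpha\in(0,1)$, $Q_\alpha(\mathbb R^n)$ consists of all $u\in L^2_{\rm loc}(\mathbb R^n)$ with $$\|u\|_{Q_\alpha(\mathbb R^n)}=\sup_{x_0\in\mathbb R^n,\,r>0}\left(r^{2\alpha-n}\int_{B(x_0,r)}\int_{B(x_0,r)}\frac{|u(x)-u(y)|^2}{|x-y|^{n+2\alpha}}\,dx\,dy\right)^{1/2}<\infty .$$ Composition operator: ${\bf C}_f(u)=u\circ f$. It is bounded on $Q_\alpha(\mathbb R^n)$ if there is a constant $C$ such that $u\circ f\in Q_\alpha(\mathbb R^n)$ and $\|u\circ f\|_{Q_\alpha(\mathbb R^n)}\le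 C\|u\|_{Q_\alpha(\mathbb R^n)}$ for all $u\in Q_\alpha(\mathbb R^n)$. Local Muckenhoupt class: for a closed set $E\subseteq\mathbb R^n$ and a nonnegative function $w:\mathbb R^n\to\mathbb R$, $w\in A_1(\mathbb R^n;E)$ means there is a constant $C>0$ such that $$\frac1{|B|}\int_B w(z)\,dz\le C\,\operatorname*{ess\,inf}_{x\in B}w(x)$$ for every ball $B=B(x_B,r_B)\subset\mathbb R^n$ with $2r_B<d(x_B,E)$, where $d(x,E)=\inf_{z\in E}|x-z|$. Dimensions: for $F\subseteq\mathbb R^n$ and $r>0$, $N_{\rm cov}(r,F)$ is the minimal number of cubes of edge length $r$ required to cover $F$ (with $\log 0=-\infty$). The local self-similar Minkowski dimension of $E$ is $$\overline{\dim}_L E=\liminf_{N\to\infty}\ \limsup_{r\to0}\ \sup_{B:\ Nr\le r_B\le1}\frac{\log N_{\rm cov}(r,E\cap B)}{\log(r_B/r)},$$ the supremum being over all balls $B=B(x_B,r_B)\subset\mathbb R^n$ with $r_B\in[Nr,1]$. The global self-similar Minkowski dimension of $E$ is $$\overline{\dim}_{LG}E=\liminf_{N\to\infty}\ \sup_{r>0}\ \sup_{B:\ r_B\ge Nr}\frac{\log N_{\rm cov}(r,E\cap B)}{\log(r_B/r)},$$ the second supremum being over all balls $B=B(x_B,r_B)\subset\mathbb R^n$ with $r_B\in[Nr,\infty)$. *)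

theory Defs
  imports "HOL-Analysis.Analysis"
begin

primrec continuously_differentiable :: "nat \<Rightarrow> ('a::euclidean_space \<Rightarrow> real) \<Rightarrow> bool" where
  "continuously_differentiable 0 \<phi> \<longleftrightarrow> continuous_on UNIV \<phi>"
| "continuously_differentiable (Suc k) \<phi> \<longleftrightarrow> (\<forall>x. \<phi> differentiable (at x)) \<and>
     (\<forall>v. continuously_differentiable k (\<lambda>x. frechet_derivative \<phi> (at x) v))"

definition test_function :: "('a::euclidean_space \<Rightarrow> real) \<Rightarrow> bool" where
  "test_function \<phi> \<longleftrightarrow>
     (\<forall>k. continuously_differentiable k \<phi>) \<and> compact (closure {x. \<phi> x \<noteq> 0})"

definition locally_integrable :: "('a::euclidean_space \<Rightarrow> 'b::euclidean_space) \<Rightarrow> bool" where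
  "locally_integrable f \<longleftrightarrow> (\<forall>K. compact K \<longrightarrow> f absolutely_integrable_on K)"

text \<open>The entry \<open>D x $ i $ j\<close> is the weak \<open>j\<close>-th partial derivative of the \<open>i\<close>-th component of
  \<open>f\<close>, so \<open>D x *v h\<close> is the derivative at \<open>x\<close> in direction \<open>h\<close>. Such a \<open>D\<close> is unique up to a
  null set, and \<open>f\<close> is in the local Sobolev space \<open>W\<^sup>1\<^sup>,\<^sup>1\<close> iff there is one.\<close>

definition has_weak_derivative ::
    "(real^'n \<Rightarrow> real^'n) \<Rightarrow> (real^'n \<Rightarrow> real^'n^'n) \<Rightarrow> bool" where
  "has_weak_derivative f D \<longleftrightarrow> locally_integrable f \<and> locally_integrable D \<and>
     (\<forall>\<phi> i j. test_function \<phi> \<longrightarrow>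
        (LINT x|lebesgue. f x $ i * frechet_derivative \<phi> (at x) (axis j 1)) =
        - (LINT x|lebesgue. D x $ i $ j * \<phi> x))"

definition quasiconformal :: "(real^'n \<Rightarrow> real^'n) \<Rightarrow> bool" where
  "quasiconformal f \<longleftrightarrow> (\<exists>g. homeomorphism UNIV UNIV f g) \<and>
     (\<exists>D. has_weak_derivative f D \<and>
        (\<exists>K::real. K \<ge> 1 \<and>
           (AE x in lebesgue. onorm ((*v) (D x)) ^ CARD('n) \<le> K * det (D x))))"

definition sqrt_ennreal :: "ennreal \<Rightarrow> ennreal" where
  "sqrt_ennreal t = (if t = \<infinity> then \<infinity> else ennreal (sqrt (enn2real t)))"

text \<open>On the null set \<open>x = y\<close> the integrand below is \<open>0 / 0 = 0\<close>.\<close>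

definition Q_norm :: "real \<Rightarrow> (real^'n \<Rightarrow> real) \<Rightarrow> ennreal" where
  "Q_norm \<alpha> u = (SUP x0. SUP r\<in>{0<..}. sqrt_ennreal
     (ennreal (r powr (2 * \<alpha> - real CARD('n))) *
      (\<integral>\<^sup>+x\<in>ball x0 r. (\<integral>\<^sup>+y\<in>ball x0 r.
          ennreal (\<bar>u x - u y\<bar>^2 / norm (x - y) powr (real CARD('n) + 2 * \<alpha>))
        \<partial>lebesgue) \<partial>lebesgue)))"

definition L2_loc :: "(real^'n \<Rightarrow> real) set" where
  "L2_loc = {u. u \<in> borel_measurable lebesgue \<and>
     (\<forall>K. compact K \<longrightarrow> (\<integral>\<^sup>+x\<in>K. ennreal (\<bar>u x\<bar>^2) \<partial>lebesgue) < \<infinity>)}"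

definition Q_space :: "real \<Rightarrow> (real^'n \<Rightarrow> real) set" where
  "Q_space \<alpha> = {u \<in> L2_loc. Q_norm \<alpha> u < \<infinity>}"

definition composition_operator :: "(real^'n \<Rightarrow> real^'n) \<Rightarrow> (real^'n \<Rightarrow> real) \<Rightarrow> (real^'n \<Rightarrow> real)"
  where "composition_operator f u = u \<circ> f"

definition composition_bounded_on_Q :: "real \<Rightarrow> (real^'n \<Rightarrow> real^'n) \<Rightarrow> bool" where
  "composition_bounded_on_Q \<alpha> f \<longleftrightarrow> (\<exists>C::real. \<forall>u\<in>Q_space \<alpha>.
     composition_operator f u \<in> Q_space \<alpha> \<and>
     Q_norm \<alpha> (composition_operator f u) \<le> ennreal C * Q_norm \<alpha> u)"

definition essinf :: "'a measure \<Rightarrow> ('a \<Rightarrow> ennreal) \<Rightarrow> ennreal" where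
  "essinf M w = Sup {c. AE x in M. c \<le> w x}"

text \<open>Weights are taken modulo null sets, hence the almost everywhere nonnegativity.
  The case \<open>E = {}\<close> is separated since the library sets \<open>infdist x {} = 0\<close>, whereas the infimum
  over the empty set is infinite.\<close>

definition A1_local :: "(real^'n) set \<Rightarrow> (real^'n \<Rightarrow> real) \<Rightarrow> bool" where
  "A1_local E w \<longleftrightarrow> closed E \<and> w \<in> borel_measurable lebesgue \<and> (AE x in lebesgue. 0 \<le> w x) \<and>
     (\<exists>C::real. C > 0 \<and> (\<forall>x r. r > 0 \<and> (E \<noteq> {} \<longrightarrow> 2 * r < infdist x E) \<longrightarrow>
        (\<integral>\<^sup>+z\<in>ball x r. ennreal (w z) \<partial>lebesgue) / emeasure lebesgue (ball x r)
          \<le> ennreal C * essinf (lebesgue_on (ball x r)) (\<lambda>z. ennreal (w z))))"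

definition cubes :: "real \<Rightarrow> (real^'n) set set" where
  "cubes r = {cbox a (a + r *\<^sub>R One) | a. True}"

definition N_cov :: "real \<Rightarrow> (real^'n) set \<Rightarrow> enat" where
  "N_cov r F = (INF \<C>\<in>{\<C>. finite \<C> \<and> \<C> \<subseteq> cubes r \<and> F \<subseteq> \<Union>\<C>}. enat (card \<C>))"

definition log_enat :: "enat \<Rightarrow> ereal" where
  "log_enat k = (case k of enat m \<Rightarrow> if m = 0 then -\<infinity> else ereal (ln (real m)) | \<infinity> \<Rightarrow> \<infinity>)"

text \<open>The suprema are nonincreasing in \<open>N\<close> once \<open>N > 1\<close>, so it is immaterial that \<open>N\<close> ranges over the
  naturals instead of the reals. For \<open>N \<le> 1\<close> the denominator \<open>ln (R / r)\<close> can
  vanish, which does not affect the limit.\<close>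

definition dim_L :: "(real^'n) set \<Rightarrow> ereal" where
  "dim_L E = liminf (\<lambda>N. Limsup (at_right 0) (\<lambda>r.
     SUP (x, R) \<in> {(x, R). real N * r \<le> R \<and> R \<le> 1}.
       log_enat (N_cov r (E \<inter> ball x R)) / ereal (ln (R / r))))"

definition dim_LG :: "(real^'n) set \<Rightarrow> ereal" where
  "dim_LG E = liminf (\<lambda>N. SUP r\<in>{0<..}.
     SUP (x, R) \<in> {(x, R). real N * r \<le> R}.
       log_enat (N_cov r (E \<inter> ball x R)) / ereal (ln (R / r)))"

end

theory Submission
  imports Defs
begin

text \<open>The set is \<open>E = A\<^sup>n\<close>, where \<open>A\<close> consists of the natural numbers whose binary digits equal to 1
  occur only at positions \<open>j\<close> with \<open>\<lfloor>t (j + 1)\<rfloor> > \<lfloor>t j\<rfloor>\<close>, for \<open>t = 1 - 2 \<alpha>\<^sub>0 / n\<close>. These positions have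
  density \<open>t\<close> uniformly in every window, so a ball of radius \<open>R\<close> is met in about \<open>(R / r) powr (n t)\<close>
  cubes of edge \<open>r \<ge> 1\<close>. The map replaces \<open>z + y\<close> by \<open>z + 2 \<bar>y\<bar> y\<close> whenever \<open>z \<in> E\<close> and \<open>\<bar>y\<bar> < 1/2\<close>;
  its Jacobian is comparable to \<open>min 1 (2 d(x, E)) ^ n\<close>.

  Place a bump of height 1 and width \<open>\<delta>\<close> at each of the roughly \<open>T powr (n - 2 \<alpha>\<^sub>0)\<close> points of \<open>E\<close> in
  a cube of edge \<open>T = 2 ^ k\<close>, with \<open>\<delta> powr (n - 2 \<alpha>)\<close> proportional to \<open>T powr (- 2 (\<alpha> - \<alpha>\<^sub>0))\<close>.
  The resulting functions have bounded Q-norm, because a bump has energy \<open>\<delta> powr (n - 2 \<alpha>)\<close>. Composition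
  with the map widens every bump to scale \<open>sqrt \<delta>\<close>, which multiplies the energy by a positive power of \<open>T\<close>.\<close>

section \<open>Binary digit sets and the self-similar Minkowski dimensions\<close>

text \<open>Uniformity over windows is forced: the Q-norm of the bumps tests balls of every centre
  and radius, so the number of points of \<open>E\<close> in a ball of radius
  \<open>R \<ge> 1\<close> must be at most a constant times \<open>R powr (n t)\<close> everywhere.
  Positions of merely asymptotic density \<open>t\<close> could contain long runs of consecutive
  positions, where the count would be too large. The floors of \<open>t j\<close> deviate from
  linear growth by less than one, wherever the window starts. Energy balance: put
  \<open>\<beta> = n - 2 \<alpha>\<close>, positive because \<open>n \<ge> 2\<close> and
  \<open>\<alpha> < 1\<close>, and \<open>\<gamma> = \<alpha> - \<alpha>\<^sub>0\<close>. There are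
  about \<open>T powr (\<beta> + 2 \<gamma>)\<close> bumps, so their normalised energy at scale
  \<open>T\<close> is about \<open>T powr (2 \<gamma>) * \<delta> powr \<beta>\<close>, which the
  choice of \<open>\<delta>\<close> keeps bounded. At width \<open>sqrt \<delta>\<close> it becomes
  \<open>T powr (2 \<gamma>) * \<delta> powr (\<beta> / 2)\<close>, about
  \<open>T powr \<gamma>\<close>; here \<open>\<alpha>\<^sub>0 < \<alpha>\<close> enters. The local
  dimension sees none of this: \<open>E\<close> consists of integer points, so a ball of radius at
  most 1 meets boundedly many of them.\<close>

definition beatty :: "real \<Rightarrow> nat \<Rightarrow> nat" where
  "beatty t j = nat \<lfloor>t * real j\<rfloor>"

definition digit_positions :: "real \<Rightarrow> nat set" where
  "digit_positions t = {j. beatty t (Suc j) = Suc (beatty t j)}"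

text \<open>Digits are tested at the shifted positions \<open>a + j\<close>, so that one family of
  sets describes the digits of an element of \<open>digit_set t\<close> in an arbitrary window, not
  only the lowest ones.\<close>

definition digit_block :: "real \<Rightarrow> nat \<Rightarrow> nat \<Rightarrow> nat set" where
  "digit_block t a m = {y. y < 2 ^ m \<and> (\<forall>j<m. odd (y div 2 ^ j) \<longrightarrow> a + j \<in> digit_positions t)}"

definition digit_set :: "real \<Rightarrow> nat set" where
  "digit_set t = {z. \<forall>j. odd (z div 2 ^ j) \<longrightarrow> j \<in> digit_positions t}"

lemma beatty_Suc:
  assumes "0 < t" "t < 1"
  shows "beatty t (Suc j) = (if j \<in> digit_positions t then Suc (beatty t j) else beatty t j)"
proof -
  have "\<lfloor>t * real j\<rfloor> \<le> \<lfloor>t * real (Suc j)\<rfloor>"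
    using assms by (intro floor_mono) auto
  moreover have "t * real (Suc j) < t * real j + 1" using assms by (simp add: algebra_simps)
  then have "\<lfloor>t * real (Suc j)\<rfloor> \<le> \<lfloor>t * real j\<rfloor> + 1" by linarith
  moreover have "\<lfloor>t * real j\<rfloor> \<ge> 0" using assms by simp
  ultimately have "beatty t (Suc j) = beatty t j \<or> beatty t (Suc j) = Suc (beatty t j)"
    unfolding beatty_def by linarith
  then show ?thesis by (auto simp: digit_positions_def)
qed

text \<open>Each floor loses less than one, and the two losses have opposite signs in the
  difference. The bounds do not depend on \<open>a\<close>, which is the uniformity over
  windows.\<close>

lemma beatty_diff_bounds:
  assumes "0 < t"
  shows "real (beatty t (a + m)) - real (beatty t a) < t * real m + 1"
    and "real (beatty t (a + m)) - real (beatty t a) > t * real m - 1"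
proof -
  have eq: "real (beatty t j) = of_int \<lfloor>t * real j\<rfloor>" for j using assms by (simp add: beatty_def)
  have "t * real (a + m) = t * real a + t * real m" by (simp add: algebra_simps)
  then show "real (beatty t (a + m)) - real (beatty t a) < t * real m + 1"
    and "real (beatty t (a + m)) - real (beatty t a) > t * real m - 1"
    unfolding eq by linarith+
qed

lemma finite_digit_block: "finite (digit_block t a m)"
  by (rule finite_subset[of _ "{..<2 ^ m}"]) (auto simp: digit_block_def)

lemma digit_block_Suc:
  "digit_block t a (Suc m) = digit_block t a m \<union>
     (if a + m \<in> digit_positions t then (\<lambda>y. y + 2 ^ m) ` digit_block t a m else {})"
proof -
  \<comment> \<open>For \<open>j < m\<close> the added \<open>2 ^ (m - j)\<close> is even, so
    setting digit \<open>m\<close> does not disturb the parity tests at lower positions.\<close>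
  have low: "(y + 2 ^ m) div 2 ^ j = y div 2 ^ j + 2 ^ (m - j)" if "j \<le> m" for y j :: nat
  proof -
    have "(2::nat) ^ m = 2 ^ (m - j) * 2 ^ j" using that by (simp flip: power_add)
    then show ?thesis by simp
  qed
  have top: "y div 2 ^ m = 1" if "2 ^ m \<le> y" "y < 2 ^ Suc m" for y :: nat
    using that by (intro div_nat_eqI) auto
  show ?thesis
  proof (intro equalityI subsetI)
    fix y assume y: "y \<in> digit_block t a (Suc m)"
    show "y \<in> digit_block t a m \<union>
      (if a + m \<in> digit_positions t then (\<lambda>y. y + 2 ^ m) ` digit_block t a m else {})"
    proof (cases "y < 2 ^ m")
      case True
      then show ?thesis using y by (auto simp: digit_block_def)
    next
      case False
      then have "y div 2 ^ m = 1" using y top by (auto simp: digit_block_def)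
      then have pos: "a + m \<in> digit_positions t" using y by (auto simp: digit_block_def)
      define w where "w = y - 2 ^ m"
      have yw: "y = w + 2 ^ m" using False by (simp add: w_def)
      have "w < 2 ^ m" using y yw by (auto simp: digit_block_def)
      moreover have "a + j \<in> digit_positions t" if "j < m" "odd (w div 2 ^ j)" for j
      proof -
        have "odd (y div 2 ^ j)" using that low[of j w] by (simp add: yw)
        then show ?thesis using y that by (auto simp: digit_block_def)
      qed
      ultimately have "w \<in> digit_block t a m" by (auto simp: digit_block_def)
      then show ?thesis using pos yw by auto
    qed
  next
    fix y assume "y \<in> digit_block t a m \<union>
      (if a + m \<in> digit_positions t then (\<lambda>y. y + 2 ^ m) ` digit_block t a m else {})"
    then consider "y \<in> digit_block t a m"
      | w where "a + m \<in> digit_positions t" "y = w + 2 ^ m" "w \<in> digit_block t a m"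
      by (auto split: if_splits)
    then show "y \<in> digit_block t a (Suc m)"
    proof cases
      case 1
      then show ?thesis by (auto simp: digit_block_def less_Suc_eq)
    next
      case 2
      have "a + j \<in> digit_positions t" if "j < Suc m" "odd (y div 2 ^ j)" for j
      proof (cases "j = m")
        case False
        then have "odd (w div 2 ^ j)" using that low[of j w] 2 by simp
        then show ?thesis using 2 that False by (auto simp: digit_block_def)
      qed (use 2 in auto)
      then show ?thesis using 2 by (auto simp: digit_block_def)
    qed
  qed
qed

text \<open>Every admissible position doubles the count and raises \<open>beatty\<close> by one. The
  product form avoids a difference of natural numbers in the exponent.\<close>

lemma card_digit_block:
  assumes "0 < t" "t < 1"
  shows "card (digit_block t a m) * 2 ^ beatty t a = 2 ^ beatty t (a + m)"
proof (induction m)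
  case 0
  have "digit_block t a 0 = {0}" by (auto simp: digit_block_def)
  then show ?case by simp
next
  case (Suc m)
  have "card (digit_block t a (Suc m)) =
    (if a + m \<in> digit_positions t then 2 else 1) * card (digit_block t a m)"
  proof -
    have "card (digit_block t a m \<union> (\<lambda>y. y + 2 ^ m) ` digit_block t a m)
        = card (digit_block t a m) + card ((\<lambda>y. y + 2 ^ m) ` digit_block t a m)"
      by (rule card_Un_disjoint) (auto simp: finite_digit_block, auto simp: digit_block_def)
    also have "card ((\<lambda>y. y + 2 ^ m) ` digit_block t a m) = card (digit_block t a m)"
      by (rule card_image) (simp add: inj_on_def)
    finally show ?thesis by (simp add: digit_block_Suc)
  qed
  then show ?case using Suc beatty_Suc[OF assms, of "a + m"] by (simp split: if_splits)
qed

lemma card_digit_block_bounds: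
  assumes "0 < t" "t < 1"
  shows "real (card (digit_block t a m)) \<le> 2 * (2 ^ m) powr t"
    and "real (card (digit_block t a m)) \<ge> (2 ^ m) powr t / 2"
proof -
  let ?d = "real (beatty t (a + m)) - real (beatty t a)"
  have "real (card (digit_block t a m)) * 2 ^ beatty t a = 2 ^ beatty t (a + m)"
    using card_digit_block[OF assms, of a m]
    by (metis of_nat_mult of_nat_numeral of_nat_power)
  then have "real (card (digit_block t a m)) = 2 powr ?d"
    by (simp add: powr_diff powr_realpow field_simps)
  moreover have "2 powr ?d \<le> 2 powr (t * real m + 1)" "2 powr (t * real m - 1) \<le> 2 powr ?d"
    using beatty_diff_bounds[OF assms(1), where a=a and m=m] by (auto intro: less_imp_le)
  moreover have "(2 ^ m) powr t = 2 powr (t * real m)"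
    by (simp add: powr_realpow[symmetric] powr_powr mult.commute)
  ultimately show "real (card (digit_block t a m)) \<le> 2 * (2 ^ m) powr t"
    and "real (card (digit_block t a m)) \<ge> (2 ^ m) powr t / 2"
    by (simp_all add: powr_add powr_diff)
qed

lemma digit_set_block:
  assumes "z \<in> digit_set t"
  shows "z div 2 ^ a mod 2 ^ m \<in> digit_block t a m"
proof -
  have "a + j \<in> digit_positions t" if "j < m" "odd (z div 2 ^ a mod 2 ^ m div 2 ^ j)" for j
  proof -
    have "odd (z div 2 ^ a div 2 ^ j)"
    proof -
      have "bit (take_bit m (z div 2 ^ a)) j" using that by (simp add: bit_iff_odd take_bit_eq_mod)
      then have "bit (z div 2 ^ a) j" unfolding bit_take_bit_iff by blast
      then show ?thesis by (simp add: bit_iff_odd)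
    qed
    then have "odd (z div 2 ^ (a + j))" by (simp add: div_mult2_eq power_add)
    then show ?thesis using assms by (auto simp: digit_set_def)
  qed
  then show ?thesis by (auto simp: digit_block_def)
qed

lemma digit_block_subset_digit_set: "digit_block t 0 m \<subseteq> digit_set t"
proof
  fix y assume y: "y \<in> digit_block t 0 m"
  have "j \<in> digit_positions t" if "odd (y div 2 ^ j)" for j
  proof -
    have "j < m"
    proof (rule ccontr)
      assume "\<not> j < m"
      then have "(2::nat) ^ m \<le> 2 ^ j" by (intro power_increasing) auto
      moreover have "y < 2 ^ m" using y by (simp add: digit_block_def)
      ultimately have "y < 2 ^ j" by linarith
      then show False using that by simp
    qed
    then show ?thesis using y that by (auto simp: digit_block_def)
  qed
  then show "y \<in> digit_set t" by (auto simp: digit_set_def)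
qed


text \<open>An interval of length \<open>2 R \<le> 2 ^ M\<close> meets at most two consecutive
  dyadic intervals of length \<open>2 ^ M\<close>; the least element of \<open>W\<close> identifies
  the first. Given that interval, the quotient by \<open>2 ^ a\<close> is determined by the digits
  at positions \<open>a\<close> to \<open>M - 1\<close>, which form a digit block. Two intervals
  times the factor 2 of the block bound give the 4.\<close>

lemma digit_set_window:
  fixes x R :: real
  assumes t: "0 < t" "t < 1" and M: "a \<le> M" "2 * R \<le> 2 ^ M"
  defines "W \<equiv> {z \<in> digit_set t. \<bar>real z - x\<bar> < R}"
  shows "finite ((\<lambda>z. z div 2 ^ a) ` W)"
    and "real (card ((\<lambda>z. z div 2 ^ a) ` W)) \<le> 4 * (2 ^ (M - a)) powr t"
proof -
  let ?q = "\<lambda>z::nat. z div 2 ^ a" and ?m = "M - a"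
  show "finite (?q ` W)" 
  proof (rule finite_imageI, rule finite_subset)
    show "W \<subseteq> {..nat \<lceil>x + R\<rceil>}" by (auto simp: W_def) linarith
  qed simp
  show "real (card (?q ` W)) \<le> 4 * (2 ^ ?m) powr t"
  proof (cases "W = {}")
    case False
    define z0 where "z0 = (LEAST z. z \<in> W)"
    have z0: "z0 \<in> W" "\<And>z. z \<in> W \<Longrightarrow> z0 \<le> z"
      using False by (auto simp: z0_def intro: LeastI Least_le)
    define Q where "Q = z0 div 2 ^ M"
    have top: "z div 2 ^ M \<in> {Q, Suc Q}" if "z \<in> W" for z
    proof -
      have "real z < real z0 + 2 ^ M" using that z0(1) M unfolding W_def by auto
      then have "real z < real (z0 + 2 ^ M)" by simp
      then have "z < z0 + 2 ^ M" by (simp only: of_nat_less_iff)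
      then have "z div 2 ^ M \<le> (z0 + 2 ^ M) div 2 ^ M" by (intro div_le_mono) simp
      then have "z div 2 ^ M \<le> Suc Q" by (simp add: Q_def)
      moreover have "Q \<le> z div 2 ^ M" unfolding Q_def using z0(2)[OF that] by (rule div_le_mono)
      ultimately show ?thesis by auto
    qed
    let ?h = "\<lambda>q::nat. (q div 2 ^ ?m, q mod 2 ^ ?m)"
    have "inj_on ?h (?q ` W)"
      by (intro inj_onI) (metis Pair_inject div_mult_mod_eq)
    moreover have "?h ` ?q ` W \<subseteq> {Q, Suc Q} \<times> digit_block t a ?m"
    proof clarify
      fix z assume z: "z \<in> W"
      have "z div 2 ^ a div 2 ^ ?m = z div 2 ^ M"
        using M(1) by (simp add: div_mult2_eq[symmetric] power_add[symmetric])
      then show "z div 2 ^ a div 2 ^ ?m \<in> {Q, Suc Q} \<and> z div 2 ^ a mod 2 ^ ?m \<in> digit_block t a ?m"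
        using top[OF z] digit_set_block[of z t a ?m] z by (simp add: W_def)
    qed
    ultimately have "card (?q ` W) \<le> card ({Q, Suc Q} \<times> digit_block t a ?m)"
      by (rule card_inj_on_le) (simp add: finite_digit_block)
    then have "real (card (?q ` W)) \<le> 2 * real (card (digit_block t a ?m))"
      by (simp add: card_cartesian_product)
    then show ?thesis using card_digit_block_bounds(1)[OF t, of a ?m] by linarith
  qed simp
qed

text \<open>The condition \<open>2 ^ a - 1 \<le> r\<close> is what covering needs: the integers with
  a common quotient by \<open>2 ^ a\<close> span only the length \<open>2 ^ a - 1\<close>. It
  permits \<open>a = 0\<close> for every \<open>r < 1\<close>. Minimality of \<open>M\<close> gives
  \<open>2 ^ M < 4 * R\<close> unless \<open>M = a\<close>, and \<open>r \<le> 2 * 2 ^ a\<close>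
  costs another 2, hence the 8.\<close>

lemma dyadic_scale:
  fixes r R :: real
  assumes "0 < r" "r \<le> R"
  obtains a M :: nat where "a \<le> M" "2 * R \<le> 2 ^ M" "2 ^ (M - a) \<le> 8 * (R / r)" "2 ^ a - 1 \<le> r"
proof -
  define a :: nat where "a = (if r < 1 then 0 else nat \<lfloor>log 2 r\<rfloor>)"
  have lower: "2 ^ a - 1 \<le> r" and upper: "r \<le> 2 * 2 ^ a"
  proof -
    have "2 ^ a - 1 \<le> r \<and> r \<le> 2 * 2 ^ a"
    proof (cases "r < 1")
      case False
      then have ln: "real a = \<lfloor>log 2 r\<rfloor>" by (simp add: a_def)
      have "2 powr real a \<le> 2 powr (log 2 r)" using ln by simp
      moreover have "2 powr (log 2 r) \<le> 2 powr (real a + 1)" unfolding ln by simp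
      ultimately show ?thesis using False by (simp add: powr_add powr_realpow)
    qed (use assms in \<open>simp add: a_def\<close>)
    then show "2 ^ a - 1 \<le> r" "r \<le> 2 * 2 ^ a" by auto
  qed
  define M where "M = (LEAST M. a \<le> M \<and> 2 * R \<le> 2 ^ M)"
  have ex: "\<exists>M. a \<le> M \<and> 2 * R \<le> 2 ^ M"
  proof -
    obtain k where k: "2 * R < 2 ^ k" using real_arch_pow[of 2 "2 * R"] by auto
    have "(2::real) ^ k \<le> 2 ^ max a k" by (intro power_increasing) auto
    then have "2 * R \<le> 2 ^ max a k" using k by linarith
    then show ?thesis by (intro exI[of _ "max a k"]) auto
  qed
  have M: "a \<le> M" "2 * R \<le> 2 ^ M" using LeastI_ex[OF ex] by (auto simp: M_def)
  have "2 ^ (M - a) \<le> 8 * (R / r)"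
  proof (cases "M = a")
    case True
    then show ?thesis using assms by (simp add: field_simps)
  next
    case False
    then obtain k where k: "M = Suc k" "a \<le> k" using M(1) by (metis le_SucE not0_implies_Suc le_zero_eq)
    have "\<not> (a \<le> k \<and> 2 * R \<le> 2 ^ k)"
      using k(1) not_less_Least[of k "\<lambda>M. a \<le> M \<and> 2 * R \<le> 2 ^ M"] unfolding M_def by auto
    then have "2 ^ M < 4 * R" using k by simp
    moreover have "(2::real) ^ M = 2 ^ (M - a) * 2 ^ a" using M(1) by (simp flip: power_add)
    ultimately have "2 ^ (M - a) * 2 ^ a < 4 * R" by simp
    moreover have "2 ^ (M - a) * r \<le> 2 ^ (M - a) * (2 * 2 ^ a)" using upper by simp
    ultimately have "2 ^ (M - a) * r \<le> 8 * R" by linarith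
    then show ?thesis using assms(1) by (simp add: field_simps)
  qed
  then show ?thesis using that M lower by blast
qed

section \<open>Covers and point counts of the product set\<close>

definition digit_grid :: "real \<Rightarrow> (real^'n) set" where
  "digit_grid t = {v. \<forall>i. v $ i \<in> real ` digit_set t}"

lemma digit_grid_integer: "x \<in> digit_grid t \<Longrightarrow> x $ i \<in> \<int>"
  by (auto simp: digit_grid_def) (metis Ints_of_nat imageE)

lemma card_vec_family:
  assumes "\<And>i. finite (S i)"
  shows "finite {v :: 'a^'n. \<forall>i. v $ i \<in> S i}"
    and "card {v :: 'a^'n. \<forall>i. v $ i \<in> S i} = (\<Prod>i\<in>UNIV. card (S i))"
proof -
  have eq: "{v :: 'a^'n. \<forall>i. v $ i \<in> S i} = vec_lambda ` (Pi\<^sub>E UNIV S)"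
  proof (intro equalityI subsetI)
    fix v :: "'a^'n" assume "v \<in> {v. \<forall>i. v $ i \<in> S i}"
    then have "v = vec_lambda (\<lambda>i. v $ i)" "(\<lambda>i. v $ i) \<in> Pi\<^sub>E UNIV S" by auto
    then show "v \<in> vec_lambda ` (Pi\<^sub>E UNIV S)" by blast
  qed auto
  have inj: "inj_on (vec_lambda :: ('n \<Rightarrow> 'a) \<Rightarrow> 'a^'n) (Pi\<^sub>E UNIV S)"
    by (auto simp: inj_on_def)
  have "finite (Pi\<^sub>E UNIV S)" using assms by (intro finite_PiE) auto
  then show "finite {v :: 'a^'n. \<forall>i. v $ i \<in> S i}" by (simp add: eq)
  show "card {v :: 'a^'n. \<forall>i. v $ i \<in> S i} = (\<Prod>i\<in>UNIV. card (S i))"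
    unfolding eq card_image[OF inj] by (simp add: card_PiE)
qed

lemma mem_cube_iff: "x \<in> cbox a (a + r *\<^sub>R One) \<longleftrightarrow> (\<forall>i. a $ i \<le> x $ i \<and> x $ i \<le> a $ i + r)"
  for x a :: "real^'n"
proof -
  have "(One :: real^'n) $ i = 1" for i
    by (simp add: cart_eq_inner_axis inner_sum_left inner_Basis axis_in_Basis_iff)
  then show ?thesis by (simp add: mem_box_cart)
qed

text \<open>One cube is placed at \<open>2 ^ a * v\<close> for each vector \<open>v\<close> of
  quotients that occur coordinatewise in the ball. The count is a product of \<open>n\<close> window
  counts, each at most \<open>4 * (8 * (R / r)) powr t\<close>, and \<open>8 powr t \<le> 8\<close>
  gives 32 per coordinate.\<close>

lemma digit_grid_cover:
  fixes x :: "real^'n"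
  assumes t: "0 < t" "t < 1" and r: "0 < r" "r \<le> R"
  obtains \<C> where "finite \<C>" "\<C> \<subseteq> cubes r" "digit_grid t \<inter> ball x R \<subseteq> \<Union>\<C>"
    "real (card \<C>) \<le> 32 ^ CARD('n) * (R / r) powr (real CARD('n) * t)"
proof -
  obtain a M where aM: "a \<le> M" "2 * R \<le> 2 ^ M" "2 ^ (M - a) \<le> 8 * (R / r)" "2 ^ a - 1 \<le> r"
    using dyadic_scale[OF r] .
  define S where "S i = (\<lambda>z. z div 2 ^ a) ` {z \<in> digit_set t. \<bar>real z - x $ i\<bar> < R}" for i
  have fin: "finite (S i)" for i
    unfolding S_def by (rule digit_set_window(1)[OF t aM(1,2)])
  have card: "real (card (S i)) \<le> 32 * (R / r) powr t" for i
  proof -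
    have "real (card (S i)) \<le> 4 * (2 ^ (M - a)) powr t"
      unfolding S_def by (rule digit_set_window(2)[OF t aM(1,2)])
    also have "\<dots> \<le> 4 * (8 * (R / r)) powr t"
      using aM(3) t by (intro mult_left_mono powr_mono2) auto
    also have "\<dots> = 4 * (8 powr t * (R / r) powr t)"
      using r by (subst powr_mult) auto
    also have "\<dots> \<le> 4 * (8 powr 1 * (R / r) powr t)"
      using t by (intro mult_left_mono mult_right_mono powr_mono) auto
    finally show ?thesis by simp
  qed
  define V where "V = {v :: nat^'n. \<forall>i. v $ i \<in> S i}"
  define cube where "cube v = (let b = (\<chi> i. real (v $ i * 2 ^ a)) in cbox b (b + r *\<^sub>R One))"
    for v :: "nat^'n"
  have "finite (cube ` V)" unfolding V_def by (intro finite_imageI card_vec_family fin)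
  moreover have "cube ` V \<subseteq> cubes r" by (auto simp: cube_def cubes_def Let_def)
  moreover have "digit_grid t \<inter> ball x R \<subseteq> \<Union>(cube ` V)"
  proof
    fix y assume y: "y \<in> digit_grid t \<inter> ball x R"
    then have "\<forall>i. \<exists>z. z \<in> digit_set t \<and> y $ i = real z" by (auto simp: digit_grid_def)
    then obtain z where z: "\<And>i. z i \<in> digit_set t" "\<And>i. y $ i = real (z i)" by metis
    have "\<bar>real (z i) - x $ i\<bar> < R" for i
    proof -
      have "\<bar>(y - x) $ i\<bar> \<le> norm (y - x)" by (rule component_le_norm_cart)
      then show ?thesis using y z(2) by (simp add: dist_norm norm_minus_commute)
    qed
    then have "(\<chi> i. z i div 2 ^ a) \<in> V" using z by (auto simp: V_def S_def)
    moreover have "y \<in> cube (\<chi> i. z i div 2 ^ a)"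
    proof -
      have "real (z i div 2 ^ a * 2 ^ a) \<le> real (z i) \<and> real (z i) \<le> real (z i div 2 ^ a * 2 ^ a) + r" for i
      proof -
        have "z i mod 2 ^ a + 1 \<le> 2 ^ a" by (simp add: Suc_leI)
        then have "real (z i mod 2 ^ a + 1) \<le> real (2 ^ a)" by (simp only: of_nat_le_iff)
        then have "real (z i mod 2 ^ a) + 1 \<le> 2 ^ a" by simp
        moreover have "real (z i) = real (z i div 2 ^ a * 2 ^ a) + real (z i mod 2 ^ a)"
          by (metis div_mult_mod_eq of_nat_add)
        ultimately show ?thesis using aM(4) by linarith
      qed
      then show ?thesis unfolding cube_def Let_def mem_cube_iff by (simp add: z(2))
    qed
    ultimately show "y \<in> \<Union>(cube ` V)" by blast
  qed
  moreover have "real (card (cube ` V)) \<le> 32 ^ CARD('n) * (R / r) powr (real CARD('n) * t)"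
  proof -
    have "real (card (cube ` V)) \<le> real (card V)"
      unfolding V_def by (intro of_nat_mono card_image_le card_vec_family fin)
    also have "\<dots> = (\<Prod>i\<in>UNIV. real (card (S i)))"
      unfolding V_def by (simp add: card_vec_family fin)
    also have "\<dots> \<le> (\<Prod>i\<in>(UNIV::'n set). 32 * (R / r) powr t)"
      by (intro prod_mono) (simp add: card)
    also have "\<dots> = 32 ^ CARD('n) * (R / r) powr (real CARD('n) * t)"
      using r by (simp add: power_mult_distrib powr_powr[symmetric] powr_realpow[symmetric] mult.commute)
    finally show ?thesis .
  qed
  ultimately show ?thesis using that by blast
qed

text \<open>A closed cube of edge 1/2 contains at most one integer point, so covering at this scale
  is counting. Closed cubes of edge 1 would not separate neighbouring points.\<close>

lemma card_le_card_half_cubes: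
  fixes F :: "(real^'n) set"
  assumes "\<And>x i. x \<in> F \<Longrightarrow> x $ i \<in> \<int>" and "finite \<C>" "\<C> \<subseteq> cubes (1/2)" "F \<subseteq> \<Union>\<C>"
  shows "finite F \<and> card F \<le> card \<C>"
proof -
  have "\<exists>c. c \<in> \<C> \<and> x \<in> c" if "x \<in> F" for x using that assms by auto
  then obtain c where c: "\<And>x. x \<in> F \<Longrightarrow> c x \<in> \<C> \<and> x \<in> c x" by metis
  have "inj_on c F"
  proof (rule inj_onI)
    fix x y assume xy: "x \<in> F" "y \<in> F" "c x = c y"
    obtain a where "c x = cbox a (a + (1/2) *\<^sub>R One)" using c[OF xy(1)] assms(3) by (auto simp: cubes_def)
    then have "x \<in> cbox a (a + (1/2) *\<^sub>R One)" "y \<in> cbox a (a + (1/2) *\<^sub>R One)" using c xy by metis+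
    then have "\<bar>x $ i - y $ i\<bar> \<le> 1/2" for i
      unfolding mem_cube_iff abs_le_iff by (smt (verit))
    moreover have "x $ i - y $ i \<in> \<int>" for i using assms(1) xy by auto
    ultimately have "x $ i - y $ i = 0" for i
      by (metis Ints_nonzero_abs_less1 field_sum_of_halves le_less_trans less_add_same_cancel1 half_gt_zero zero_less_one)
    then show "x = y" by (simp add: vec_eq_iff)
  qed
  moreover have "c ` F \<subseteq> \<C>" using c by auto
  ultimately show ?thesis using assms(2) card_inj_on_le inj_on_finite by metis
qed

text \<open>This is the cover at edge 1/2; the additional factor
  \<open>2 powr (n t) \<le> 2 ^ n\<close> turns 32 into 64.\<close>

lemma digit_grid_card:
  fixes x :: "real^'n"
  assumes t: "0 < t" "t < 1" and R: "1 \<le> R"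
  shows "finite (digit_grid t \<inter> ball x R)"
    and "real (card (digit_grid t \<inter> ball x R)) \<le> 64 ^ CARD('n) * R powr (real CARD('n) * t)"
proof -
  obtain \<C> :: "(real^'n) set set" where C: "finite \<C>" "\<C> \<subseteq> cubes (1/2)" "digit_grid t \<inter> ball x R \<subseteq> \<Union>\<C>"
    "real (card \<C>) \<le> 32 ^ CARD('n) * (R / (1/2)) powr (real CARD('n) * t)"
  proof -
    have "0 < (1/2::real)" "1/2 \<le> R" using R by auto
    from digit_grid_cover[OF t this, of x] that show ?thesis by blast
  qed
  have *: "finite (digit_grid t \<inter> ball x R) \<and> card (digit_grid t \<inter> ball x R) \<le> card \<C>"
    by (rule card_le_card_half_cubes) (use C digit_grid_integer in auto)
  then show "finite (digit_grid t \<inter> ball x R)" by simp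
  have "real (card (digit_grid t \<inter> ball x R)) \<le> 32 ^ CARD('n) * (R * 2) powr (real CARD('n) * t)"
    using * C(4) by simp
  also have "\<dots> = 32 ^ CARD('n) * (R powr (real CARD('n) * t) * 2 powr (real CARD('n) * t))"
    using R by (simp add: powr_mult)
  also have "\<dots> \<le> 32 ^ CARD('n) * (R powr (real CARD('n) * t) * 2 powr real CARD('n))"
    using t by (intro mult_left_mono powr_mono) (auto simp: mult_left_le)
  also have "\<dots> = 64 ^ CARD('n) * R powr (real CARD('n) * t)"
    by (simp add: powr_realpow flip: power_mult_distrib)
  finally show "real (card (digit_grid t \<inter> ball x R)) \<le> 64 ^ CARD('n) * R powr (real CARD('n) * t)" .
qed

text \<open>This is the part of \<open>digit_grid t\<close> in the half-open cube of edge
  \<open>2 ^ k\<close> at the origin, and the finite set that will carry the bumps.\<close>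

definition digit_grid_piece :: "real \<Rightarrow> nat \<Rightarrow> (real^'n) set" where
  "digit_grid_piece t k = {v. \<forall>i. v $ i \<in> real ` digit_block t 0 k}"

lemma digit_grid_piece_subset:
  "digit_grid_piece t k \<subseteq> (digit_grid t \<inter> ball 0 (real CARD('n) * 2 ^ k) :: (real^'n) set)"
proof
  fix v :: "real^'n" assume v: "v \<in> digit_grid_piece t k"
  have "v \<in> digit_grid t"
    using v digit_block_subset_digit_set[of t k] by (fastforce simp: digit_grid_piece_def digit_grid_def)
  moreover have "norm v < real CARD('n) * 2 ^ k"
  proof -
    have "\<bar>v $ i\<bar> < 2 ^ k" for i
    proof -
      obtain y where "y \<in> digit_block t 0 k" "v $ i = real y" using v by (auto simp: digit_grid_piece_def)
      moreover from this have "y < 2 ^ k" by (simp add: digit_block_def)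
      ultimately show ?thesis by (metis abs_of_nat of_nat_less_iff of_nat_numeral of_nat_power)
    qed
    then have "(\<Sum>i\<in>UNIV. \<bar>v $ i\<bar>) < (\<Sum>i\<in>(UNIV::'n set). 2 ^ k)"
      by (intro sum_strict_mono) auto
    then show ?thesis using norm_le_l1_cart[of v] by simp
  qed
  ultimately show "v \<in> digit_grid t \<inter> ball 0 (real CARD('n) * 2 ^ k)" by simp
qed

lemma digit_grid_piece_card:
  assumes "0 < t" "t < 1"
  shows "finite (digit_grid_piece t k :: (real^'n) set)"
    and "(2 ^ k) powr (real CARD('n) * t) / 2 ^ CARD('n) \<le> real (card (digit_grid_piece t k :: (real^'n) set))"
proof -
  have fin: "finite (real ` digit_block t 0 k)" by (simp add: finite_digit_block)
  show "finite (digit_grid_piece t k :: (real^'n) set)"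
    unfolding digit_grid_piece_def by (rule card_vec_family(1)[OF fin])
  have "(2 ^ k) powr (real CARD('n) * t) / 2 ^ CARD('n) = ((2 ^ k) powr t / 2) ^ CARD('n)"
    by (simp add: power_divide powr_powr[symmetric] powr_realpow[symmetric] mult.commute)
  also have "\<dots> \<le> real (card (real ` digit_block t 0 k)) ^ CARD('n)"
    using card_digit_block_bounds(2)[OF assms, of k 0] by (intro power_mono) (auto simp: card_image)
  also have "\<dots> = real (card (digit_grid_piece t k :: (real^'n) set))"
    unfolding digit_grid_piece_def by (simp add: card_vec_family(2)[OF fin])
  finally show "(2 ^ k) powr (real CARD('n) * t) / 2 ^ CARD('n) \<le> real (card (digit_grid_piece t k :: (real^'n) set))" .
qed

section \<open>Covering numbers and the two Minkowski dimensions\<close>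

lemma N_cov_le:
  assumes "finite \<C>" "\<C> \<subseteq> cubes r" "F \<subseteq> \<Union>\<C>"
  shows "N_cov r F \<le> enat (card \<C>)"
  unfolding N_cov_def using assms by (intro INF_lower) auto

lemma N_cov_ge:
  assumes "\<And>\<C>. finite \<C> \<Longrightarrow> \<C> \<subseteq> cubes r \<Longrightarrow> F \<subseteq> \<Union>\<C> \<Longrightarrow> m \<le> card \<C>"
  shows "enat m \<le> N_cov r F"
  unfolding N_cov_def using assms by (intro INF_greatest) auto

lemma log_enat_le:
  assumes "k \<le> enat m" "real m \<le> B" "1 \<le> B"
  shows "log_enat k \<le> ereal (ln B)"
proof -
  obtain j where j: "k = enat j" "j \<le> m" using assms(1) by (cases k) auto
  then have "real j \<le> B" using assms(2) by linarith
  then have "ln (real j) \<le> ln B" if "j \<noteq> 0" using that by (intro ln_mono) auto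
  then show ?thesis using j by (simp add: log_enat_def)
qed

lemma log_enat_ge:
  assumes "enat m \<le> k" "b \<le> real m" "0 < b"
  shows "ereal (ln b) \<le> log_enat k"
proof (cases k)
  case (enat j)
  then have "b \<le> real j" using assms by simp
  then have "j \<noteq> 0" "ln b \<le> ln (real j)" using assms(3) by auto
  then show ?thesis using enat by (simp add: log_enat_def)
qed (simp add: log_enat_def)

lemma tendsto_const_over_ln_nat: "(\<lambda>N. ereal (s + L / ln (real N))) \<longlonglongrightarrow> ereal s"
proof -
  have "filterlim (\<lambda>N. ln (real N)) at_top sequentially"
    by (rule filterlim_compose[OF ln_at_top filterlim_real_sequentially])
  then have "(\<lambda>N. L / ln (real N)) \<longlonglongrightarrow> 0"
    by (intro real_tendsto_divide_at_top[OF tendsto_const]) 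
  then have "(\<lambda>N. s + L / ln (real N)) \<longlonglongrightarrow> s + 0" by (intro tendsto_intros)
  then show ?thesis by simp
qed

text \<open>A constant factor \<open>B\<close> in the covering bound adds
  \<open>ln B / ln (R / r)\<close> to the quotient. Since \<open>R / r \<ge> N\<close>, this is at
  most \<open>ln B / ln N\<close>, which the limit in \<open>N\<close> removes.\<close>

lemma dim_LG_le:
  fixes E :: "(real^'n) set"
  assumes B: "1 \<le> B" and s: "0 \<le> s"
    and cover: "\<And>x r R. 0 < r \<Longrightarrow> r \<le> R \<Longrightarrow> \<exists>\<C>. finite \<C> \<and> \<C> \<subseteq> cubes r \<and>
      E \<inter> ball x R \<subseteq> \<Union>\<C> \<and> real (card \<C>) \<le> B * (R / r) powr s"
  shows "dim_LG E \<le> ereal s"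
proof -
  have "log_enat (N_cov r (E \<inter> ball x R)) / ereal (ln (R / r)) \<le> ereal (s + ln B / ln (real N))"
    if N: "2 \<le> N" and r: "0 < r" and R: "real N * r \<le> R" for N r x R
  proof -
    have NR: "real N \<le> R / r" using r R by (simp add: field_simps)
    then have R1: "1 < R / r" using N by linarith
    then have rR: "r \<le> R" using r by (simp add: field_simps)
    have lnN: "0 < ln (real N)" "ln (real N) \<le> ln (R / r)" using N NR by (auto intro!: ln_mono)
    obtain \<C> where C: "finite \<C>" "\<C> \<subseteq> cubes r" "E \<inter> ball x R \<subseteq> \<Union>\<C>"
      "real (card \<C>) \<le> B * (R / r) powr s"
      using cover[OF r rR, of x] by (elim exE conjE)
    have "1 \<le> (R / r) powr s" using R1 s by (intro ge_one_powr_ge_zero) auto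
    then have "1 * 1 \<le> B * (R / r) powr s" using B by (intro mult_mono) auto
    then have "log_enat (N_cov r (E \<inter> ball x R)) \<le> ereal (ln (B * (R / r) powr s))"
      using N_cov_le[OF C(1-3)] C(4) by (intro log_enat_le) auto
    also have "ln (B * (R / r) powr s) = ln B + s * ln (R / r)"
    proof -
      have "ln (B * (R / r) powr s) = ln B + ln ((R / r) powr s)"
        using B R1 by (intro ln_mult_pos) auto
      then show ?thesis using R1 by (simp only: ln_powr)
    qed
    finally have "log_enat (N_cov r (E \<inter> ball x R)) / ereal (ln (R / r)) \<le>
        ereal (ln B + s * ln (R / r)) / ereal (ln (R / r))"
      using lnN by (intro ereal_divide_right_mono) auto
    also have "\<dots> = ereal (s + ln B / ln (R / r))" using lnN by (simp add: field_simps)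
    also have "\<dots> \<le> ereal (s + ln B / ln (real N))"
      using lnN B by (simp add: frac_le)
    finally show ?thesis .
  qed
  then have "(SUP r\<in>{0<..}. SUP (x, R) \<in> {(x, R). real N * r \<le> R}.
      log_enat (N_cov r (E \<inter> ball x R)) / ereal (ln (R / r))) \<le> ereal (s + ln B / ln (real N))"
    if "2 \<le> N" for N
    using that by (intro SUP_least) auto
  then have "dim_LG E \<le> liminf (\<lambda>N. ereal (s + ln B / ln (real N)))"
    unfolding dim_LG_def by (intro Liminf_mono eventually_sequentiallyI[of 2]) auto
  also have "\<dots> = ereal s"
    by (rule lim_imp_Liminf[OF trivial_limit_sequentially tendsto_const_over_ln_nat])
  finally show ?thesis .
qed

lemma tendsto_log_count_ratio:
  assumes "0 < b" "0 < c"
  shows "(\<lambda>k. ereal (ln ((2 ^ k) powr s / b) / ln (c * 2 ^ k))) \<longlonglongrightarrow> ereal s"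
proof -
  have "(\<lambda>k. (s * ln 2 - ln b / real k) / (ln c / real k + ln 2)) \<longlonglongrightarrow> (s * ln 2 - 0) / (0 + ln 2)"
    by (intro tendsto_intros lim_const_over_n) auto
  moreover have "\<forall>\<^sub>F k in sequentially. (s * ln 2 - ln b / real k) / (ln c / real k + ln 2)
      = ln ((2 ^ k) powr s / b) / ln (c * 2 ^ k)"
  proof (rule eventually_sequentiallyI[of 1])
    fix k :: nat assume k: "1 \<le> k"
    have 1: "ln ((2 ^ k) powr s / b) = real k * (s * ln 2 - ln b / real k)"
      using assms k by (subst ln_div) (auto simp: ln_powr ln_realpow algebra_simps)
    have 2: "ln (c * 2 ^ k) = real k * (ln c / real k + ln 2)"
      using assms k by (subst ln_mult) (auto simp: ln_realpow algebra_simps)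
    show "(s * ln 2 - ln b / real k) / (ln c / real k + ln 2) = ln ((2 ^ k) powr s / b) / ln (c * 2 ^ k)"
      unfolding 1 2 using k by simp
  qed
  ultimately show ?thesis by (simp add: tendsto_cong)
qed

lemma dim_LG_digit_grid:
  assumes t: "0 < t" "t < 1"
  shows "dim_LG (digit_grid t :: (real^'n) set) = ereal (real CARD('n) * t)"
proof (rule antisym)
  show "dim_LG (digit_grid t :: (real^'n) set) \<le> ereal (real CARD('n) * t)"
  proof (rule dim_LG_le[of "32 ^ CARD('n)"])
    fix x :: "real^'n" and r R :: real assume "0 < r" "r \<le> R"
    then show "\<exists>\<C>. finite \<C> \<and> \<C> \<subseteq> cubes r \<and> digit_grid t \<inter> ball x R \<subseteq> \<Union>\<C> \<and>
        real (card \<C>) \<le> 32 ^ CARD('n) * (R / r) powr (real CARD('n) * t)"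
      using digit_grid_cover[OF t, of r R x] by metis
  qed (use t in auto)
  have "ereal (real CARD('n) * t) \<le> (SUP r\<in>{0<..}. SUP (x, R) \<in> {(x, R). real N * r \<le> R}.
      log_enat (N_cov r (digit_grid t \<inter> ball (x::real^'n) R)) / ereal (ln (R / r)))" (is "_ \<le> ?S") for N
  \<comment> \<open>For fixed \<open>N\<close> the supremum already contains the pairs of edge 1/2
    and radius \<open>n * 2 ^ k\<close> for all large \<open>k\<close>; along these the quotient
    tends to \<open>n t\<close>, so the lower bound holds for every single \<open>N\<close>.\<close>
  proof (rule LIMSEQ_le_const2[OF tendsto_log_count_ratio])
    let ?R = "\<lambda>k. real CARD('n) * 2 ^ k"
    obtain k0 where k0: "real N + 1 < 2 ^ k0" using real_arch_pow[of 2 "real N + 1"] by auto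
    have "ereal (ln ((2 ^ k) powr (real CARD('n) * t) / 2 ^ CARD('n)) / ln (2 * real CARD('n) * 2 ^ k)) \<le> ?S"
      if k: "k0 \<le> k" for k
    proof -
      let ?F = "digit_grid t \<inter> ball (0::real^'n) (?R k)"
      let ?b = "(2 ^ k) powr (real CARD('n) * t) / 2 ^ CARD('n)"
      have "(2::real) ^ k0 \<le> 2 ^ k" using k by (intro power_increasing) auto
      then have k2: "real N + 1 < 2 ^ k" using k0 by linarith
      also have "(2::real) ^ k = 1 * 2 ^ k" by simp
      also have "\<dots> \<le> ?R k" by (intro mult_right_mono) (auto simp: Suc_leI)
      finally have R: "real N + 1 < ?R k" .
      have "enat (card (digit_grid_piece t k :: (real^'n) set)) \<le> N_cov (1/2) ?F"
      proof (rule N_cov_ge)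
        fix \<C> :: "(real^'n) set set" assume C: "finite \<C>" "\<C> \<subseteq> cubes (1/2)" "?F \<subseteq> \<Union>\<C>"
        have "card (digit_grid_piece t k :: (real^'n) set) \<le> card ?F"
          using digit_grid_piece_subset digit_grid_card(1)[OF t, of "?R k"] R by (intro card_mono) auto
        also have "\<dots> \<le> card \<C>" using card_le_card_half_cubes[of ?F \<C>] C digit_grid_integer by blast
        finally show "card (digit_grid_piece t k :: (real^'n) set) \<le> card \<C>" .
      qed
      then have "ereal (ln ?b) \<le> log_enat (N_cov (1/2) ?F)"
        by (rule log_enat_ge) (use digit_grid_piece_card(2)[OF t] in auto)
      then have "ereal (ln ?b) / ereal (ln (?R k / (1/2))) \<le> log_enat (N_cov (1/2) ?F) / ereal (ln (?R k / (1/2)))"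
        using R by (intro ereal_divide_right_mono) auto
      moreover have "\<dots> \<le> (SUP (x, R) \<in> {(x, R). real N * (1/2) \<le> R}.
          log_enat (N_cov (1/2) (digit_grid t \<inter> ball (x::real^'n) R)) / ereal (ln (R / (1/2))))"
        by (rule SUP_upper2[of "(0, ?R k)"]) (use R in auto)
      moreover have "\<dots> \<le> ?S" by (rule SUP_upper) simp
      ultimately have "ereal (ln ?b) / ereal (ln (?R k / (1/2))) \<le> ?S" by (meson order_trans)
      moreover have "ln (?R k / (1/2)) = ln (2 * real CARD('n) * 2 ^ k)" "ln (?R k / (1/2)) > 0"
        using R by (simp_all add: mult_ac)
      ultimately show ?thesis by (simp only: ereal_divide less_imp_neq[symmetric] if_False)
    qed
    then show "\<exists>k0. \<forall>k\<ge>k0. ereal (ln ((2 ^ k) powr (real CARD('n) * t) / 2 ^ CARD('n)) / ln (2 * real CARD('n) * 2 ^ k)) \<le> ?S"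
      by blast
  qed auto
  then show "ereal (real CARD('n) * t) \<le> dim_LG (digit_grid t :: (real^'n) set)"
    unfolding dim_LG_def by (intro Liminf_bounded always_eventually allI)
qed

lemma N_cov_le_card:
  assumes "finite F" "0 \<le> r"
  shows "N_cov r F \<le> enat (card F)"
proof -
  let ?c = "\<lambda>a. cbox a (a + r *\<^sub>R One)"
  have "x \<in> ?c x" for x :: "real^'n" using assms(2) by (simp add: mem_cube_iff)
  then have "F \<subseteq> \<Union>(?c ` F)" by blast
  then have "N_cov r F \<le> enat (card (?c ` F))" using assms by (intro N_cov_le) (auto simp: cubes_def)
  also have "\<dots> \<le> enat (card F)" using assms(1) by (simp add: card_image_le)
  finally show ?thesis .
qed

lemma zero_in_digit_grid: "0 \<in> digit_grid t"
proof -
  have "0 \<in> digit_set t" by (simp add: digit_set_def)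
  then show ?thesis by (force simp: digit_grid_def)
qed

text \<open>A ball of radius at most 1 meets at most \<open>64 ^ n\<close> grid points, whatever
  \<open>r\<close> is, so the numerator stays bounded while the denominator is at least
  \<open>ln N\<close>.\<close>

lemma dim_L_digit_grid:
  assumes t: "0 < t" "t < 1"
  shows "dim_L (digit_grid t :: (real^'n) set) = 0"
proof (rule antisym)
  let ?q = "\<lambda>r (x::real^'n) R. log_enat (N_cov r (digit_grid t \<inter> ball x R)) / ereal (ln (R / r))"
  let ?B = "64 ^ CARD('n) :: real"
  have "?q r x R \<le> ereal (0 + ln ?B / ln (real N))"
    if N: "2 \<le> N" and r: "0 < r" and R: "real N * r \<le> R" "R \<le> 1" for N r x R
  proof -
    have NR: "real N \<le> R / r" using r R by (simp add: field_simps)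
    then have lnN: "0 < ln (real N)" "ln (real N) \<le> ln (R / r)" using N by (auto intro!: ln_mono)
    have sub: "digit_grid t \<inter> ball x R \<subseteq> digit_grid t \<inter> ball x 1" using R by auto
    have fin: "finite (digit_grid t \<inter> ball x R)"
      using sub digit_grid_card(1)[OF t, of 1 x] by (rule finite_subset) simp
    have "card (digit_grid t \<inter> ball x R) \<le> card (digit_grid t \<inter> ball x 1)"
      using digit_grid_card(1)[OF t, of 1 x] sub by (intro card_mono) auto
    then have "real (card (digit_grid t \<inter> ball x R)) \<le> ?B"
      using digit_grid_card(2)[OF t, of 1 x] by simp
    then have "log_enat (N_cov r (digit_grid t \<inter> ball x R)) \<le> ereal (ln ?B)"
      using N_cov_le_card[OF fin, of r] r by (intro log_enat_le) auto
    then have "?q r x R \<le> ereal (ln ?B) / ereal (ln (R / r))"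
      using lnN by (intro ereal_divide_right_mono) auto
    also have "\<dots> \<le> ereal (0 + ln ?B / ln (real N))"
      using lnN by (auto intro!: divide_left_mono)
    finally show ?thesis .
  qed
  then have *: "(SUP (x, R) \<in> {(x, R). real N * r \<le> R \<and> R \<le> 1}. ?q r x R) \<le> ereal (0 + ln ?B / ln (real N))"
    if "2 \<le> N" "0 < r" for N r
    using that by (intro SUP_least) auto
  have "Limsup (at_right 0) (\<lambda>r. SUP (x, R) \<in> {(x, R). real N * r \<le> R \<and> R \<le> 1}. ?q r x R)
      \<le> ereal (0 + ln ?B / ln (real N))" if "2 \<le> N" for N
    using *[OF that] by (intro Limsup_bounded) (auto simp: eventually_at_filter)
  then have "dim_L (digit_grid t :: (real^'n) set) \<le> liminf (\<lambda>N. ereal (0 + ln ?B / ln (real N)))"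
    unfolding dim_L_def by (intro Liminf_mono eventually_sequentiallyI[of 2]) auto
  also have "\<dots> = ereal 0"
    by (rule lim_imp_Liminf[OF trivial_limit_sequentially tendsto_const_over_ln_nat])
  finally show "dim_L (digit_grid t :: (real^'n) set) \<le> 0" unfolding zero_ereal_def .
  \<comment> \<open>A ball that misses the set contributes \<open>-\<infinity>\<close>, so a witness
    is needed: the unit ball at the origin, which contains the grid point 0 and needs at least one
    cube.\<close>
  have "0 \<le> Limsup (at_right 0) (\<lambda>r. SUP (x, R) \<in> {(x, R). real N * r \<le> R \<and> R \<le> 1}. ?q r x R)" for N
  proof (rule le_Limsup)
    have "0 \<le> (SUP (x, R) \<in> {(x, R). real N * r \<le> R \<and> R \<le> 1}. ?q r x R)"
      \<comment> \<open>This threshold gives both \<open>real N * r \<le> 1\<close>, which admits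
        the radius 1, and \<open>r < 1\<close>, which makes \<open>ln (1 / r)\<close>
        positive.\<close>
      if r: "0 < r" "r < 1 / (real N + 1)" for r
    proof -
      have "1 / (real N + 1) \<le> 1" by simp
      then have "r < 1" using r by linarith
      moreover have "real N * r \<le> 1" using r by (simp add: field_simps)
      ultimately have r1: "r < 1" "real N * r \<le> 1" by auto
      have "enat 1 \<le> N_cov r (digit_grid t \<inter> ball (0::real^'n) 1)"
      proof (rule N_cov_ge)
        fix \<C> :: "(real^'n) set set" assume C: "finite \<C>" "digit_grid t \<inter> ball 0 1 \<subseteq> \<Union>\<C>"
        have "0 \<in> \<Union>\<C>" using C(2) zero_in_digit_grid[of t] by auto
        then have "\<C> \<noteq> {}" by auto
        then show "1 \<le> card \<C>" using C(1) by (simp add: Suc_leI card_gt_0_iff)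
      qed
      then have "ereal (ln 1) \<le> log_enat (N_cov r (digit_grid t \<inter> ball (0::real^'n) 1))"
        by (rule log_enat_ge) auto
      then have "ereal (ln 1) / ereal (ln (1 / r)) \<le> ?q r 0 1"
        using r r1 by (intro ereal_divide_right_mono) (auto simp: ln_div)
      moreover have "0 < ln (1 / r)" using r r1 by simp
      then have "ereal (ln 1) / ereal (ln (1 / r)) = 0" by simp
      ultimately have "0 \<le> ?q r 0 1" by (simp only:)
      also have "\<dots> \<le> (SUP (x, R) \<in> {(x, R). real N * r \<le> R \<and> R \<le> 1}. ?q r x R)"
        by (rule SUP_upper2[of "(0, 1)"]) (use r1 in auto)
      finally show ?thesis .
    qed
    then show "\<forall>\<^sub>F r in at_right 0. 0 \<le> (SUP (x, R) \<in> {(x, R). real N * r \<le> R \<and> R \<le> 1}. ?q r x R)"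
      unfolding eventually_at_right_field by (intro exI[of _ "1 / (real N + 1)"]) auto
  qed simp
  then show "0 \<le> dim_L (digit_grid t :: (real^'n) set)"
    unfolding dim_L_def by (intro Liminf_bounded always_eventually allI)
qed

lemma digit_grid_unbounded:
  assumes t: "0 < t" "t < 1"
  shows "\<not> bounded (digit_grid t :: (real^'n) set)"
proof
  assume "bounded (digit_grid t :: (real^'n) set)"
  then obtain R where R: "digit_grid t \<subseteq> ball (0::real^'n) R"
    using bounded_subset_ballD by blast
  have "digit_grid t \<subseteq> digit_grid t \<inter> ball (0::real^'n) (max 1 R)" using R by auto
  then have fin: "finite (digit_grid t :: (real^'n) set)"
    by (rule finite_subset) (rule digit_grid_card(1)[OF t], simp)
  let ?C = "card (digit_grid t :: (real^'n) set)"
  have "(2 ^ k) powr (real CARD('n) * t) / 2 ^ CARD('n) \<le> real ?C" for k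
  proof -
    have "card (digit_grid_piece t k :: (real^'n) set) \<le> ?C"
      using digit_grid_piece_subset by (intro card_mono fin) blast
    then show ?thesis using digit_grid_piece_card(2)[OF t, of k, where 'n='n] by linarith
  qed
  moreover have "1 < 2 powr (real CARD('n) * t)" using t by simp
  then obtain k where k: "real ?C * 2 ^ CARD('n) < (2 powr (real CARD('n) * t)) ^ k"
    using real_arch_pow by blast
  moreover have "real ?C * 2 ^ CARD('n) < (2 ^ k) powr (real CARD('n) * t)"
  proof -
    have "(2 powr (real CARD('n) * t)) ^ k = 2 powr (real CARD('n) * t * real k)"
      by (simp add: powr_realpow[symmetric] powr_powr)
    also have "\<dots> = (2 powr real k) powr (real CARD('n) * t)"
      by (simp add: powr_powr mult_ac)
    finally show ?thesis using k by (simp add: powr_realpow)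
  qed
  ultimately have "(2 ^ k) powr (real CARD('n) * t) / 2 ^ CARD('n) \<le> real ?C"
    "real ?C < (2 ^ k) powr (real CARD('n) * t) / 2 ^ CARD('n)"
    by (auto simp only: pos_less_divide_eq zero_less_power zero_less_numeral)
  then show False by linarith
qed

lemma Ints_vec_dist_ge_1:
  fixes z w :: "real^'n"
  assumes "\<And>i. z $ i \<in> \<int>" "\<And>i. w $ i \<in> \<int>" "z \<noteq> w"
  shows "1 \<le> dist z w"
proof -
  obtain i where i: "z $ i \<noteq> w $ i" using assms(3) by (auto simp: vec_eq_iff)
  have "z $ i - w $ i \<in> \<int>" using assms by auto
  then have "1 \<le> \<bar>(z - w) $ i\<bar>" using i Ints_nonzero_abs_ge1[of "z $ i - w $ i"] by simp
  also have "\<dots> \<le> norm (z - w)" by (rule component_le_norm_cart)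
  finally show ?thesis by (simp add: dist_norm)
qed

section \<open>Weak derivatives of Lipschitz maps\<close>

lemma integrable_lborel_shift_iff:
  fixes g :: "'a::euclidean_space \<Rightarrow> real"
  assumes "g \<in> borel_measurable borel"
  shows "integrable lborel (\<lambda>x. g (a + x)) \<longleftrightarrow> integrable lborel g"
  using integrable_distr_eq[of "(+) a" lborel borel g] assms by (simp add: lborel_distr_plus)

lemma integral_lborel_shift:
  fixes g :: "'a::euclidean_space \<Rightarrow> real"
  assumes "g \<in> borel_measurable borel"
  shows "(LINT x|lborel. g (a + x)) = (LINT x|lborel. g x)"
  using integral_distr[of "(+) a" lborel borel g] assms by (simp add: lborel_distr_plus)

lemma integrable_lebesgue_bounded_support:
  fixes h :: "'a::euclidean_space \<Rightarrow> real"
  assumes "h \<in> borel_measurable lebesgue" and "\<And>x. \<bar>h x\<bar> \<le> B" and "\<And>x. norm x > R \<Longrightarrow> h x = 0"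
  shows "integrable lebesgue h"
proof (rule Bochner_Integration.integrable_bound)
  show "integrable lebesgue (\<lambda>x. B * indicator (cball (0::'a) R) x)"
    using emeasure_lborel_cball_finite[of "0::'a" R] by (intro integrable_mult_right) simp
  have "norm (h x) \<le> norm (B * indicator (cball (0::'a) R) x)" for x
    using assms(2)[of x] assms(3)[of x] by (cases "norm x > R") auto
  then show "AE x in lebesgue. norm (h x) \<le> norm (B * indicator (cball (0::'a) R) x)" by simp
qed (use assms in simp)

text \<open>Translation invariance makes the integrals of the difference quotients vanish.\<close>

lemma integral_directional_derivative_eq_0:
  fixes g :: "'a::euclidean_space \<Rightarrow> real"
  assumes cont: "continuous_on UNIV g" and supp: "\<And>x. norm x > R \<Longrightarrow> g x = 0"
    and lip: "\<And>x t. 0 < t \<Longrightarrow> t \<le> 1 \<Longrightarrow> \<bar>g (x + t *\<^sub>R v) - g x\<bar> \<le> L * t"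
    and meas: "d \<in> borel_measurable lebesgue"
    and deriv: "AE x in lebesgue. ((\<lambda>t. g (x + t *\<^sub>R v)) has_real_derivative d x) (at 0)"
  shows "integrable lebesgue d" "(LINT x|lebesgue. d x) = 0"
proof -
  define t where "t k = 1 / real (Suc k)" for k
  have t: "0 < t k" "t k \<le> 1" for k by (simp_all add: t_def)
  define q where "q k x = (g (x + t k *\<^sub>R v) - g x) / t k" for k x
  have g_borel [measurable]: "g \<in> borel_measurable borel"
    by (rule borel_measurable_continuous_onI[OF cont])
  have q_borel [measurable]: "q k \<in> borel_measurable borel" for k
    unfolding q_def by measurable
  have q_leb: "q k \<in> borel_measurable lebesgue" for k
    by (rule measurable_completion) simp
  \<comment> \<open>The dominating function. Outside radius \<open>R + norm v\<close> both
    evaluation points lie outside the support, because the step is at most 1; inside, the Lipschitz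
    bound along \<open>v\<close> applies.\<close>
  have bound: "norm (q k x) \<le> L * indicator (cball 0 (R + norm v)) x" for k x
  proof (cases "norm x \<le> R + norm v")
    case True
    have "\<bar>g (x + t k *\<^sub>R v) - g x\<bar> / t k \<le> L * t k / t k"
      using lip[OF t] t[of k] by (intro divide_right_mono) auto
    moreover have "norm (q k x) = \<bar>g (x + t k *\<^sub>R v) - g x\<bar> / t k"
      unfolding q_def using t(1)[of k] by simp
    moreover have "L * t k / t k = L" using t(1)[of k] by simp
    ultimately show ?thesis using True by simp
  next
    case False
    have "norm (t k *\<^sub>R v) \<le> norm v" using t[of k] by (simp add: mult_left_le_one_le)
    then have "norm (x + t k *\<^sub>R v) > R" using False norm_diff_ineq[of x "t k *\<^sub>R v"] by linarith
    moreover have "norm x > R" using False norm_ge_zero[of v] by linarith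
    ultimately have "q k x = 0" unfolding q_def by (simp add: supp)
    then show ?thesis using False by simp
  qed
  have L: "0 \<le> L" using lip[of 1 0] by simp
  have w: "integrable lebesgue (\<lambda>x. L * indicator (cball (0::'a) (R + norm v)) x)"
    using emeasure_lborel_cball_finite[of "0::'a" "R + norm v"] by (intro integrable_mult_right) simp
  have lim: "AE x in lebesgue. (\<lambda>k. q k x) \<longlonglongrightarrow> d x"
    using deriv
  proof eventually_elim
    case (elim x)
    then have "((\<lambda>s. (g (x + s *\<^sub>R v) - g x) / s) \<longlongrightarrow> d x) (at 0)"
      by (simp add: has_field_derivative_iff)
    moreover have "filterlim t (at 0) sequentially"
      unfolding filterlim_at t_def
      using LIMSEQ_inverse_real_of_nat by (auto simp: inverse_eq_divide)
    ultimately show ?case unfolding q_def by (rule filterlim_compose)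
  qed
  note dct = integrable_dominated_convergence integral_dominated_convergence
  show "integrable lebesgue d"
    by (rule dct(1)[OF meas q_leb w lim]) (use bound in simp)
  have "(\<lambda>k. LINT x|lebesgue. q k x) \<longlonglongrightarrow> (LINT x|lebesgue. d x)"
    by (rule dct(2)[OF meas q_leb w lim]) (use bound in simp)
  \<comment> \<open>Continuity and bounded support make \<open>g\<close> integrable, so the integral
    of the quotient splits into two finite integrals that cancel.\<close>
  moreover have "(LINT x|lebesgue. q k x) = 0" for k
  proof -
    have "bounded (g ` cball 0 R)"
      by (rule compact_imp_bounded[OF compact_continuous_image[OF continuous_on_subset[OF cont]]]) auto
    then obtain B where "\<forall>y\<in>g ` cball 0 R. norm y \<le> B" unfolding bounded_iff by blast
    then have B: "\<And>x. x \<in> cball 0 R \<Longrightarrow> norm (g x) \<le> B" by blast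
    have "integrable lebesgue g"
    proof (rule integrable_lebesgue_bounded_support[where B="max B 0"])
      show "\<bar>g x\<bar> \<le> max B 0" for x using B[of x] supp[of x] by (cases "norm x \<le> R") auto
    qed (use supp in \<open>auto intro: measurable_completion\<close>)
    then have int: "integrable lborel g" by (simp add: integrable_completion)
    then have int': "integrable lborel (\<lambda>x. g (t k *\<^sub>R v + x))" by (simp add: integrable_lborel_shift_iff)
    have "(LINT x|lebesgue. q k x) = (LINT x|lborel. (g (t k *\<^sub>R v + x) - g x) / t k)"
      unfolding q_def by (subst integral_completion) (simp_all add: add.commute)
    also have "\<dots> = ((LINT x|lborel. g (t k *\<^sub>R v + x)) - (LINT x|lborel. g x)) / t k"
      using int int' by simp
    also have "\<dots> = 0" by (simp add: integral_lborel_shift)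
    finally show ?thesis .
  qed
  ultimately show "(LINT x|lebesgue. d x) = 0" by (simp add: LIMSEQ_const_iff)
qed

section \<open>Integration by parts against test functions\<close>

lemma test_functionD:
  assumes "test_function \<phi>"
  shows "(\<phi> has_derivative frechet_derivative \<phi> (at x)) (at x)"
    and "continuous_on UNIV \<phi>"
    and "continuous_on UNIV (\<lambda>x. frechet_derivative \<phi> (at x) v)"
    and "\<exists>R. \<forall>x. norm x > R \<longrightarrow> \<phi> x = 0 \<and> frechet_derivative \<phi> (at x) v = 0"
proof -
  have k: "continuously_differentiable k \<phi>" for k using assms by (simp add: test_function_def)
  show D: "(\<phi> has_derivative frechet_derivative \<phi> (at x)) (at x)" for x
    using k[of "Suc 0"] by (simp add: frechet_derivative_works)
  show "continuous_on UNIV \<phi>" using k[of 0] by simp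
  show "continuous_on UNIV (\<lambda>x. frechet_derivative \<phi> (at x) v)" using k[of "Suc 0"] by simp
  have "compact (closure {x. \<phi> x \<noteq> 0})" using assms by (simp add: test_function_def)
  then have "bounded {x. \<phi> x \<noteq> 0}" using bounded_subset closure_subset compact_imp_bounded by metis
  then obtain R where R: "\<And>x. norm x > R \<Longrightarrow> \<phi> x = 0" 
    unfolding bounded_iff by (metis mem_Collect_eq not_less)
  have "frechet_derivative \<phi> (at x) v = 0" if "norm x > R" for x
  proof -
    have "((\<lambda>_. 0) has_derivative frechet_derivative \<phi> (at x)) (at x)"
    proof (rule has_derivative_transform_within_open[OF D])
      show "open {y. norm y > R}" by (intro open_Collect_less continuous_intros)
    qed (use that R in auto)
    then have "frechet_derivative \<phi> (at x) = (\<lambda>_. 0)"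
      by (rule has_derivative_unique) (rule has_derivative_const)
    then show ?thesis by simp
  qed
  then show "\<exists>R. \<forall>x. norm x > R \<longrightarrow> \<phi> x = 0 \<and> frechet_derivative \<phi> (at x) v = 0" using R by blast
qed

lemma bounded_if_continuous_compact_support:
  fixes h :: "'a::euclidean_space \<Rightarrow> real"
  assumes "continuous_on UNIV h" "\<And>x. norm x > R \<Longrightarrow> h x = 0"
  obtains B where "0 \<le> B" "\<And>x. \<bar>h x\<bar> \<le> B"
proof -
  have "bounded (h ` cball 0 R)"
    by (rule compact_imp_bounded[OF compact_continuous_image[OF continuous_on_subset[OF assms(1)]]]) auto
  then obtain B where "\<forall>y\<in>h ` cball 0 R. norm y \<le> B" unfolding bounded_iff by blast
  then have B: "\<And>x. x \<in> cball 0 R \<Longrightarrow> norm (h x) \<le> B" by blast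
  have "\<bar>h x\<bar> \<le> max B 0" for x using B[of x] assms(2)[of x] by (cases "norm x \<le> R") auto
  then show ?thesis using that[of "max B 0"] by simp
qed

lemma directional_derivative_bound:
  fixes \<phi> :: "'a::euclidean_space \<Rightarrow> real"
  assumes D: "\<And>x. (\<phi> has_derivative \<phi>' x) (at x)" and B: "\<And>x. \<bar>\<phi>' x v\<bar> \<le> B" and t: "0 \<le> t"
  shows "\<bar>\<phi> (x + t *\<^sub>R v) - \<phi> x\<bar> \<le> B * t"
proof -
  have "((\<lambda>s. \<phi> (x + s *\<^sub>R v)) has_derivative (\<lambda>h. h * \<phi>' (x + s *\<^sub>R v) v)) (at s within {0..t})" for s
  proof -
    have "((\<lambda>s. \<phi> (x + s *\<^sub>R v)) has_derivative (\<lambda>h. \<phi>' (x + s *\<^sub>R v) (h *\<^sub>R v))) (at s within {0..t})"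
      by (rule has_derivative_compose[OF _ D]) (auto intro!: derivative_eq_intros)
    moreover have "\<phi>' y (h *\<^sub>R v) = h * \<phi>' y v" for y h
      using linear_scale[OF has_derivative_linear[OF D[of y]]] by simp
    ultimately show ?thesis by simp
  qed
  then have "norm (\<phi> (x + t *\<^sub>R v) - \<phi> (x + 0 *\<^sub>R v)) \<le> B * norm (t - 0)"
    using t B by (intro differentiable_bound[where S="{0..t}"])
      (auto intro!: onorm_le mult_right_mono simp: abs_mult mult.commute[of B] mult_left_mono)
  then show ?thesis using t by simp
qed

lemma absolutely_integrable_if_bounded_entries:
  fixes D :: "real^'n \<Rightarrow> real^'n^'n"
  assumes meas: "\<And>i j. (\<lambda>x. D x $ i $ j) \<in> borel_measurable lebesgue"
    and bound: "\<And>x i j. \<bar>D x $ i $ j\<bar> \<le> B"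
  shows "locally_integrable D"
  unfolding locally_integrable_def
proof (intro allI impI)
  fix K :: "(real^'n) set" assume K: "compact K"
  have eq: "D x \<bullet> b = D x $ i $ j" if "b = axis i (axis j 1)" for x b i j
    using that by (simp add: inner_axis)
  have "(\<lambda>x. D x \<bullet> b) \<in> borel_measurable lebesgue" if b: "b \<in> Basis" for b
  proof -
    obtain i u where "b = axis i u" "u \<in> (Basis :: (real^'n) set)"
      using b unfolding Basis_vec_def[where 'a="real^'n"] by blast
    moreover from this obtain j where "u = axis j 1"
      unfolding Basis_vec_def[where 'a=real] by auto
    ultimately have "b = axis i (axis j 1)" by simp
    then show ?thesis using meas eq by simp
  qed
  then have Dm: "D \<in> borel_measurable lebesgue" by (subst borel_measurable_euclidean_space) auto
  have KS: "K \<in> sets lebesgue" using K by (simp add: compact_imp_closed)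
  show "D absolutely_integrable_on K"
  proof (rule measurable_bounded_by_integrable_imp_absolutely_integrable[OF _ KS])
    show "D \<in> borel_measurable (lebesgue_on K)" using Dm by (rule measurable_restrict_space1)
    show "(\<lambda>_. real CARD('n) * (real CARD('n) * B)) integrable_on K"
      using K by (intro integrable_on_const lmeasurable_compact)
    fix x
    have "norm (D x $ i) \<le> real CARD('n) * B" for i
    proof -
      have "norm (D x $ i) \<le> (\<Sum>j\<in>UNIV. \<bar>D x $ i $ j\<bar>)" by (rule norm_le_l1_cart)
      also have "\<dots> \<le> (\<Sum>j\<in>(UNIV :: 'n set). B)" by (intro sum_mono bound)
      finally show ?thesis by simp
    qed
    moreover have "norm (D x) \<le> (\<Sum>i\<in>UNIV. norm (D x $ i))"
      unfolding norm_vec_def by (rule L2_set_le_sum) simp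
    ultimately have "norm (D x) \<le> (\<Sum>i\<in>(UNIV :: 'n set). real CARD('n) * B)"
      by (meson order_trans sum_mono)
    then show "norm (D x) \<le> real CARD('n) * (real CARD('n) * B)" by simp
  qed
qed

text \<open>For \<open>g = f_i * \<phi>\<close> the product rule gives, almost everywhere, the
  directional derivative \<open>f_i * \<phi>' + D_ij * \<phi>\<close>. Its integral vanishes by
  translation invariance, and splitting that integral is the integration by parts formula. The
  Lipschitz bound supplies the domination that lets an almost everywhere derivative suffice.\<close>

lemma has_weak_derivativeI:
  fixes f :: "real^'n \<Rightarrow> real^'n"
  assumes lip: "L-lipschitz_on UNIV f"
    and meas: "\<And>i j. (\<lambda>x. D x $ i $ j) \<in> borel_measurable lebesgue"
    and bound: "\<And>x i j. \<bar>D x $ i $ j\<bar> \<le> B"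
    and deriv: "AE x in lebesgue. (f has_derivative ((*v) (D x))) (at x)"
  shows "has_weak_derivative f D"
proof -
  have contf: "continuous_on UNIV f" by (rule lipschitz_on_continuous_on[OF lip])
  have contf_i: "continuous_on UNIV (\<lambda>x. f x $ i)" for i
    using contf by (intro continuous_intros)
  have "locally_integrable f"
    unfolding locally_integrable_def
  proof (intro allI impI)
    fix K :: "(real^'n) set" assume "compact K"
    then show "f absolutely_integrable_on K"
      unfolding set_integrable_def
      using borel_integrable_compact[OF \<open>compact K\<close> continuous_on_subset[OF contf]]
      by (subst integrable_completion) (auto dest: borel_measurable_integrable)
  qed
  moreover have "(LINT x|lebesgue. f x $ i * frechet_derivative \<phi> (at x) (axis j 1)) =
        - (LINT x|lebesgue. D x $ i $ j * \<phi> x)" if \<phi>: "test_function \<phi>" for \<phi> i j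
  proof -
    let ?v = "axis j 1 :: real^'n"
    let ?\<phi>' = "\<lambda>x. frechet_derivative \<phi> (at x) ?v"
    obtain R where R: "\<And>x. norm x > R \<Longrightarrow> \<phi> x = 0" "\<And>x. norm x > R \<Longrightarrow> ?\<phi>' x = 0"
      using test_functionD(4)[OF \<phi>] by blast
    obtain B1 where B1: "0 \<le> B1" "\<And>x. \<bar>\<phi> x\<bar> \<le> B1"
      using bounded_if_continuous_compact_support[OF test_functionD(2)[OF \<phi>] R(1)] by blast
    obtain B2 where B2: "0 \<le> B2" "\<And>x. \<bar>?\<phi>' x\<bar> \<le> B2"
      using bounded_if_continuous_compact_support[OF test_functionD(3)[OF \<phi>] R(2)] by blast
    \<comment> \<open>Radius \<open>R + 1\<close>: the Lipschitz estimate for \<open>g\<close>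
      evaluates \<open>f\<close> at a point moved by at most 1, while \<open>x\<close> or that point
      may lie anywhere in the ball of radius \<open>R\<close>.\<close>
    have "bounded ((\<lambda>x. f x $ i) ` cball 0 (R + 1))"
      by (rule compact_imp_bounded[OF compact_continuous_image[OF continuous_on_subset[OF contf_i]]]) auto
    then obtain M' where "\<forall>y\<in>(\<lambda>x. f x $ i) ` cball 0 (R + 1). norm y \<le> M'"
      unfolding bounded_iff by blast
    then have M': "\<And>x. x \<in> cball 0 (R + 1) \<Longrightarrow> \<bar>f x $ i\<bar> \<le> M'" by simp
    define M where "M = max M' 0"
    have M: "0 \<le> M" "\<And>x. x \<in> cball 0 (R + 1) \<Longrightarrow> \<bar>f x $ i\<bar> \<le> M"
      using M' by (auto simp: M_def le_max_iff_disj)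
    have L: "0 \<le> L" using lip by (rule lipschitz_on_nonneg)
    have nv: "norm ?v = 1" by simp
    define g where "g x = f x $ i * \<phi> x" for x
    define d1 where "d1 x = f x $ i * ?\<phi>' x" for x
    define d2 where "d2 x = D x $ i $ j * \<phi> x" for x
    have "AE x in lebesgue. ((\<lambda>t. g (x + t *\<^sub>R ?v)) has_real_derivative d1 x + d2 x) (at 0)"
      using deriv
    proof eventually_elim
      case (elim x)
      have line: "((\<lambda>t. x + t *\<^sub>R ?v) has_derivative (\<lambda>t. t *\<^sub>R ?v)) (at 0)"
        by (auto intro!: derivative_eq_intros)
      have "((\<lambda>t. f (x + t *\<^sub>R ?v)) has_derivative (\<lambda>t. D x *v (t *\<^sub>R ?v))) (at 0)"
        by (rule has_derivative_compose[OF line]) (use elim in simp)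
      then have "((\<lambda>t. f (x + t *\<^sub>R ?v) $ i) has_derivative (\<lambda>t. (D x *v (t *\<^sub>R ?v)) $ i)) (at 0)"
        by (rule bounded_linear.has_derivative[OF bounded_linear_vec_nth])
      moreover have "(\<lambda>t. (D x *v (t *\<^sub>R ?v)) $ i) = (*) (D x $ i $ j)"
        by (simp add: fun_eq_iff matrix_vector_mult_scaleR matrix_vector_mul_component inner_axis mult.commute)
      ultimately have 1: "((\<lambda>t. f (x + t *\<^sub>R ?v) $ i) has_real_derivative D x $ i $ j) (at 0)"
        by (simp add: has_field_derivative_def)
      have "((\<lambda>t. \<phi> (x + t *\<^sub>R ?v)) has_derivative (\<lambda>t. frechet_derivative \<phi> (at x) (t *\<^sub>R ?v))) (at 0)"
        by (rule has_derivative_compose[OF line]) (use test_functionD(1)[OF \<phi>, of x] in simp)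
      moreover have "(\<lambda>t. frechet_derivative \<phi> (at x) (t *\<^sub>R ?v)) = (*) (?\<phi>' x)"
        using linear_scale[OF has_derivative_linear[OF test_functionD(1)[OF \<phi>, of x]]]
        by (simp add: fun_eq_iff mult.commute)
      ultimately have 2: "((\<lambda>t. \<phi> (x + t *\<^sub>R ?v)) has_real_derivative ?\<phi>' x) (at 0)"
        by (simp add: has_field_derivative_def)
      show ?case unfolding g_def d1_def d2_def
        using DERIV_mult[OF 1 2] by (simp add: mult.commute add.commute)
    qed
    moreover have "\<bar>g (x + t *\<^sub>R ?v) - g x\<bar> \<le> (M * B2 + B1 * L) * t" if t: "0 < t" "t \<le> 1" for x t
    proof (cases "norm x > R \<and> norm (x + t *\<^sub>R ?v) > R")
      case True
      then have "g (x + t *\<^sub>R ?v) = 0" "g x = 0" by (simp_all add: g_def R(1))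
      then show ?thesis using M(1) B1 B2 L t by simp
    next
      case False
      have "norm (t *\<^sub>R ?v) \<le> 1" using t by simp
      then have "norm (x + t *\<^sub>R ?v) \<le> R + 1"
        using False norm_triangle_ineq[of x "t *\<^sub>R ?v"] by linarith
      then have fM: "\<bar>f (x + t *\<^sub>R ?v) $ i\<bar> \<le> M" using M by simp
      have "g (x + t *\<^sub>R ?v) - g x =
          f (x + t *\<^sub>R ?v) $ i * (\<phi> (x + t *\<^sub>R ?v) - \<phi> x) + \<phi> x * (f (x + t *\<^sub>R ?v) - f x) $ i"
        by (simp add: g_def algebra_simps)
      also have "\<bar>\<dots>\<bar> \<le> \<bar>f (x + t *\<^sub>R ?v) $ i\<bar> * \<bar>\<phi> (x + t *\<^sub>R ?v) - \<phi> x\<bar> + \<bar>\<phi> x\<bar> * \<bar>(f (x + t *\<^sub>R ?v) - f x) $ i\<bar>"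
        by (intro order_trans[OF abs_triangle_ineq]) (simp add: abs_mult)
      also have "\<dots> \<le> M * (B2 * t) + B1 * (L * t)"
      proof (intro add_mono mult_mono)
        show "\<bar>\<phi> (x + t *\<^sub>R ?v) - \<phi> x\<bar> \<le> B2 * t"
          by (rule directional_derivative_bound[OF test_functionD(1)[OF \<phi>] B2(2)]) (use t in simp)
        have "\<bar>(f (x + t *\<^sub>R ?v) - f x) $ i\<bar> \<le> norm (f (x + t *\<^sub>R ?v) - f x)"
          by (rule component_le_norm_cart)
        also have "\<dots> \<le> L * t"
          using lipschitz_onD[OF lip, of "x + t *\<^sub>R ?v" x] t by (simp add: dist_norm)
        finally show "\<bar>(f (x + t *\<^sub>R ?v) - f x) $ i\<bar> \<le> L * t" .
      qed (use fM B1 B2 t in auto)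
      finally show ?thesis by (simp add: algebra_simps)
    qed
    moreover have "continuous_on UNIV g" unfolding g_def
      by (intro continuous_intros contf_i test_functionD(2)[OF \<phi>])
    moreover have g0: "g x = 0" if "norm x > R" for x using R(1)[OF that] by (simp add: g_def)
    moreover have d1c: "continuous_on UNIV d1" unfolding d1_def
      by (intro continuous_intros contf_i test_functionD(3)[OF \<phi>])
    have leb: "h \<in> borel_measurable lebesgue" if "continuous_on UNIV h" for h :: "real^'n \<Rightarrow> real"
      using borel_measurable_continuous_onI[OF that] by (intro measurable_completion) simp
    have d1m: "d1 \<in> borel_measurable lebesgue" by (rule leb[OF d1c])
    have d2m: "d2 \<in> borel_measurable lebesgue" unfolding d2_def
      by (intro borel_measurable_times meas leb test_functionD(2)[OF \<phi>])
    have "(\<lambda>x. d1 x + d2 x) \<in> borel_measurable lebesgue"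
      using d1m d2m by (rule borel_measurable_add)
    ultimately have zero: "(LINT x|lebesgue. d1 x + d2 x) = 0"
      by (intro integral_directional_derivative_eq_0(2)[where g=g and v="?v" and L="M * B2 + B1 * L" and R=R]) auto
    have d10: "d1 x = 0" if "norm x > R" for x using R(2)[OF that] by (simp add: d1_def)
    obtain B3 where B3: "0 \<le> B3" "\<And>x. \<bar>d1 x\<bar> \<le> B3"
      using bounded_if_continuous_compact_support[OF d1c d10] by blast
    have int1: "integrable lebesgue d1"
      by (rule integrable_lebesgue_bounded_support[OF d1m B3(2) d10])
    have int2: "integrable lebesgue d2"
    proof (rule integrable_lebesgue_bounded_support[OF d2m])
      show "\<bar>d2 x\<bar> \<le> B * B1" for x
        using bound[of x i j] B1(2)[of x] unfolding d2_def abs_mult by (intro mult_mono) auto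
      show "d2 x = 0" if "norm x > R" for x using R(1)[OF that] by (simp add: d2_def)
    qed
    have "(LINT x|lebesgue. d1 x) + (LINT x|lebesgue. d2 x) = 0"
      unfolding zero[symmetric] by (rule Bochner_Integration.integral_add[OF int1 int2, symmetric])
    then show ?thesis unfolding d1_def d2_def by (rule add_eq_0_iff2[THEN iffD1])
  qed
  ultimately show ?thesis
    unfolding has_weak_derivative_def using absolutely_integrable_if_bounded_entries[OF meas bound] by blast
qed

section \<open>The squeezing map of a separated set\<close>

text \<open>The map \<open>2 \<bar>y\<bar> y\<close> on the ball of radius 1/2; the
  \<open>min\<close> glues it continuously to the identity outside.\<close>

definition radial_square :: "real^'n \<Rightarrow> real^'n" where
  "radial_square y = min 1 (2 * norm y) *\<^sub>R y"

text \<open>The Jacobian matrix of \<open>2 \<bar>y\<bar> y\<close>, namely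
  \<open>2 \<bar>y\<bar>\<close> times the identity plus the rank one matrix
  \<open>2 y y^T / \<bar>y\<bar>\<close>. At \<open>y = 0\<close> division by zero yields the zero
  matrix.\<close>

definition radial_square_deriv :: "real^'n \<Rightarrow> real^'n^'n" where
  "radial_square_deriv y = (\<chi> i j. (if i = j then 2 * norm y else 0) + 2 * y $ i * y $ j / norm y)"

lemma radial_square_deriv_apply:
  "radial_square_deriv y *v h = (2 * norm y) *\<^sub>R h + (2 * (y \<bullet> h) / norm y) *\<^sub>R y"
proof -
  have "(\<Sum>j\<in>UNIV. ((if i = j then 2 * norm y else 0) + 2 * y $ i * y $ j / norm y) * h $ j)
      = 2 * norm y * h $ i + 2 * (y \<bullet> h) / norm y * y $ i" for i
  proof -
    have "(\<Sum>j\<in>UNIV. ((if i = j then 2 * norm y else 0) + 2 * y $ i * y $ j / norm y) * h $ j)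
      = (\<Sum>j\<in>UNIV. (if i = j then 2 * norm y * h $ j else 0)) + (\<Sum>j\<in>UNIV. (2 * y $ i / norm y) * (y $ j * h $ j))"
      unfolding sum.distrib[symmetric] by (intro sum.cong) (auto simp: algebra_simps)
    also have "\<dots> = 2 * norm y * h $ i + (2 * y $ i / norm y) * (y \<bullet> h)"
      unfolding sum_distrib_left[symmetric] by (simp add: inner_vec_def)
    finally show ?thesis by simp
  qed
  then show ?thesis by (simp add: vec_eq_iff matrix_vector_mult_def radial_square_deriv_def)
qed

lemma radial_square_has_derivative:
  assumes "y \<noteq> 0"
  shows "((\<lambda>y. (2 * norm y) *\<^sub>R y) has_derivative ((*v) (radial_square_deriv y))) (at y)"
proof -
  have "((\<lambda>y. (2 * norm y) *\<^sub>R y) has_derivative (\<lambda>h. (2 * norm y) *\<^sub>R h + (2 * (h \<bullet> sgn y)) *\<^sub>R y)) (at y)"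
    by (auto intro!: derivative_eq_intros has_derivative_norm[OF assms])
  moreover have "(\<lambda>h. (2 * norm y) *\<^sub>R h + (2 * (h \<bullet> sgn y)) *\<^sub>R y) = (*v) (radial_square_deriv y)"
    by (simp add: fun_eq_iff radial_square_deriv_apply sgn_div_norm inner_commute divide_inverse mult_ac)
  ultimately show ?thesis by simp
qed

text \<open>In an orthonormal basis starting with \<open>y / norm y\<close> the matrix is diagonal.\<close>

lemma det_radial_square_deriv: "det (radial_square_deriv (y :: real^'n)) = 2 * (2 * norm y) ^ CARD('n)"
proof (cases "y = 0")
  case True
  then have "radial_square_deriv y = 0" by (simp add: radial_square_deriv_def vec_eq_iff)
  moreover have "(0::real) ^ CARD('n) = 0" by simp
  moreover have "det (0 :: real^'n^'n) = 0"
    by (rule det_zero_row(1)[of undefined]) (simp add: row_def vec_eq_iff)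
  ultimately show ?thesis using True by simp
next
  case False
  define u where "u = y /\<^sub>R norm y"
  have u: "norm u = 1" "y = norm y *\<^sub>R u" using False by (simp_all add: u_def)
  \<comment> \<open>An arbitrary index, whose axis is rotated onto the radial direction
    \<open>u\<close>.\<close>
  obtain k :: 'n where True by simp
  obtain Q :: "real^'n^'n" where Q: "orthogonal_matrix Q" "Q *v axis k 1 = u"
    using orthogonal_matrix_exists_basis[OF u(1)] .
  \<comment> \<open>The radial eigenvalue is \<open>4 \<bar>y\<bar>\<close>, the slope of
    \<open>2 s^2\<close> at \<open>s = \<bar>y\<bar>\<close>; the tangential ones are
    \<open>2 \<bar>y\<bar>\<close>.\<close>
  define \<Delta> :: "real^'n^'n" where
    "\<Delta> = (\<chi> i j. if i = j then (if i = k then 4 * norm y else 2 * norm y) else 0)"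
  have inner_Q: "u \<bullet> (Q *v h) = h $ k" for h
  proof -
    have "orthogonal_transformation ((*v) Q)" using Q(1) by (simp add: orthogonal_transformation_matrix)
    then have "(Q *v axis k 1) \<bullet> (Q *v h) = axis k 1 \<bullet> h" by (simp add: orthogonal_transformation_def)
    then show ?thesis by (simp add: Q(2) inner_axis')
  qed
  have \<Delta>: "\<Delta> *v h = (2 * norm y) *\<^sub>R h + (2 * norm y * h $ k) *\<^sub>R axis k 1" for h
    by (auto simp: vec_eq_iff matrix_vector_mult_def \<Delta>_def axis_def if_distrib[of "\<lambda>a. a * _"] cong: if_cong)
  have "(radial_square_deriv y ** Q) *v h = (Q ** \<Delta>) *v h" for h
  proof -
    have yQ: "y \<bullet> (Q *v h) = norm y * h $ k" by (subst u(2)) (simp add: inner_Q)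
    have "(radial_square_deriv y ** Q) *v h = (2 * norm y) *\<^sub>R (Q *v h) + (2 * h $ k) *\<^sub>R y"
      using False by (simp add: matrix_vector_mul_assoc[symmetric] radial_square_deriv_apply yQ)
    also have "(2 * h $ k) *\<^sub>R y = (2 * norm y * h $ k) *\<^sub>R u" by (subst u(2)) simp
    also have "(2 * norm y) *\<^sub>R (Q *v h) + (2 * norm y * h $ k) *\<^sub>R u = (Q ** \<Delta>) *v h"
      by (simp add: matrix_vector_mul_assoc[symmetric] \<Delta> matrix_vector_right_distrib matrix_vector_mult_scaleR Q(2))
    finally show ?thesis .
  qed
  then have "radial_square_deriv y ** Q = Q ** \<Delta>" by (simp add: matrix_eq)
  then have "det (radial_square_deriv y) * det Q = det Q * det \<Delta>" by (metis det_mul)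
  moreover have "det Q \<noteq> 0" using det_orthogonal_matrix[OF Q(1)] by auto
  ultimately have "det (radial_square_deriv y) = det \<Delta>" by simp
  also have "\<dots> = (\<Prod>i\<in>UNIV. \<Delta> $ i $ i)" by (rule det_diagonal) (simp add: \<Delta>_def)
  also have "\<dots> = (\<Prod>i\<in>UNIV. (if i = k then 2 else 1) * (2 * norm y))"
    by (intro prod.cong) (auto simp: \<Delta>_def)
  also have "\<dots> = 2 * (2 * norm y) ^ CARD('n)" by (simp add: prod.distrib)
  finally show ?thesis .
qed

lemma norm_radial_square_deriv_le: "norm (radial_square_deriv y *v h) \<le> 4 * norm y * norm h"
proof -
  have "norm ((2 * (y \<bullet> h) / norm y) *\<^sub>R y) \<le> 2 * norm y * norm h"
    using Cauchy_Schwarz_ineq2[of y h] by (cases "y = 0") auto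
  moreover have "norm ((2 * norm y) *\<^sub>R h) = 2 * norm y * norm h" by simp
  ultimately show ?thesis unfolding radial_square_deriv_apply
    by (intro order_trans[OF norm_triangle_ineq]) linarith
qed

lemma norm_radial_square: "norm (radial_square y) = min 1 (2 * norm y) * norm y"
  by (simp add: radial_square_def)

lemma radial_square_eq_self: "1/2 \<le> norm y \<Longrightarrow> radial_square y = y"
  by (simp add: radial_square_def)

lemma norm_radial_square_less_half: "norm (radial_square y) < 1/2 \<longleftrightarrow> norm y < 1/2"
proof
  assume "norm y < 1/2"
  then have "min 1 (2 * norm y) * norm y \<le> 1 * norm y" by (intro mult_right_mono) auto
  then show "norm (radial_square y) < 1/2" using \<open>norm y < 1/2\<close> by (simp add: norm_radial_square)
next
  assume "norm (radial_square y) < 1/2"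
  then show "norm y < 1/2" using radial_square_eq_self[of y] by force
qed

text \<open>The displacement is treated instead of the map because it vanishes outside the ball of
  radius 1/2, so that displacements around different centres can be combined. It equals
  \<open>- m(y) y\<close>, where \<open>m\<close> has values in \<open>[0, 1]\<close> and Lipschitz
  constant 2; as \<open>\<bar>y\<bar> < 1/2\<close> on the support, the product estimate gives
  \<open>1 + 2 * (1/2) = 2\<close>.\<close>

lemma radial_square_displacement_lipschitz:
  fixes x y :: "real^'n"
  shows "norm ((radial_square x - x) - (radial_square y - y)) \<le> 2 * norm (x - y)"
proof -
  define m where "m x = max 0 (1 - 2 * norm x)" for x :: "real^'n"
  have eq: "radial_square x - x = - (m x *\<^sub>R x)" for x :: "real^'n"
  proof -
    have "min 1 (2 * norm x) = 1 - m x" by (simp add: m_def)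
    then show ?thesis unfolding radial_square_def by (simp only: scaleR_diff_left) simp
  qed
  have *: "norm (m x *\<^sub>R x - m y *\<^sub>R y) \<le> 2 * norm (x - y)" if y: "norm y < 1/2" for x y :: "real^'n"
  proof -
    have "\<bar>m x - m y\<bar> \<le> 2 * norm (x - y)"
      using norm_triangle_ineq3[of x y] unfolding m_def by (simp add: max_def abs_if split: if_splits)
    have "m x *\<^sub>R x - m y *\<^sub>R y = m x *\<^sub>R (x - y) + (m x - m y) *\<^sub>R y" by (simp add: algebra_simps)
    also have "norm \<dots> \<le> norm (m x *\<^sub>R (x - y)) + norm ((m x - m y) *\<^sub>R y)" by (rule norm_triangle_ineq)
    also have "\<dots> = m x * norm (x - y) + \<bar>m x - m y\<bar> * norm y" by (simp add: m_def)
    also have "\<dots> \<le> 1 * norm (x - y) + (2 * norm (x - y)) * (1/2)"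
      using \<open>\<bar>m x - m y\<bar> \<le> 2 * norm (x - y)\<close> y by (intro add_mono mult_mono) (auto simp: m_def)
    finally show ?thesis by simp
  qed
  have "norm (m x *\<^sub>R x - m y *\<^sub>R y) \<le> 2 * norm (x - y)"
  proof (cases "norm y < 1/2")
    case False
    show ?thesis
    proof (cases "norm x < 1/2")
      case True
      then show ?thesis using *[OF True, of y] by (simp add: norm_minus_commute)
    qed (use False in \<open>simp add: m_def\<close>)
  qed (rule *)
  then show ?thesis by (simp add: eq norm_minus_commute)
qed

lemma radial_square_inj:
  assumes "norm x < 1/2" "norm y < 1/2" "radial_square x = radial_square y"
  shows "x = y"
proof -
  have eq: "(2 * norm x) *\<^sub>R x = (2 * norm y) *\<^sub>R y" using assms by (simp add: radial_square_def min_def)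
  then have "norm ((2 * norm x) *\<^sub>R x) = norm ((2 * norm y) *\<^sub>R y)" by simp
  then have "norm x ^ 2 = norm y ^ 2" by (simp add: power2_eq_square)
  then have "norm x = norm y" by simp
  then show ?thesis using eq by (cases "x = 0") auto
qed

lemma radial_square_surj:
  assumes "norm y < 1/2"
  obtains x where "norm x < 1/2" "radial_square x = y"
proof (cases "y = 0")
  case True
  then show ?thesis using that[of 0] by (simp add: radial_square_def)
next
  case False
  \<comment> \<open>With \<open>x = y / s\<close>, the equation \<open>2 \<bar>x\<bar> x = y\<close>
    requires \<open>2 \<bar>y\<bar> / s = s\<close>.\<close>
  define s where "s = sqrt (2 * norm y)"
  have s: "0 < s" "s * s = 2 * norm y" using False by (simp_all add: s_def)
  have "s < 1" using assms by (simp add: s_def real_sqrt_lt_1_iff)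
  have n: "norm ((1 / s) *\<^sub>R y) = s / 2" using s by (simp add: field_simps)
  have "min 1 (2 * norm ((1 / s) *\<^sub>R y)) = s" unfolding n using \<open>s < 1\<close> by simp
  then have "radial_square ((1 / s) *\<^sub>R y) = y"
    unfolding radial_square_def using s(1) by simp
  moreover have "norm ((1 / s) *\<^sub>R y) < 1/2" unfolding n using \<open>s < 1\<close> by simp
  ultimately show ?thesis using that by blast
qed

section \<open>The squeezing homeomorphism of a separated set\<close>

locale separated_set =
  fixes E :: "(real^'n) set"
  assumes separated: "\<And>z w. z \<in> E \<Longrightarrow> w \<in> E \<Longrightarrow> z \<noteq> w \<Longrightarrow> 1 \<le> dist z w"
    and nonempty: "E \<noteq> {}" and countable: "countable E"
begin

definition tube :: "(real^'n) set" where
  "tube = (\<Union>z\<in>E. ball z (1/2))"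

text \<open>By separation the balls of radius 1/2 are disjoint, so the choice is unique. Off the
  tube the value \<open>x\<close> makes the offset \<open>x - center x\<close> vanish.\<close>

definition center :: "real^'n \<Rightarrow> real^'n" where
  "center x = (if x \<in> tube then SOME z. z \<in> E \<and> dist z x < 1/2 else x)"

definition squeeze :: "real^'n \<Rightarrow> real^'n" where
  "squeeze x = center x + radial_square (x - center x)"

definition squeeze_deriv :: "real^'n \<Rightarrow> real^'n^'n" where
  "squeeze_deriv x = (if x \<in> tube then radial_square_deriv (x - center x) else mat 1)"

lemma closed_E: "closed E"
  by (rule discrete_imp_closed[of 1]) (simp, metis separated dist_commute dist_norm not_less)

lemma ball_disjoint:
  assumes "z \<in> E" "w \<in> E" "dist z x < 1/2" "z \<noteq> w"
  shows "1/2 \<le> dist w x"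
  using separated[OF assms(1,2,4)] dist_triangle2[of z w x] assms(3) by linarith

lemma center_eq:
  assumes "z \<in> E" "dist z x < 1/2"
  shows "center x = z"
proof -
  have "(SOME z. z \<in> E \<and> dist z x < 1/2) = z"
    using assms ball_disjoint by (intro some_equality) force+
  then show ?thesis using assms by (auto simp: center_def tube_def)
qed

text \<open>Off the tube the formula holds for every \<open>z\<close> in \<open>E\<close>, because
  \<open>radial_square\<close> is the identity there. A point inside a ball and a point off the tube
  can thus be compared using the same \<open>z\<close>.\<close>

lemma squeeze_eq:
  assumes "z \<in> E" "dist z x < 1/2 \<or> x \<notin> tube"
  shows "squeeze x = z + radial_square (x - z)"
proof (cases "dist z x < 1/2")
  case True
  then show ?thesis using center_eq assms by (simp add: squeeze_def)
next
  case False
  then have "squeeze x = x" using assms by (simp add: squeeze_def center_def radial_square_def)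
  moreover have "radial_square (x - z) = x - z"
    using False by (intro radial_square_eq_self) (simp add: dist_norm norm_minus_commute)
  ultimately show ?thesis by simp
qed

lemma squeeze_outside: "x \<notin> tube \<Longrightarrow> squeeze x = x"
  by (simp add: squeeze_def center_def radial_square_def)

text \<open>If the two points share a centre, or one of them lies off the tube, a single radial
  displacement gives the constant 2. For different centres \<open>z\<close> and \<open>w\<close>,
  the displacement around each centre vanishes at the point belonging to the other; inserting these
  zeros leaves the sum of two radial displacement differences, hence 4.\<close>

lemma squeeze_displacement_lipschitz: "norm ((squeeze x - x) - (squeeze y - y)) \<le> 4 * norm (x - y)"
proof -
  let ?g = "\<lambda>y. radial_square y - y"
  have g_eq: "squeeze x - x = ?g (x - z)" if "z \<in> E" "dist z x < 1/2 \<or> x \<notin> tube" for x z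
    using squeeze_eq[OF that] by simp
  have g_0: "?g (x - w) = 0" if "z \<in> E" "w \<in> E" "dist z x < 1/2" "z \<noteq> w" for x z w
    using radial_square_eq_self[of "x - w"] ball_disjoint[OF that] by (simp add: dist_norm norm_minus_commute)
  have lip: "norm (?g (x - z) - ?g (y - z)) \<le> 2 * norm (x - y)" for x y z :: "real^'n"
    using radial_square_displacement_lipschitz[of "x - z" "y - z"] by simp
  have one: "norm ((squeeze x - x) - (squeeze y - y)) \<le> 4 * norm (x - y)"
    if "x \<in> tube" "y \<notin> tube" for x y
  proof -
    obtain z where z: "z \<in> E" "dist z x < 1/2" using \<open>x \<in> tube\<close> by (auto simp: tube_def)
    have eqs: "squeeze x - x = ?g (x - z)" "squeeze y - y = ?g (y - z)"
      using g_eq[OF z(1), of x] g_eq[OF z(1), of y] z that by auto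
    show ?thesis unfolding eqs using lip[of x z y] norm_ge_zero[of "x - y"] by linarith
  qed
  consider "x \<in> tube" "y \<notin> tube" | "x \<notin> tube" "y \<in> tube" | "x \<notin> tube" "y \<notin> tube" | "x \<in> tube" "y \<in> tube"
    by blast
  then show ?thesis
  proof cases
    case 1
    then show ?thesis by (rule one)
  next
    case 2
    then show ?thesis using one[of y x] by (metis norm_minus_commute)
  next
    case 3
    then show ?thesis by (simp add: squeeze_outside)
  next
    case 4
    then obtain z w where zw: "z \<in> E" "dist z x < 1/2" "w \<in> E" "dist w y < 1/2" by (auto simp: tube_def)
    have eqs: "squeeze x - x = ?g (x - z)" "squeeze y - y = ?g (y - w)" using g_eq zw by auto
    show ?thesis
    proof (cases "z = w")
      case True
      show ?thesis unfolding eqs True[symmetric] using lip[of x z y] norm_ge_zero[of "x - y"] by linarith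
    next
      case False
      have "?g (x - w) = 0" "?g (y - z) = 0" using g_0 zw False by blast+
      then have "?g (x - z) - ?g (y - w) = (?g (x - z) - ?g (y - z)) + (?g (x - w) - ?g (y - w))" by simp
      also have "norm \<dots> \<le> 2 * norm (x - y) + 2 * norm (x - y)"
        by (intro order_trans[OF norm_triangle_ineq] add_mono lip)
      finally show ?thesis unfolding eqs by simp
    qed
  qed
qed

lemma squeeze_lipschitz: "5-lipschitz_on UNIV squeeze"
proof (rule lipschitz_onI)
  fix x y
  have "squeeze x - squeeze y = ((squeeze x - x) - (squeeze y - y)) + (x - y)" by simp
  then have "norm (squeeze x - squeeze y) \<le> norm ((squeeze x - x) - (squeeze y - y)) + norm (x - y)"
    by (metis norm_triangle_ineq)
  then show "dist (squeeze x) (squeeze y) \<le> 5 * dist x y"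
    using squeeze_displacement_lipschitz[of x y] by (simp add: dist_norm)
qed simp

text \<open>Invariance of each ball of radius 1/2 reduces bijectivity of \<open>squeeze\<close> to
  that of the radial map on a single ball.\<close>

lemma dist_squeeze_less_half:
  assumes "z \<in> E"
  shows "dist z (squeeze x) < 1/2 \<longleftrightarrow> dist z x < 1/2"
proof (cases "dist z x < 1/2 \<or> x \<notin> tube")
  case True
  then have "dist z (squeeze x) = norm (radial_square (x - z))"
    using squeeze_eq[OF assms True] by (simp add: dist_norm)
  then have "dist z (squeeze x) < 1/2 \<longleftrightarrow> norm (x - z) < 1/2"
    by (simp only: norm_radial_square_less_half)
  then show ?thesis by (simp only: dist_norm norm_minus_commute[of z x])
next
  case False
  then obtain w where w: "w \<in> E" "dist w x < 1/2" by (auto simp: tube_def)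
  have "dist w (squeeze x) = norm (radial_square (x - w))"
    using squeeze_eq[of w x] w by (simp add: dist_norm)
  then have "dist w (squeeze x) < 1/2"
    using w(2) by (simp only: norm_radial_square_less_half dist_norm norm_minus_commute[of w x])
  then have "1/2 \<le> dist z (squeeze x)" using ball_disjoint[of w z] w assms False by metis
  then show ?thesis using False by simp
qed

lemma squeeze_tube_iff: "squeeze x \<in> tube \<longleftrightarrow> x \<in> tube"
  using dist_squeeze_less_half by (auto simp: tube_def)

lemma inj_squeeze: "inj squeeze"
proof (rule injI)
  fix x y assume eq: "squeeze x = squeeze y"
  show "x = y"
  proof (cases "x \<in> tube")
    case True
    then obtain z where z: "z \<in> E" "dist z x < 1/2" by (auto simp: tube_def)
    then have zy: "dist z y < 1/2" using dist_squeeze_less_half[OF z(1)] eq by metis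
    have eq': "radial_square (x - z) = radial_square (y - z)"
      using eq squeeze_eq[OF z(1), of x] squeeze_eq[OF z(1), of y] z zy by simp
    have "norm (x - z) < 1/2" "norm (y - z) < 1/2"
      using z(2) zy by (simp_all only: dist_norm norm_minus_commute[of z])
    then have "x - z = y - z" using eq' by (rule radial_square_inj)
    then show ?thesis by simp
  next
    case False
    then have "y \<notin> tube" using eq squeeze_tube_iff by metis
    then show ?thesis using False eq squeeze_outside by metis
  qed
qed

lemma surj_squeeze: "surj squeeze"
proof -
  have "\<exists>x. squeeze x = y" for y
  proof (cases "y \<in> tube")
    case True
    then obtain z where z: "z \<in> E" "dist z y < 1/2" by (auto simp: tube_def)
    then have "norm (y - z) < 1/2" by (simp add: dist_norm norm_minus_commute)
    then obtain u where u: "norm u < 1/2" "radial_square u = y - z" by (rule radial_square_surj)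
    have "squeeze (z + u) = y" using squeeze_eq[OF z(1), of "z + u"] u by (simp add: dist_norm)
    then show ?thesis ..
  next
    case False
    then show ?thesis using squeeze_outside by blast
  qed
  then show ?thesis unfolding surj_def by metis
qed

text \<open>Invariance of domain supplies the continuity of the inverse, so no lower bound on
  distances between images is required.\<close>

lemma squeeze_homeomorphism: "\<exists>g. homeomorphism UNIV UNIV squeeze g"
proof -
  obtain g where "homeomorphism UNIV (range squeeze) squeeze g"
    using invariance_of_domain_homeomorphism[OF open_UNIV
        lipschitz_on_continuous_on[OF squeeze_lipschitz] order_refl inj_squeeze] .
  then have "homeomorphism UNIV UNIV squeeze g" unfolding surj_squeeze .
  then show ?thesis by (rule exI[of _ g])
qed

section \<open>Derivative, quasiconformality and Jacobian weight\<close>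

lemma squeeze_has_derivative:
  "AE x in lebesgue. (squeeze has_derivative ((*v) (squeeze_deriv x))) (at x)"
proof -
  \<comment> \<open>The centres and the gluing spheres; countability of \<open>E\<close> makes their
    union a null set.\<close>
  define N where "N = (\<Union>z\<in>E. sphere z (1/2) \<union> {z})"
  have "negligible (sphere z (1/2) \<union> {z})" for z :: "real^'n"
    by (intro negligible_Un negligible_sphere negligible_sing)
  then have "negligible N"
    unfolding N_def by (intro negligible_countable_Union countable_image countable) (erule imageE, simp only:)
  then have "N \<in> null_sets lebesgue" by (simp add: negligible_iff_null_sets)
  moreover have "(squeeze has_derivative ((*v) (squeeze_deriv x))) (at x)" if x: "x \<notin> N" for x
  proof (cases "x \<in> tube")
    case True
    then obtain z where z: "z \<in> E" "dist z x < 1/2" by (auto simp: tube_def)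
    have "x - z \<noteq> 0" using x z by (auto simp: N_def)
    have "((\<lambda>x. z + (2 * norm (x - z)) *\<^sub>R (x - z)) has_derivative ((*v) (radial_square_deriv (x - z)))) (at x)"
    proof -
      have "((\<lambda>x. (2 * norm (x - z)) *\<^sub>R (x - z)) has_derivative (\<lambda>h. radial_square_deriv (x - z) *v h)) (at x)"
        by (rule has_derivative_compose[of "\<lambda>x. x - z" "\<lambda>h. h", OF _ radial_square_has_derivative])
          (use \<open>x - z \<noteq> 0\<close> in \<open>auto intro!: derivative_eq_intros\<close>)
      from has_derivative_add[OF has_derivative_const this, of z] show ?thesis by simp
    qed
    then have "(squeeze has_derivative ((*v) (radial_square_deriv (x - z)))) (at x)"
    proof (rule has_derivative_transform_within_open)
      show "open (ball z (1/2))" "x \<in> ball z (1/2)" using z by auto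
      fix y assume y: "y \<in> ball z (1/2)"
      then have "norm (y - z) < 1/2" by (simp add: dist_norm norm_minus_commute)
      then show "z + (2 * norm (y - z)) *\<^sub>R (y - z) = squeeze y"
        using squeeze_eq[OF z(1), of y] y by (simp add: radial_square_def)
    qed
    then show ?thesis using True center_eq[OF z] by (simp add: squeeze_deriv_def)
  next
    case False
    \<comment> \<open>The distance to the closed set is attained, so a point off the tube and off
      all spheres has distance strictly above 1/2. This holds on a whole neighbourhood, where
      \<open>squeeze\<close> is the identity.\<close>
    obtain w where w: "w \<in> E" "infdist x E = dist x w"
      using infdist_attains_inf[OF closed_E nonempty] by blast
    have "dist w x \<noteq> 1/2" using x w by (auto simp: N_def)
    then have gt: "infdist x E > 1/2" using False w by (force simp: tube_def dist_commute)
    have "((\<lambda>x. x) has_derivative (\<lambda>h. h)) (at x)" by (rule has_derivative_ident)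
    then have "(squeeze has_derivative (\<lambda>h. h)) (at x)"
    proof (rule has_derivative_transform_within_open)
      show "open {y. 1/2 < infdist y E}" by (intro open_Collect_less continuous_intros)
      fix y assume "y \<in> {y. 1/2 < infdist y E}"
      then have "y \<notin> tube" using infdist_le[of _ E y] by (force simp: tube_def dist_commute)
      then show "y = squeeze y" by (simp add: squeeze_outside)
    qed (use gt in simp)
    moreover have "(*v) (squeeze_deriv x) = (\<lambda>h. h)"
      using False by (simp add: squeeze_deriv_def fun_eq_iff)
    ultimately show ?thesis by simp
  qed
  ultimately show ?thesis by (intro AE_I'[of N]) auto
qed

text \<open>Measurability despite the choice in \<open>center\<close>: on the open tube the centre
  is locally constant, so the offset is continuous there, and off the tube it is zero.\<close>

lemma offset_measurable: "(\<lambda>x. x - center x) \<in> borel_measurable borel"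
proof -
  have "continuous_on tube (\<lambda>x. x - center x)"
  proof (rule continuous_at_imp_continuous_on, intro ballI)
    fix x assume "x \<in> tube"
    then obtain z where z: "z \<in> E" "dist z x < 1/2" by (auto simp: tube_def)
    have "\<forall>\<^sub>F y in nhds x. y \<in> ball z (1/2)" using z by (intro eventually_nhds_in_open) auto
    then have "\<forall>\<^sub>F y in nhds x. y - center y = y - z"
      by eventually_elim (use center_eq z in auto)
    then show "isCont (\<lambda>x. x - center x) x"
      by (subst isCont_cong[where g="\<lambda>y. y - z"]) (auto intro!: continuous_intros)
  qed
  moreover have "open tube" by (auto simp: tube_def)
  ultimately have "(\<lambda>x. indicator tube x *\<^sub>R (x - center x)) \<in> borel_measurable borel"
    by (intro borel_measurable_continuous_on_indicator) auto
  moreover have "(\<lambda>x. indicator tube x *\<^sub>R (x - center x)) = (\<lambda>x. x - center x)"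
    by (auto simp: fun_eq_iff indicator_def center_def)
  ultimately show ?thesis by simp
qed

lemma tube_borel: "tube \<in> sets borel"
  by (intro borel_open) (auto simp: tube_def)

lemma squeeze_deriv_measurable: "(\<lambda>x. squeeze_deriv x $ i $ j) \<in> borel_measurable lebesgue"
proof -
  note [measurable] = offset_measurable tube_borel
  have [measurable]: "(\<lambda>x. (x - center x) $ i) \<in> borel_measurable borel" for i
    using measurable_compose[OF offset_measurable, of "\<lambda>v. v $ i"] by simp
  have "(\<lambda>x. squeeze_deriv x $ i $ j) = (\<lambda>x. if x \<in> tube then
      (if i = j then 2 * norm (x - center x) else 0) + 2 * (x - center x) $ i * (x - center x) $ j / norm (x - center x)
      else (mat 1 :: real^'n^'n) $ i $ j)"
    by (auto simp: fun_eq_iff squeeze_deriv_def radial_square_deriv_def)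
  also have "\<dots> \<in> borel_measurable borel"
    by measurable
  finally show ?thesis by (intro measurable_completion) simp
qed

lemma norm_offset_less: "x \<in> tube \<Longrightarrow> norm (x - center x) < 1/2"
  using center_eq by (force simp: tube_def dist_norm norm_minus_commute)

lemma norm_squeeze_deriv_le: "norm (squeeze_deriv x *v h) \<le> 2 * norm h"
proof (cases "x \<in> tube")
  case True
  have "4 * norm (x - center x) * norm h \<le> 2 * norm h"
    using norm_offset_less[OF True] by (intro mult_right_mono) auto
  then have "norm (radial_square_deriv (x - center x) *v h) \<le> 2 * norm h"
    using norm_radial_square_deriv_le[of "x - center x" h] by linarith
  then show ?thesis using True by (simp add: squeeze_deriv_def)
qed (simp add: squeeze_deriv_def)

lemma squeeze_has_weak_derivative: "has_weak_derivative squeeze squeeze_deriv"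
proof (rule has_weak_derivativeI[OF squeeze_lipschitz squeeze_deriv_measurable _ squeeze_has_derivative])
  fix x and i j :: 'n
  have "squeeze_deriv x $ i $ j = (squeeze_deriv x *v axis j 1) $ i"
    by (simp add: matrix_vector_mul_component inner_axis)
  also have "\<bar>\<dots>\<bar> \<le> norm (squeeze_deriv x *v axis j 1)" by (rule component_le_norm_cart)
  also have "\<dots> \<le> 2" using norm_squeeze_deriv_le[of x "axis j 1"] by simp
  finally show "\<bar>squeeze_deriv x $ i $ j\<bar> \<le> 2" .
qed

lemma det_squeeze_deriv:
  "det (squeeze_deriv x) = (if x \<in> tube then 2 * (2 * norm (x - center x)) ^ CARD('n) else 1)"
  by (simp add: squeeze_deriv_def det_radial_square_deriv)

text \<open>At distance \<open>r\<close> from a centre the radial and tangential stretches are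
  \<open>4 r\<close> and \<open>2 r\<close>. Their ratio is 2 at every distance, which is why one
  constant, \<open>2 ^ n\<close>, works although the Jacobian degenerates at
  \<open>E\<close>.\<close>

lemma quasiconformal_squeeze: "quasiconformal squeeze"
proof -
  have "onorm ((*v) (squeeze_deriv x)) ^ CARD('n) \<le> 2 ^ CARD('n) * det (squeeze_deriv x)" for x
  proof (cases "x \<in> tube")
    case True
    let ?r = "norm (x - center x)"
    have "onorm ((*v) (squeeze_deriv x)) \<le> 4 * ?r"
      using norm_radial_square_deriv_le[of "x - center x"] True by (intro onorm_le) (simp add: squeeze_deriv_def)
    then have "onorm ((*v) (squeeze_deriv x)) ^ CARD('n) \<le> (4 * ?r) ^ CARD('n)"
      by (intro power_mono onorm_pos_le matrix_vector_mul_bounded_linear)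
    also have "\<dots> = 2 ^ CARD('n) * (2 * ?r) ^ CARD('n)"
      unfolding power_mult_distrib[symmetric] by simp
    also have "\<dots> \<le> 2 ^ CARD('n) * (2 * (2 * ?r) ^ CARD('n))" by (intro mult_left_mono) auto
    finally show ?thesis using True by (simp add: det_squeeze_deriv)
  next
    case False
    have "onorm ((*v) (squeeze_deriv x)) \<le> 1" using False by (intro onorm_le) (simp add: squeeze_deriv_def)
    then have "onorm ((*v) (squeeze_deriv x)) ^ CARD('n) \<le> 1"
      by (intro power_le_one onorm_pos_le matrix_vector_mul_bounded_linear)
    then show ?thesis using False by (simp add: det_squeeze_deriv order_trans[OF _ one_le_power])
  qed
  moreover have "(1::real) \<le> 2 ^ CARD('n)" by simp
  ultimately show ?thesis
    unfolding quasiconformal_def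
    by (intro conjI exI[of _ squeeze_deriv] exI[of _ "2 ^ CARD('n)"] AE_I2
        squeeze_homeomorphism squeeze_has_weak_derivative)
qed

lemma infdist_eq_norm_offset: "x \<in> tube \<Longrightarrow> infdist x E = norm (x - center x)"
proof -
  assume "x \<in> tube"
  then obtain z where z: "z \<in> E" "dist z x < 1/2" by (auto simp: tube_def)
  obtain w where w: "w \<in> E" "infdist x E = dist x w"
    using infdist_attains_inf[OF closed_E nonempty] by blast
  have "infdist x E \<le> dist x z" by (rule infdist_le[OF z(1)])
  then have "w = z" using w ball_disjoint[OF z(1) w(1) z(2)] z(2) by (force simp: dist_commute)
  then show ?thesis using w center_eq[OF z] by (simp add: dist_norm)
qed

text \<open>The Jacobian jumps from 2 to 1 across the gluing spheres. The comparison function is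
  continuous and depends on the distance to \<open>E\<close> alone, so it can be controlled on
  balls.\<close>

lemma det_squeeze_deriv_comparable:
  defines "m \<equiv> \<lambda>x. min 1 (2 * infdist x E)"
  shows "m x ^ CARD('n) \<le> det (squeeze_deriv x)" "det (squeeze_deriv x) \<le> 2 * m x ^ CARD('n)"
proof -
  have "m x ^ CARD('n) \<le> det (squeeze_deriv x) \<and> det (squeeze_deriv x) \<le> 2 * m x ^ CARD('n)"
  proof (cases "x \<in> tube")
    case True
    then have "m x = 2 * norm (x - center x)"
      using norm_offset_less[OF True] by (simp add: m_def infdist_eq_norm_offset)
    then show ?thesis using True by (simp add: det_squeeze_deriv)
  next
    case False
    obtain w where w: "w \<in> E" "infdist x E = dist x w"
      using infdist_attains_inf[OF closed_E nonempty] by blast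
    then have "m x = 1" using False by (force simp: m_def tube_def dist_commute)
    then show ?thesis using False by (simp add: det_squeeze_deriv)
  qed
  then show "m x ^ CARD('n) \<le> det (squeeze_deriv x)" "det (squeeze_deriv x) \<le> 2 * m x ^ CARD('n)" by auto
qed

text \<open>On a ball with \<open>2 r < d(x, E)\<close> the distance to \<open>E\<close> stays
  between \<open>1/2\<close> and \<open>3/2\<close> of its value at the centre, and so does
  \<open>min 1 (2 d)\<close>. The extreme values of the weight therefore differ by at most the
  factor \<open>2 * 3 ^ n\<close>.\<close>

lemma A1_local_det_squeeze_deriv: "A1_local E (\<lambda>x. det (squeeze_deriv x))"
proof -
  let ?w = "\<lambda>x. det (squeeze_deriv x)" and ?n = "CARD('n)"
  let ?m = "\<lambda>x. min 1 (2 * infdist x E)"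
  have "(\<lambda>x. if x \<in> tube then 2 * (2 * norm (x - center x)) ^ ?n else 1) \<in> borel_measurable borel"
    using offset_measurable tube_borel by measurable
  then have meas: "?w \<in> borel_measurable lebesgue"
    unfolding det_squeeze_deriv by (intro measurable_completion) simp
  have nonneg: "0 \<le> ?m x" for x by (simp add: infdist_nonneg)
  have pos: "0 \<le> ?w x" for x
    by (rule order_trans[OF zero_le_power[OF nonneg] det_squeeze_deriv_comparable(1)])
  have "(\<integral>\<^sup>+z\<in>ball x r. ennreal (?w z) \<partial>lebesgue) / emeasure lebesgue (ball x r)
      \<le> ennreal (2 * 3 ^ ?n) * essinf (lebesgue_on (ball x r)) (\<lambda>z. ennreal (?w z))"
    if r: "0 < r" "2 * r < infdist x E" for x r
  proof -
    let ?B = "ball x r"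
    have m_le: "?m y \<le> 3/2 * ?m x" and m_ge: "?m x / 2 \<le> ?m y" if "y \<in> ?B" for y
      using infdist_triangle[of x E y] infdist_triangle[of y E x] that r by (auto simp: dist_commute min_def)
    have up: "?w y \<le> 2 * (3/2 * ?m x) ^ ?n" if "y \<in> ?B" for y
      using order_trans[OF det_squeeze_deriv_comparable(2) mult_left_mono[OF power_mono[OF m_le[OF that] nonneg]]]
      by simp
    have low: "(?m x / 2) ^ ?n \<le> ?w y" if "y \<in> ?B" for y
      by (rule order_trans[OF power_mono[OF m_ge[OF that]] det_squeeze_deriv_comparable(1)]) (use nonneg in simp)
    have "emeasure lebesgue ?B > 0" using r by (simp add: emeasure_ball)
    moreover have "(\<integral>\<^sup>+z\<in>?B. ennreal (?w z) \<partial>lebesgue) \<le> (\<integral>\<^sup>+z. ennreal (2 * (3/2 * ?m x) ^ ?n) * indicator ?B z \<partial>lebesgue)"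
      using up by (intro nn_integral_mono) (auto simp: indicator_def intro!: ennreal_leI)
    then have "(\<integral>\<^sup>+z\<in>?B. ennreal (?w z) \<partial>lebesgue) \<le> ennreal (2 * (3/2 * ?m x) ^ ?n) * emeasure lebesgue ?B"
      by (simp add: nn_integral_cmult_indicator)
    ultimately have "(\<integral>\<^sup>+z\<in>?B. ennreal (?w z) \<partial>lebesgue) / emeasure lebesgue ?B \<le> ennreal (2 * (3/2 * ?m x) ^ ?n)"
      by (intro divide_le_posI_ennreal) (auto simp: mult.commute)
    also have "2 * (3/2 * ?m x) ^ ?n = (2 * 3 ^ ?n) * (?m x / 2) ^ ?n"
      by (simp add: power_mult_distrib power_divide)
    also have "ennreal \<dots> = ennreal (2 * 3 ^ ?n) * ennreal ((?m x / 2) ^ ?n)"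
      using nonneg[of x] by (intro ennreal_mult) auto
    also have "\<dots> \<le> ennreal (2 * 3 ^ ?n) * essinf (lebesgue_on ?B) (\<lambda>z. ennreal (?w z))"
    proof (intro mult_left_mono)
      show "ennreal ((?m x / 2) ^ ?n) \<le> essinf (lebesgue_on ?B) (\<lambda>z. ennreal (?w z))"
        unfolding essinf_def
        by (intro Sup_upper CollectI AE_I2 ennreal_leI low) (simp add: space_restrict_space)
    qed simp
    finally show ?thesis .
  qed
  then have "\<exists>C::real. C > 0 \<and> (\<forall>x r. r > 0 \<and> (E \<noteq> {} \<longrightarrow> 2 * r < infdist x E) \<longrightarrow>
        (\<integral>\<^sup>+z\<in>ball x r. ennreal (?w z) \<partial>lebesgue) / emeasure lebesgue (ball x r)
          \<le> ennreal C * essinf (lebesgue_on (ball x r)) (\<lambda>z. ennreal (?w z)))"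
    using nonempty by (intro exI[of _ "2 * 3 ^ ?n"]) auto
  then show ?thesis unfolding A1_local_def by (intro conjI closed_E meas AE_I2 pos)
qed

end

section \<open>Q-norms of bumps\<close>

text \<open>One estimate for two kernels: \<open>q = 1/2\<close> handles the singularity at
  \<open>c\<close>, \<open>q = 2\<close> the decay at infinity. On shell \<open>j\<close> the power
  is at most \<open>(s q ^ j) powr p\<close>, as \<open>p \<le> 0\<close>, and the shell lies in a
  ball of radius \<open>2 s q ^ j\<close>; the contributions are geometric with ratio
  \<open>q powr (p + n)\<close>.\<close>

lemma nn_integral_power_dyadic_shells:
  fixes c :: "'a::euclidean_space" and p s q :: real
  assumes p: "p \<le> 0" and s: "0 < s" and q: "0 < q" "q powr (p + DIM('a)) < 1"
    and shells: "\<And>y. y \<in> A \<Longrightarrow> y \<noteq> c \<Longrightarrow> \<exists>j. s * q ^ j \<le> norm (c - y) \<and> norm (c - y) < 2 * (s * q ^ j)"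
  shows "(\<integral>\<^sup>+y\<in>A. ennreal (norm (c - y) powr p) \<partial>lborel) \<le>
    ennreal (unit_ball_vol DIM('a) * 2 ^ DIM('a) / (1 - q powr (p + DIM('a))) * s powr (p + DIM('a)))"
proof -
  let ?n = "DIM('a)" and ?\<omega> = "unit_ball_vol (real DIM('a))"
  let ?f = "\<lambda>j y. ennreal ((s * q ^ j) powr p) * indicator (ball c (2 * (s * q ^ j))) y"
  have pos: "0 < s * q ^ j" for j using s q by simp
  have "ennreal (norm (c - y) powr p) * indicator A y \<le> (\<Sum>j. ?f j y)" for y
  proof (cases "y \<in> A \<and> y \<noteq> c")
    case True
    then obtain j where j: "s * q ^ j \<le> norm (c - y)" "norm (c - y) < 2 * (s * q ^ j)"
      using shells by blast
    have "norm (c - y) powr p \<le> (s * q ^ j) powr p"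
      using p j(1) pos by (intro powr_mono2') auto
    then have "ennreal (norm (c - y) powr p) * indicator A y \<le> ?f j y"
      using True j(2) by (simp add: dist_norm ennreal_leI)
    also have "?f j y = sum (\<lambda>i. ?f i y) {j}"
      by (simp only: sum.insert sum.empty finite.emptyI empty_iff not_False_eq_True add_0_right)
    also have "\<dots> \<le> (\<Sum>j. ?f j y)" by (intro sum_le_suminf) auto
    finally show ?thesis .
  next
    case False
    \<comment> \<open>At \<open>y = c\<close>, which no shell contains, the integrand is zero
      because \<open>0 powr p = 0\<close>.\<close>
    then have "ennreal (norm (c - y) powr p) * indicator A y = 0" by (cases "y \<in> A") simp_all
    then show ?thesis by (simp only: zero_le)
  qed
  then have le: "(\<integral>\<^sup>+y\<in>A. ennreal (norm (c - y) powr p) \<partial>lborel) \<le> (\<integral>\<^sup>+y. (\<Sum>j. ?f j y) \<partial>lborel)"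
    by (intro nn_integral_mono)
  have "?f j \<in> borel_measurable lborel" for j
    by (intro borel_measurable_times_ennreal borel_measurable_const borel_measurable_indicator) simp
  then have *: "(\<integral>\<^sup>+y. (\<Sum>j. ?f j y) \<partial>lborel) = (\<Sum>j. \<integral>\<^sup>+y. ?f j y \<partial>lborel)" by (rule nn_integral_suminf)
  note le
  also note *
  also have "\<dots> = (\<Sum>j. ennreal (?\<omega> * 2 ^ ?n * s powr (p + ?n) * (q powr (p + ?n)) ^ j))"
  proof (rule suminf_cong)
    fix j
    have "(\<integral>\<^sup>+y. ?f j y \<partial>lborel) = ennreal ((s * q ^ j) powr p) * emeasure lborel (ball c (2 * (s * q ^ j)))"
      by (intro nn_integral_cmult_indicator) simp
    also have "\<dots> = ennreal ((s * q ^ j) powr p * (?\<omega> * (2 * (s * q ^ j)) ^ ?n))"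
      using less_imp_le[OF pos[of j]] by (subst ennreal_mult) (auto simp: emeasure_ball simp del: mult_pos_pos)
    also have "(s * q ^ j) powr p * (?\<omega> * (2 * (s * q ^ j)) ^ ?n) = ?\<omega> * 2 ^ ?n * ((s * q ^ j) powr p * (s * q ^ j) powr ?n)"
      unfolding powr_realpow[OF pos[of j]] power_mult_distrib[of 2] by (simp only: mult_ac)
    also have "(s * q ^ j) powr p * (s * q ^ j) powr ?n = s powr (p + ?n) * (q powr (p + ?n)) ^ j"
    proof -
      have "(s * q ^ j) powr (p + ?n) = s powr (p + ?n) * (q ^ j) powr (p + ?n)"
        by (rule powr_mult)
      also have "(q ^ j) powr (p + ?n) = (q powr (p + ?n)) ^ j"
        using q by (simp add: powr_realpow[symmetric] powr_powr mult.commute)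
      finally show ?thesis by (simp add: powr_add)
    qed
    finally show "(\<integral>\<^sup>+y. ?f j y \<partial>lborel) = ennreal (?\<omega> * 2 ^ ?n * s powr (p + ?n) * (q powr (p + ?n)) ^ j)"
      by (simp only: mult.assoc)
  qed
  also have "\<dots> = ennreal (\<Sum>j. ?\<omega> * 2 ^ ?n * s powr (p + ?n) * (q powr (p + ?n)) ^ j)"
    using q by (intro suminf_ennreal2 summable_mult summable_geometric) auto
  also have "(\<Sum>j. ?\<omega> * 2 ^ ?n * s powr (p + ?n) * (q powr (p + ?n)) ^ j)
      = ?\<omega> * 2 ^ ?n / (1 - q powr (p + ?n)) * s powr (p + ?n)"
    using q by (subst suminf_mult) (auto simp: suminf_geometric summable_geometric)
  finally show ?thesis .
qed

lemma dyadic_shell_below: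
  fixes a t :: real
  assumes "0 < t" "t < a"
  shows "\<exists>j. a / 2 * (1/2) ^ j \<le> t \<and> t < 2 * (a / 2 * (1/2) ^ j)"
proof -
  let ?P = "\<lambda>j. a / 2 * (1/2) ^ j \<le> t"
  have a: "0 < a" using assms by simp
  obtain k where "(1/2) ^ k < 2 * t / a" using real_arch_pow_inv[of "2 * t / a" "1/2"] assms a by auto
  then have "?P k" using a by (simp add: field_simps)
  then have P: "?P (Least ?P)" by (rule LeastI)
  show ?thesis
  proof (cases "Least ?P")
    case 0
    then show ?thesis using P assms by (intro exI[of _ 0]) simp
  next
    case (Suc i)
    then have "\<not> ?P i" using not_less_Least[of i ?P] by simp
    then show ?thesis using P Suc by (intro exI[of _ "Suc i"]) simp
  qed
qed

lemma dyadic_shell_above: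
  fixes a t :: real
  assumes "0 < a" "a \<le> t"
  shows "\<exists>j. a * 2 ^ j \<le> t \<and> t < 2 * (a * 2 ^ j)"
proof -
  let ?P = "\<lambda>j. t < 2 * (a * 2 ^ j)"
  obtain k where "t / a < 2 ^ k" using real_arch_pow[of 2 "t / a"] by auto
  then have "t < a * 2 ^ k" using assms by (simp add: field_simps)
  moreover have "0 < a * 2 ^ k" using assms by simp
  ultimately have "?P k" by linarith
  then have P: "?P (Least ?P)" by (rule LeastI)
  show ?thesis
  proof (cases "Least ?P")
    case 0
    then show ?thesis using P assms by (intro exI[of _ 0]) simp
  next
    case (Suc i)
    then have "\<not> ?P i" using not_less_Least[of i ?P] by simp
    then show ?thesis using P Suc by (intro exI[of _ "Suc i"]) simp
  qed
qed

text \<open>The 2 in the exponent is what the slope bound on the squared difference contributes.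
  Then \<open>\<alpha> < 1\<close> makes the kernel integrable at \<open>x\<close>, and dimension at
  least 2 makes its exponent nonpositive.\<close>

lemma riesz_kernel_ball:
  assumes "DIM('a::euclidean_space) \<ge> 2" "0 < \<alpha>" "\<alpha> < 1"
  obtains K :: real where "0 < K" "\<And>(x::'a) r. 0 < r \<Longrightarrow>
    (\<integral>\<^sup>+y\<in>ball x r. ennreal (norm (x - y) powr (2 - (real DIM('a) + 2 * \<alpha>))) \<partial>lborel) \<le> ennreal (K * r powr (2 - 2 * \<alpha>))"
proof -
  let ?p = "2 - (real DIM('a) + 2 * \<alpha>)"
  have e: "?p + real DIM('a) = 2 - 2 * \<alpha>" by simp
  have lt: "(1/2) powr (2 - 2 * \<alpha>) < (1::real)"
    using powr_less_mono2_neg[of "-(2 - 2 * \<alpha>)" "1/2" 1] assms by (simp add: powr_divide)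
  define K where "K = unit_ball_vol DIM('a) * 2 ^ DIM('a) / (1 - (1/2) powr (2 - 2 * \<alpha>))"
  have "0 < K" using lt by (simp add: K_def)
  moreover have "(\<integral>\<^sup>+y\<in>ball x r. ennreal (norm (x - y) powr ?p) \<partial>lborel) \<le> ennreal (K * r powr (2 - 2 * \<alpha>))"
    if r: "0 < r" for x :: 'a and r
  proof -
    have "(\<integral>\<^sup>+y\<in>ball x r. ennreal (norm (x - y) powr ?p) \<partial>lborel) \<le>
      ennreal (unit_ball_vol DIM('a) * 2 ^ DIM('a) / (1 - (1/2) powr (?p + DIM('a))) * (r / 2) powr (?p + DIM('a)))"
    proof (rule nn_integral_power_dyadic_shells)
      show "(1/2) powr (?p + DIM('a)) < 1" unfolding e by (rule lt)
      show "\<exists>j. r / 2 * (1/2) ^ j \<le> norm (x - y) \<and> norm (x - y) < 2 * (r / 2 * (1/2) ^ j)"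
        if "y \<in> ball x r" "y \<noteq> x" for y
        using that by (intro dyadic_shell_below) (auto simp: dist_norm)
    qed (use assms r in auto)
    also have "\<dots> \<le> ennreal (K * r powr (2 - 2 * \<alpha>))"
      unfolding e K_def[symmetric] using \<open>0 < K\<close> r assms
      by (intro ennreal_leI mult_left_mono powr_mono2) auto
    finally show ?thesis .
  qed
  ultimately show ?thesis using that by blast
qed

text \<open>The counterpart for distant points, where only the oscillation bound 1 is
  available.\<close>

lemma riesz_kernel_complement:
  assumes "0 < \<alpha>"
  obtains K :: real where "0 < K" "\<And>(x::'a::euclidean_space) r. 0 < r \<Longrightarrow>
    (\<integral>\<^sup>+y\<in>- ball x r. ennreal (norm (x - y) powr (- (real DIM('a) + 2 * \<alpha>))) \<partial>lborel) \<le> ennreal (K * r powr (- 2 * \<alpha>))"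
proof -
  let ?p = "- (real DIM('a) + 2 * \<alpha>)"
  have e: "?p + real DIM('a) = - 2 * \<alpha>" by simp
  have lt: "2 powr (- 2 * \<alpha>) < (1::real)"
    using powr_less_mono[of "- 2 * \<alpha>" 0 2] assms by simp
  define K where "K = unit_ball_vol DIM('a) * 2 ^ DIM('a) / (1 - 2 powr (- 2 * \<alpha>))"
  have "0 < K" using lt by (simp add: K_def)
  moreover have "(\<integral>\<^sup>+y\<in>- ball x r. ennreal (norm (x - y) powr ?p) \<partial>lborel) \<le> ennreal (K * r powr (- 2 * \<alpha>))"
    if r: "0 < r" for x :: 'a and r
  proof -
    have "(\<integral>\<^sup>+y\<in>- ball x r. ennreal (norm (x - y) powr ?p) \<partial>lborel) \<le>
      ennreal (unit_ball_vol DIM('a) * 2 ^ DIM('a) / (1 - 2 powr (?p + DIM('a))) * r powr (?p + DIM('a)))"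
    proof (rule nn_integral_power_dyadic_shells)
      show "2 powr (?p + DIM('a)) < 1" unfolding e by (rule lt)
      show "\<exists>j. r * 2 ^ j \<le> norm (x - y) \<and> norm (x - y) < 2 * (r * 2 ^ j)"
        if "y \<in> - ball x r" "y \<noteq> x" for y
        using that r by (intro dyadic_shell_above) (auto simp: dist_norm)
    qed (use assms r in auto)
    then show ?thesis unfolding e K_def .
  qed
  ultimately show ?thesis using that by blast
qed

section \<open>Energy estimates for truncated Lipschitz functions\<close>

definition gagliardo :: "real \<Rightarrow> (real^'n \<Rightarrow> real) \<Rightarrow> real^'n \<Rightarrow> real^'n \<Rightarrow> ennreal" where
  "gagliardo \<alpha> u x y = ennreal (\<bar>u x - u y\<bar>^2 / norm (x - y) powr (real CARD('n) + 2 * \<alpha>))"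

text \<open>Passing from \<open>lebesgue\<close> to \<open>lborel\<close> leaves nonnegative
  integrals unchanged and gives access to Fubini on the product of two \<open>lborel\<close>
  measures.\<close>

lemma Q_norm_gagliardo:
  "Q_norm \<alpha> (u :: real^'n \<Rightarrow> real) = (SUP x0. SUP r\<in>{0<..}. sqrt_ennreal
     (ennreal (r powr (2 * \<alpha> - real CARD('n))) *
      (\<integral>\<^sup>+x\<in>ball x0 r. (\<integral>\<^sup>+y\<in>ball x0 r. gagliardo \<alpha> u x y \<partial>lborel) \<partial>lborel)))"
  unfolding Q_norm_def gagliardo_def by (simp only: nn_integral_completion)

lemma gagliardo_measurable:
  assumes "u \<in> borel_measurable borel"
  shows "(\<lambda>(x, y). gagliardo \<alpha> u x y) \<in> borel_measurable (lborel \<Otimes>\<^sub>M lborel)"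
  using assms unfolding gagliardo_def by measurable

lemma gagliardo_commute: "gagliardo \<alpha> u x y = gagliardo \<alpha> u y x"
  unfolding gagliardo_def by (simp add: norm_minus_commute abs_minus_commute)

text \<open>Oscillation at most 1 serves at distances above \<open>\<delta>\<close>, slope
  \<open>1 / \<delta>\<close> at distances below.\<close>

definition truncated_lipschitz :: "real \<Rightarrow> ('a::real_normed_vector \<Rightarrow> real) \<Rightarrow> bool" where
  "truncated_lipschitz \<delta> u \<longleftrightarrow> (\<forall>x y. \<bar>u x - u y\<bar> \<le> min 1 (norm (x - y) / \<delta>))"

lemma truncated_lipschitzD:
  assumes "truncated_lipschitz \<delta> u"
  shows "\<bar>u x - u y\<bar> \<le> 1" "\<bar>u x - u y\<bar> \<le> norm (x - y) / \<delta>"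
  using assms unfolding truncated_lipschitz_def by auto

lemma truncated_lipschitz_borel_measurable:
  fixes u :: "'a::euclidean_space \<Rightarrow> real"
  assumes "0 < \<delta>" "truncated_lipschitz \<delta> u"
  shows "u \<in> borel_measurable borel"
proof (intro borel_measurable_continuous_onI lipschitz_on_continuous_on)
  show "(1 / \<delta>)-lipschitz_on UNIV u"
    using assms truncated_lipschitzD(2)[OF assms(2)] by (intro lipschitz_onI) (auto simp: dist_norm)
qed

text \<open>The integral over the whole space is split at distance \<open>\<delta>\<close>, where
  both parts scale like \<open>\<delta> powr (- 2 * \<alpha>)\<close>. The second bound is for balls
  smaller than \<open>\<delta>\<close>, where the slope alone gives a better estimate.\<close>

lemma nn_integral_gagliardo_lipschitz:
  assumes "CARD('n) \<ge> 2" "0 < \<alpha>" "\<alpha> < 1"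
  obtains K where "0 < K"
    "\<And>(u::real^'n \<Rightarrow> real) \<delta> x. 0 < \<delta> \<Longrightarrow> truncated_lipschitz \<delta> u \<Longrightarrow>
      (\<integral>\<^sup>+y. gagliardo \<alpha> u x y \<partial>lborel) \<le> ennreal (K * \<delta> powr (- 2 * \<alpha>))"
    "\<And>(u::real^'n \<Rightarrow> real) \<delta> r x. 0 < \<delta> \<Longrightarrow> 0 < r \<Longrightarrow> truncated_lipschitz \<delta> u \<Longrightarrow>
      (\<integral>\<^sup>+y\<in>ball x r. gagliardo \<alpha> u x y \<partial>lborel) \<le> ennreal (K * r powr (2 - 2 * \<alpha>) / \<delta>^2)"
proof -
  let ?q = "real CARD('n) + 2 * \<alpha>"
  obtain K1 :: real where K1: "0 < K1" "\<And>(x::real^'n) r. 0 < r \<Longrightarrow>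
    (\<integral>\<^sup>+y\<in>ball x r. ennreal (norm (x - y) powr (2 - ?q)) \<partial>lborel) \<le> ennreal (K1 * r powr (2 - 2 * \<alpha>))"
    using riesz_kernel_ball[where 'a="real^'n", of \<alpha>] assms by auto
  obtain K2 :: real where K2: "0 < K2" "\<And>(x::real^'n) r. 0 < r \<Longrightarrow>
    (\<integral>\<^sup>+y\<in>- ball x r. ennreal (norm (x - y) powr (- ?q)) \<partial>lborel) \<le> ennreal (K2 * r powr (- 2 * \<alpha>))"
    using riesz_kernel_complement[where 'a="real^'n", of \<alpha>] assms by auto
  have near: "(\<integral>\<^sup>+y\<in>ball x r. gagliardo \<alpha> u x y \<partial>lborel) \<le> ennreal (K1 * r powr (2 - 2 * \<alpha>) / \<delta>^2)"
    if \<delta>: "0 < \<delta>" and r: "0 < r" and u: "truncated_lipschitz \<delta> u"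
    for u :: "real^'n \<Rightarrow> real" and \<delta> r x
  proof -
    have [measurable]: "ball x r \<in> sets borel" by simp
    have "gagliardo \<alpha> u x y \<le> ennreal (1 / \<delta>^2) * ennreal (norm (x - y) powr (2 - ?q))" for y
    proof (cases "x = y")
      case False
      have "\<bar>u x - u y\<bar> \<le> norm (x - y) / \<delta>" by (rule truncated_lipschitzD(2)[OF u])
      then have "\<bar>u x - u y\<bar>^2 \<le> (norm (x - y) / \<delta>)^2" by (intro power_mono) auto
      then have "\<bar>u x - u y\<bar>^2 / norm (x - y) powr ?q \<le> (norm (x - y) / \<delta>)^2 / norm (x - y) powr ?q"
        by (intro divide_right_mono) auto
      also have "\<dots> = 1 / \<delta>^2 * norm (x - y) powr (2 - ?q)"
        using False by (simp add: powr_diff power_divide)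
      finally show ?thesis unfolding gagliardo_def using \<delta> by (simp flip: ennreal_mult)
    qed (simp add: gagliardo_def)
    then have "(\<integral>\<^sup>+y\<in>ball x r. gagliardo \<alpha> u x y \<partial>lborel)
        \<le> (\<integral>\<^sup>+y. ennreal (1 / \<delta>^2) * (ennreal (norm (x - y) powr (2 - ?q)) * indicator (ball x r) y) \<partial>lborel)"
      by (intro nn_integral_mono) (auto simp: indicator_def)
    also have "(\<integral>\<^sup>+y. ennreal (1 / \<delta>^2) * (ennreal (norm (x - y) powr (2 - ?q)) * indicator (ball x r) y) \<partial>lborel)
        = ennreal (1 / \<delta>^2) * (\<integral>\<^sup>+y\<in>ball x r. ennreal (norm (x - y) powr (2 - ?q)) \<partial>lborel)"
      by (intro nn_integral_cmult) measurable
    also have "\<dots> \<le> ennreal (1 / \<delta>^2) * ennreal (K1 * r powr (2 - 2 * \<alpha>))"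
      by (intro mult_left_mono K1 r) simp
    also have "\<dots> = ennreal (K1 * r powr (2 - 2 * \<alpha>) / \<delta>^2)" using K1 by (simp flip: ennreal_mult)
    finally show ?thesis .
  qed
  define K where "K = K1 + K2"
  have all: "(\<integral>\<^sup>+y. gagliardo \<alpha> u x y \<partial>lborel) \<le> ennreal (K * \<delta> powr (- 2 * \<alpha>))"
    if \<delta>: "0 < \<delta>" and u: "truncated_lipschitz \<delta> u"
    for u :: "real^'n \<Rightarrow> real" and \<delta> x
  proof -
    have [measurable]: "u \<in> borel_measurable borel" by (rule truncated_lipschitz_borel_measurable[OF \<delta> u])
    have [measurable]: "ball x \<delta> \<in> sets borel" by simp
    have "gagliardo \<alpha> u x y \<le> ennreal (norm (x - y) powr (- ?q))" for y
    proof -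
      have "\<bar>u x - u y\<bar>^2 \<le> 1" using truncated_lipschitzD(1)[OF u, of x y] by (simp add: abs_square_le_1)
      then have "\<bar>u x - u y\<bar>^2 / norm (x - y) powr ?q \<le> 1 / norm (x - y) powr ?q"
        by (intro divide_right_mono) auto
      then show ?thesis unfolding gagliardo_def powr_minus_divide by (rule ennreal_leI)
    qed
    then have "(\<integral>\<^sup>+y. gagliardo \<alpha> u x y \<partial>lborel) \<le>
      (\<integral>\<^sup>+y. gagliardo \<alpha> u x y * indicator (ball x \<delta>) y
         + ennreal (norm (x - y) powr (- ?q)) * indicator (- ball x \<delta>) y \<partial>lborel)"
      by (intro nn_integral_mono) (auto simp: indicator_def)
    also have "\<dots> = (\<integral>\<^sup>+y\<in>ball x \<delta>. gagliardo \<alpha> u x y \<partial>lborel)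
        + (\<integral>\<^sup>+y\<in>- ball x \<delta>. ennreal (norm (x - y) powr (- ?q)) \<partial>lborel)"
      unfolding gagliardo_def by (intro nn_integral_add) measurable
    also have "\<dots> \<le> ennreal (K1 * \<delta> powr (2 - 2 * \<alpha>) / \<delta>^2) + ennreal (K2 * \<delta> powr (- 2 * \<alpha>))"
      by (intro add_mono near[OF \<delta> \<delta> u] K2 \<delta>)
    also have "K1 * \<delta> powr (2 - 2 * \<alpha>) / \<delta>^2 = K1 * \<delta> powr (- 2 * \<alpha>)"
      using \<delta> by (simp add: powr_diff powr_minus_divide)
    also have "ennreal (K1 * \<delta> powr (- 2 * \<alpha>)) + ennreal (K2 * \<delta> powr (- 2 * \<alpha>)) = ennreal (K * \<delta> powr (- 2 * \<alpha>))"
      using K1 K2 by (simp add: K_def algebra_simps flip: ennreal_plus)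
    finally show ?thesis .
  qed
  show ?thesis
  proof (rule that[of K])
    show "0 < K" using K1 K2 by (simp add: K_def)
    show "(\<integral>\<^sup>+y\<in>ball x r. gagliardo \<alpha> u x y \<partial>lborel) \<le> ennreal (K * r powr (2 - 2 * \<alpha>) / \<delta>^2)"
      if "0 < \<delta>" "0 < r" "truncated_lipschitz \<delta> u"
      for u :: "real^'n \<Rightarrow> real" and \<delta> r x
    proof -
      have "K1 * r powr (2 - 2 * \<alpha>) / \<delta>^2 \<le> K * r powr (2 - 2 * \<alpha>) / \<delta>^2"
        using K2 by (intro divide_right_mono mult_right_mono) (auto simp: K_def)
      then show ?thesis using near[OF that] by (meson ennreal_leI order_trans)
    qed
  qed (rule all)
qed

text \<open>A pair contributes only if one of its points lies in \<open>S\<close>. By symmetry of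
  the kernel, twice the integral over pairs with \<open>x\<close> in \<open>S\<close> suffices, so
  the energy is controlled by the measure of the support.\<close>

lemma nn_integral_gagliardo_support:
  fixes u :: "real^'n \<Rightarrow> real"
  assumes u [measurable]: "u \<in> borel_measurable borel"
    and S [measurable]: "S \<in> sets borel" and B [measurable]: "B \<in> sets borel"
    and supp: "\<And>x. x \<notin> S \<Longrightarrow> u x = 0"
    and bound: "\<And>x. (\<integral>\<^sup>+y. gagliardo \<alpha> u x y \<partial>lborel) \<le> c"
  shows "(\<integral>\<^sup>+x\<in>B. (\<integral>\<^sup>+y\<in>B. gagliardo \<alpha> u x y \<partial>lborel) \<partial>lborel) \<le> 2 * (c * emeasure lborel (B \<inter> S))"
proof -
  note [measurable] = gagliardo_measurable[OF u]
  let ?g = "gagliardo \<alpha> u"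
  let ?h = "\<lambda>x y. ?g x y * indicator (B \<inter> S) x * indicator B y"
  have h_meas [measurable]: "(\<lambda>(x, y). ?h x y) \<in> borel_measurable (lborel \<Otimes>\<^sub>M lborel)" by measurable
  have split: "?g x y * indicator B y \<le> ?h x y + ?h y x" if x: "x \<in> B" for x y
  proof (cases "x \<in> S \<or> y \<in> S")
    case True
    then show ?thesis using gagliardo_commute[of \<alpha> u x y] x by (auto simp: indicator_def)
  next
    case False
    then have "?g x y = 0" using supp by (simp add: gagliardo_def)
    then show ?thesis by simp
  qed
  have "(\<integral>\<^sup>+x\<in>B. (\<integral>\<^sup>+y\<in>B. ?g x y \<partial>lborel) \<partial>lborel)
      \<le> (\<integral>\<^sup>+x. (\<integral>\<^sup>+y. ?h x y + ?h y x \<partial>lborel) \<partial>lborel)"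
  proof (rule nn_integral_mono)
    fix x
    show "(\<integral>\<^sup>+y\<in>B. ?g x y \<partial>lborel) * indicator B x \<le> (\<integral>\<^sup>+y. ?h x y + ?h y x \<partial>lborel)"
    proof (cases "x \<in> B")
      case True
      have "(\<integral>\<^sup>+y\<in>B. ?g x y \<partial>lborel) \<le> (\<integral>\<^sup>+y. ?h x y + ?h y x \<partial>lborel)"
        by (rule nn_integral_mono) (rule split[OF True])
      then show ?thesis using True by simp
    qed simp
  qed
  also have "\<dots> = (\<integral>\<^sup>+x. (\<integral>\<^sup>+y. ?h x y \<partial>lborel) \<partial>lborel) + (\<integral>\<^sup>+x. (\<integral>\<^sup>+y. ?h y x \<partial>lborel) \<partial>lborel)"
    by (simp add: nn_integral_add)
  also have "(\<integral>\<^sup>+x. (\<integral>\<^sup>+y. ?h y x \<partial>lborel) \<partial>lborel) = (\<integral>\<^sup>+x. (\<integral>\<^sup>+y. ?h x y \<partial>lborel) \<partial>lborel)"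
    by (rule lborel_pair.Fubini') measurable
  finally have "(\<integral>\<^sup>+x\<in>B. (\<integral>\<^sup>+y\<in>B. ?g x y \<partial>lborel) \<partial>lborel) \<le> 2 * (\<integral>\<^sup>+x. (\<integral>\<^sup>+y. ?h x y \<partial>lborel) \<partial>lborel)"
    by (simp add: mult_2)
  also have "\<dots> \<le> 2 * (\<integral>\<^sup>+x. c * indicator (B \<inter> S) x \<partial>lborel)"
  proof (intro mult_left_mono nn_integral_mono)
    fix x
    have "(\<integral>\<^sup>+y. ?h x y \<partial>lborel) \<le> (\<integral>\<^sup>+y. ?g x y * indicator (B \<inter> S) x \<partial>lborel)"
      by (intro nn_integral_mono) (auto simp: indicator_def)
    also have "\<dots> = (\<integral>\<^sup>+y. ?g x y \<partial>lborel) * indicator (B \<inter> S) x"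
      by (intro nn_integral_multc) measurable
    also have "\<dots> \<le> c * indicator (B \<inter> S) x" by (intro mult_right_mono bound) simp
    finally show "(\<integral>\<^sup>+y. ?h x y \<partial>lborel) \<le> c * indicator (B \<inter> S) x" .
  qed simp
  also have "\<dots> = 2 * (c * emeasure lborel (B \<inter> S))"
    by (simp add: nn_integral_cmult_indicator)
  finally show ?thesis .
qed

section \<open>Two-sided Q-norm bounds for bumps\<close>

definition bump :: "real \<Rightarrow> (real^'n) set \<Rightarrow> real^'n \<Rightarrow> real" where
  "bump \<delta> F x = max 0 (1 - infdist x F / \<delta>)"

lemma bump_lipschitz:
  assumes "0 < \<delta>"
  shows "truncated_lipschitz \<delta> (bump \<delta> F)"
  unfolding truncated_lipschitz_def
proof (intro allI)
  fix x y
  have range: "0 \<le> bump \<delta> F x" "bump \<delta> F x \<le> 1" for x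
    using assms infdist_nonneg[of x F] by (auto simp: bump_def)
  have "\<bar>infdist x F - infdist y F\<bar> \<le> norm (x - y)"
    using infdist_triangle_abs[of x F y] by (simp add: dist_norm)
  then have "\<bar>infdist x F / \<delta> - infdist y F / \<delta>\<bar> \<le> norm (x - y) / \<delta>"
    using assms by (simp add: diff_divide_distrib[symmetric] divide_right_mono)
  then have "\<bar>bump \<delta> F x - bump \<delta> F y\<bar> \<le> norm (x - y) / \<delta>" unfolding bump_def by linarith
  then show "\<bar>bump \<delta> F x - bump \<delta> F y\<bar> \<le> min 1 (norm (x - y) / \<delta>)" using range[of x] range[of y] by auto
qed

lemma bump_eq_0: "0 < \<delta> \<Longrightarrow> \<delta> \<le> infdist x F \<Longrightarrow> bump \<delta> F x = 0"
  by (simp add: bump_def field_simps)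

lemma sqrt_ennreal_mono: "a \<le> b \<Longrightarrow> sqrt_ennreal a \<le> sqrt_ennreal b"
  unfolding sqrt_ennreal_def
  by (auto simp: top_unique intro!: ennreal_leI real_sqrt_le_mono enn2real_mono simp: less_top)

lemma sqrt_ennreal_ennreal: "0 \<le> t \<Longrightarrow> sqrt_ennreal (ennreal t) = ennreal (sqrt t)"
  by (simp add: sqrt_ennreal_def)

text \<open>The double integral over a ball of radius \<open>r\<close> is estimated by the kernel at scale \<open>r\<close> if
  \<open>r \<le> \<delta>\<close>, and by the measure of the support of the bump at scale \<open>\<delta>\<close> otherwise.\<close>

lemma Q_norm_bump_le:
  assumes "CARD('n) \<ge> 2" "0 < \<alpha>" "\<alpha> < 1"
  obtains C where "0 < C"
    "\<And>(F::(real^'n) set) \<delta> M. 0 < \<delta> \<Longrightarrow> finite F \<Longrightarrow> F \<noteq> {} \<Longrightarrow>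
      (\<And>x r. \<delta> \<le> r \<Longrightarrow> real (card (F \<inter> ball x (r + \<delta>))) * (\<delta> / r) powr (real CARD('n) - 2 * \<alpha>) \<le> M) \<Longrightarrow>
      Q_norm \<alpha> (bump \<delta> F) \<le> ennreal (sqrt (C * (1 + M)))"
proof -
  obtain K where K: "0 < K"
    "\<And>(u::real^'n \<Rightarrow> real) \<delta> x. 0 < \<delta> \<Longrightarrow> truncated_lipschitz \<delta> u \<Longrightarrow>
      (\<integral>\<^sup>+y. gagliardo \<alpha> u x y \<partial>lborel) \<le> ennreal (K * \<delta> powr (- 2 * \<alpha>))"
    "\<And>(u::real^'n \<Rightarrow> real) \<delta> r x. 0 < \<delta> \<Longrightarrow> 0 < r \<Longrightarrow> truncated_lipschitz \<delta> u \<Longrightarrow>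
      (\<integral>\<^sup>+y\<in>ball x r. gagliardo \<alpha> u x y \<partial>lborel) \<le> ennreal (K * r powr (2 - 2 * \<alpha>) / \<delta>^2)"
    by (rule nn_integral_gagliardo_lipschitz[OF assms]) blast
  let ?n = "CARD('n)" and ?\<omega> = "unit_ball_vol (real CARD('n))"
  \<comment> \<open>The 4 bounds \<open>2 powr (2 - 2 * \<alpha>)\<close>, from the doubled radius
    when \<open>r \<le> \<delta>\<close>; for larger \<open>r\<close> the symmetry factor 2 is
    covered as well.\<close>
  define C where "C = 4 * ?\<omega> * K"
  have C: "0 < C" using K by (simp add: C_def)
  have bound: "ennreal (r powr (2 * \<alpha> - ?n)) *
      (\<integral>\<^sup>+x\<in>ball x0 r. (\<integral>\<^sup>+y\<in>ball x0 r. gagliardo \<alpha> (bump \<delta> F) x y \<partial>lborel) \<partial>lborel) \<le> ennreal (C * (1 + M))"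
    if \<delta>: "0 < \<delta>" and F: "finite F" "F \<noteq> {}" and r: "0 < r"
      and M: "\<And>x r. \<delta> \<le> r \<Longrightarrow> real (card (F \<inter> ball x (r + \<delta>))) * (\<delta> / r) powr (real ?n - 2 * \<alpha>) \<le> M"
    for F :: "(real^'n) set" and \<delta> M x0 r
  proof -
    let ?u = "bump \<delta> F"
    let ?J = "\<integral>\<^sup>+x\<in>ball x0 r. (\<integral>\<^sup>+y\<in>ball x0 r. gagliardo \<alpha> ?u x y \<partial>lborel) \<partial>lborel"
    have M0: "0 \<le> M" using M[of \<delta> 0] by (rule order_trans[rotated]) auto
    note lip = bump_lipschitz[OF \<delta>, of F]
    show ?thesis
    proof (cases "r \<le> \<delta>")
      case True
      let ?c = "K * (2 * r) powr (2 - 2 * \<alpha>) / \<delta>^2"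
      have "?J \<le> (\<integral>\<^sup>+x. ennreal ?c * indicator (ball x0 r) x \<partial>lborel)"
      proof (intro nn_integral_mono)
        fix x
        have "(\<integral>\<^sup>+y\<in>ball x0 r. gagliardo \<alpha> ?u x y \<partial>lborel) \<le> ennreal ?c" if x: "x \<in> ball x0 r"
        proof -
          have "ball x0 r \<subseteq> ball x (2 * r)"
          proof
            fix y assume "y \<in> ball x0 r"
            then show "y \<in> ball x (2 * r)" using x dist_triangle3[of x y x0] by simp
          qed
          then have "(\<integral>\<^sup>+y\<in>ball x0 r. gagliardo \<alpha> ?u x y \<partial>lborel) \<le> (\<integral>\<^sup>+y\<in>ball x (2 * r). gagliardo \<alpha> ?u x y \<partial>lborel)"
            by (intro nn_integral_mono) (auto simp: indicator_def)
          also have "\<dots> \<le> ennreal ?c" by (rule K(3)[OF \<delta> _ lip]) (use r in simp)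
          finally show ?thesis .
        qed
        then show "(\<integral>\<^sup>+y\<in>ball x0 r. gagliardo \<alpha> ?u x y \<partial>lborel) * indicator (ball x0 r) x \<le> ennreal ?c * indicator (ball x0 r) x"
          by (auto simp: indicator_def)
      qed
      also have "\<dots> = ennreal ?c * emeasure lborel (ball x0 r)" by (intro nn_integral_cmult_indicator) simp
      also have "\<dots> = ennreal (?c * (?\<omega> * r ^ ?n))"
        using r K(1) by (simp add: emeasure_ball flip: ennreal_mult)
      finally have "ennreal (r powr (2 * \<alpha> - ?n)) * ?J \<le> ennreal (r powr (2 * \<alpha> - ?n)) * ennreal (?c * (?\<omega> * r ^ ?n))"
        by (intro mult_left_mono) auto
      also have "\<dots> = ennreal (r powr (2 * \<alpha> - ?n) * (?c * (?\<omega> * r ^ ?n)))"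
        using r K(1) by (intro ennreal_mult[symmetric]) auto
      also have "r powr (2 * \<alpha> - ?n) * (?c * (?\<omega> * r ^ ?n)) \<le> C * (1 + M)"
      proof -
        have "r powr (2 * \<alpha> - ?n) * (?c * (?\<omega> * r ^ ?n))
          = K * ?\<omega> * 2 powr (2 - 2 * \<alpha>) * (r powr (2 * \<alpha> - ?n) * r powr (2 - 2 * \<alpha>) * r powr ?n) / \<delta>^2"
          using r by (simp add: powr_mult powr_realpow)
        also have "r powr (2 * \<alpha> - ?n) * r powr (2 - 2 * \<alpha>) * r powr ?n = r powr 2"
          by (simp flip: powr_add)
        also have "K * ?\<omega> * 2 powr (2 - 2 * \<alpha>) * r powr 2 / \<delta>^2 = (K * ?\<omega>) * (2 powr (2 - 2 * \<alpha>) * (r / \<delta>)^2)"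
          using r by (simp add: power_divide)
        also have "\<dots> \<le> (K * ?\<omega>) * (2 powr 2 * 1)"
        proof (intro mult_left_mono mult_mono)
          show "(r / \<delta>)^2 \<le> 1" using True r \<delta> by (simp add: power_le_one)
          show "2 powr (2 - 2 * \<alpha>) \<le> (2::real) powr 2" using assms by (intro powr_mono) auto
        qed (use K(1) in auto)
        also have "\<dots> = C * 1" by (simp add: C_def)
        also have "\<dots> \<le> C * (1 + M)" using C M0 by (intro mult_left_mono) auto
        finally show ?thesis .
      qed
      finally show ?thesis using C M0 by (simp add: ennreal_leI)
    next
      case False
      let ?S = "{x. infdist x F < \<delta>}" and ?G = "F \<inter> ball x0 (r + \<delta>)"
      have S: "?S \<in> sets borel" by (intro borel_open open_Collect_less continuous_intros)
      have "?J \<le> 2 * (ennreal (K * \<delta> powr (- 2 * \<alpha>)) * emeasure lborel (ball x0 r \<inter> ?S))"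
      proof (rule nn_integral_gagliardo_support[OF truncated_lipschitz_borel_measurable[OF \<delta> lip] S])
        show "bump \<delta> F x = 0" if "x \<notin> ?S" for x using that by (intro bump_eq_0 \<delta>) simp
        show "(\<integral>\<^sup>+y. gagliardo \<alpha> ?u x y \<partial>lborel) \<le> ennreal (K * \<delta> powr (- 2 * \<alpha>))" for x
          by (rule K(2)[OF \<delta> lip])
      qed simp
      \<comment> \<open>A point of the ball within \<open>\<delta>\<close> of \<open>F\<close> has
        its nearest point of \<open>F\<close> within \<open>r + \<delta>\<close> of
        \<open>x0\<close>; this is the enlarged ball in which the hypothesis counts.\<close>
      also have "emeasure lborel (ball x0 r \<inter> ?S) \<le> emeasure lborel (\<Union>z\<in>?G. ball z \<delta>)"
      proof (intro emeasure_mono subsetI)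
        fix x assume x: "x \<in> ball x0 r \<inter> ?S"
        obtain z where z: "z \<in> F" "infdist x F = dist x z"
          using infdist_attains_inf[OF finite_imp_closed[OF F(1)] F(2)] by blast
        then have "dist x0 z < r + \<delta>" using x dist_triangle[of x0 z x] by simp
        then show "x \<in> (\<Union>z\<in>?G. ball z \<delta>)" using z x by (auto simp: dist_commute)
      qed (use F in \<open>auto intro!: sets.finite_UN\<close>)
      also have "\<dots> \<le> (\<Sum>z\<in>?G. emeasure lborel (ball z \<delta>))"
        using F by (intro emeasure_subadditive_finite) auto
      also have "\<dots> = ennreal (real (card ?G) * (?\<omega> * \<delta> ^ ?n))"
        using \<delta> by (simp add: emeasure_ball ennreal_of_nat_eq_real_of_nat flip: ennreal_mult)
      finally have "?J \<le> 2 * (ennreal (K * \<delta> powr (- 2 * \<alpha>)) * ennreal (real (card ?G) * (?\<omega> * \<delta> ^ ?n)))"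
        by (simp add: mult_left_mono)
      also have "\<dots> = ennreal (2 * (K * \<delta> powr (- 2 * \<alpha>) * (real (card ?G) * (?\<omega> * \<delta> ^ ?n))))"
      proof -
        let ?a = "K * \<delta> powr (- 2 * \<alpha>)" and ?b = "real (card ?G) * (?\<omega> * \<delta> ^ ?n)"
        have "ennreal ?a * ennreal ?b = ennreal (?a * ?b)"
          using K(1) \<delta> by (intro ennreal_mult[symmetric]) auto
        moreover have "2 * ennreal (?a * ?b) = ennreal 2 * ennreal (?a * ?b)" by simp
        moreover have "\<dots> = ennreal (2 * (?a * ?b))"
          using K(1) \<delta> by (intro ennreal_mult[symmetric]) auto
        ultimately show ?thesis by (simp only:)
      qed
      finally have "ennreal (r powr (2 * \<alpha> - ?n)) * ?J \<le> ennreal (r powr (2 * \<alpha> - ?n)) * \<dots>"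
        by (intro mult_left_mono) auto
      also have "\<dots> = ennreal (r powr (2 * \<alpha> - ?n) * (2 * (K * \<delta> powr (- 2 * \<alpha>) * (real (card ?G) * (?\<omega> * \<delta> ^ ?n)))))"
        using K(1) \<delta> by (intro ennreal_mult[symmetric]) auto
      also have "r powr (2 * \<alpha> - ?n) * (2 * (K * \<delta> powr (- 2 * \<alpha>) * (real (card ?G) * (?\<omega> * \<delta> ^ ?n))))
          = 2 * ?\<omega> * K * (real (card ?G) * (\<delta> / r) powr (?n - 2 * \<alpha>))"
        using r \<delta> by (simp add: powr_divide powr_diff powr_minus powr_realpow field_simps)
      also have "\<dots> \<le> C * (1 + M)"
      proof -
        have "real (card ?G) * (\<delta> / r) powr (?n - 2 * \<alpha>) \<le> 1 + M" using M[of r x0] False by simp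
        then have "2 * ?\<omega> * K * (real (card ?G) * (\<delta> / r) powr (?n - 2 * \<alpha>)) \<le> 2 * ?\<omega> * K * (1 + M)"
          using K(1) by (intro mult_left_mono) auto
        also have "\<dots> \<le> C * (1 + M)" using K(1) M0 by (intro mult_right_mono) (auto simp: C_def)
        finally show ?thesis .
      qed
      finally show ?thesis using C M0 by (simp add: ennreal_leI)
    qed
  qed
  show ?thesis
  proof (rule that[OF C])
    fix F :: "(real^'n) set" and \<delta> M
    assume *: "0 < \<delta>" "finite F" "F \<noteq> {}"
      "\<And>x r. \<delta> \<le> r \<Longrightarrow> real (card (F \<inter> ball x (r + \<delta>))) * (\<delta> / r) powr (real CARD('n) - 2 * \<alpha>) \<le> M"
    have "0 \<le> M" using *(4)[of \<delta> 0] by (rule order_trans[rotated]) auto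
    then have eq: "ennreal (sqrt (C * (1 + M))) = sqrt_ennreal (ennreal (C * (1 + M)))"
      using C by (simp add: sqrt_ennreal_ennreal)
    show "Q_norm \<alpha> (bump \<delta> F) \<le> ennreal (sqrt (C * (1 + M)))"
      unfolding Q_norm_gagliardo eq
      by (intro SUP_least sqrt_ennreal_mono bound *) (simp_all add: *(4))
  qed
qed

text \<open>Near each point of \<open>F\<close>, pair the ball of radius
  \<open>\<epsilon> / 2\<close> with the annulus from \<open>\<epsilon>\<close> to
  \<open>2 \<epsilon>\<close>. There \<open>v\<close> differs by at least 1/2 and distances are at
  most \<open>3 \<epsilon>\<close>, which gives the 4 and the power of 3 in \<open>c\<close>; the
  volumes of annulus and ball give the square of the unit ball volume and \<open>2 ^ n\<close>.
  Separation makes the small balls disjoint, so the contributions add, and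
  \<open>R - 2 * \<epsilon>\<close> keeps the annuli inside the test ball.\<close>

lemma Q_norm_ge_separated_bumps:
  fixes F :: "(real^'n) set" and v :: "real^'n \<Rightarrow> real"
  assumes F: "finite F" "F \<subseteq> ball 0 (R - 2 * \<epsilon>)" and \<epsilon>: "0 < \<epsilon>" "\<epsilon> \<le> 1/4" and R: "0 < R" and \<alpha>: "0 < \<alpha>"
    and sep: "\<And>z w. z \<in> F \<Longrightarrow> w \<in> F \<Longrightarrow> z \<noteq> w \<Longrightarrow> 1 \<le> dist z w"
    and high: "\<And>z x. z \<in> F \<Longrightarrow> dist z x < \<epsilon> / 2 \<Longrightarrow> 3/4 \<le> v x"
    and low: "\<And>z x. z \<in> F \<Longrightarrow> \<epsilon> \<le> dist z x \<Longrightarrow> dist z x < 2 * \<epsilon> \<Longrightarrow> v x = 0"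
  defines "c \<equiv> unit_ball_vol (real CARD('n)) ^ 2 / (4 * 2 ^ CARD('n) * 3 powr (real CARD('n) + 2 * \<alpha>))"
  shows "ennreal (sqrt (c * real (card F) * R powr (2 * \<alpha> - real CARD('n)) * \<epsilon> powr (real CARD('n) - 2 * \<alpha>))) \<le> Q_norm \<alpha> v"
proof -
  let ?n = "CARD('n)" and ?\<omega> = "unit_ball_vol (real CARD('n))"
  let ?q = "real ?n + 2 * \<alpha>"
  let ?B = "ball (0::real^'n) R"
  let ?k = "1 / (4 * (3 * \<epsilon>) powr ?q)"
  let ?U = "\<Union>z\<in>F. ball z (\<epsilon> / 2)"
  have inB: "x \<in> ?B" if "z \<in> F" "dist z x < 2 * \<epsilon>" for z x
    using F(2) that dist_triangle[of 0 x z] by auto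
  have inner: "ennreal (?k * (?\<omega> * \<epsilon> ^ ?n)) \<le> (\<integral>\<^sup>+y\<in>?B. gagliardo \<alpha> v x y \<partial>lborel)" if x: "x \<in> ?U" for x
  proof -
    obtain z where z: "z \<in> F" "dist z x < \<epsilon> / 2" using x by auto
    let ?A = "ball z (2 * \<epsilon>) - ball z \<epsilon>"
    have "ennreal ?k * indicator ?A y \<le> gagliardo \<alpha> v x y * indicator ?B y" for y
    proof (cases "y \<in> ?A")
      case True
      then have "v y = 0" "y \<in> ?B" using low[OF z(1)] inB[OF z(1)] by auto
      have "x \<noteq> y" using True z by auto
      have "norm (x - y) \<le> 3 * \<epsilon>"
        using True z dist_triangle3[of x y z] by (simp add: dist_norm)
      then have "norm (x - y) powr ?q \<le> (3 * \<epsilon>) powr ?q" using \<alpha> by (intro powr_mono2) auto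
      moreover have "1/4 \<le> \<bar>v x - v y\<bar>^2"
      proof -
        have "(1/2)^2 \<le> \<bar>v x - v y\<bar>^2"
          using high[OF z] \<open>v y = 0\<close> by (intro power_mono) auto
        then show ?thesis by (simp add: power2_eq_square)
      qed
      ultimately have "(1/4) / (3 * \<epsilon>) powr ?q \<le> \<bar>v x - v y\<bar>^2 / norm (x - y) powr ?q"
        using \<open>x \<noteq> y\<close> by (intro frac_le) auto
      then show ?thesis using True \<open>y \<in> ?B\<close> by (simp add: gagliardo_def ennreal_leI)
    qed simp
    then have "(\<integral>\<^sup>+y. ennreal ?k * indicator ?A y \<partial>lborel) \<le> (\<integral>\<^sup>+y\<in>?B. gagliardo \<alpha> v x y \<partial>lborel)"
      by (intro nn_integral_mono)
    moreover have "(\<integral>\<^sup>+y. ennreal ?k * indicator ?A y \<partial>lborel) = ennreal ?k * emeasure lborel ?A"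
      by (intro nn_integral_cmult_indicator) simp
    moreover have "ennreal (?\<omega> * \<epsilon> ^ ?n) \<le> emeasure lborel ?A"
    proof -
      have "emeasure lborel ?A = emeasure lborel (ball z (2 * \<epsilon>)) - emeasure lborel (ball z \<epsilon>)"
        using \<epsilon> emeasure_lborel_ball_finite[of z \<epsilon>] by (intro emeasure_Diff) auto
      also have "\<dots> = ennreal (?\<omega> * (2 * \<epsilon>) ^ ?n - ?\<omega> * \<epsilon> ^ ?n)"
        using \<epsilon> by (simp add: emeasure_ball ennreal_minus)
      also have "\<dots> \<ge> ennreal (?\<omega> * \<epsilon> ^ ?n)"
      proof (rule ennreal_leI)
        have "(2::real) * \<epsilon> ^ ?n \<le> 2 ^ ?n * \<epsilon> ^ ?n"
          using \<epsilon> self_le_power[of "2::real" ?n] by (intro mult_right_mono) auto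
        then have "?\<omega> * (2 * \<epsilon> ^ ?n) \<le> ?\<omega> * (2 * \<epsilon>) ^ ?n"
          unfolding power_mult_distrib by (intro mult_left_mono) auto
        then show "?\<omega> * \<epsilon> ^ ?n \<le> ?\<omega> * (2 * \<epsilon>) ^ ?n - ?\<omega> * \<epsilon> ^ ?n" by simp
      qed
      finally show ?thesis .
    qed
    moreover have "ennreal (?k * (?\<omega> * \<epsilon> ^ ?n)) = ennreal ?k * ennreal (?\<omega> * \<epsilon> ^ ?n)"
      using \<epsilon> by (intro ennreal_mult) auto
    ultimately show ?thesis by (auto intro: order_trans[OF mult_left_mono])
  qed
  let ?J = "\<integral>\<^sup>+x\<in>?B. (\<integral>\<^sup>+y\<in>?B. gagliardo \<alpha> v x y \<partial>lborel) \<partial>lborel"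
  have U: "emeasure lborel ?U = ennreal (real (card F) * (?\<omega> * (\<epsilon> / 2) ^ ?n))"
  proof -
    have "disjoint_family_on (\<lambda>z. ball z (\<epsilon> / 2)) F"
    proof (unfold disjoint_family_on_def, intro ballI impI)
      fix z w assume "z \<in> F" "w \<in> F" "z \<noteq> w"
      then have "1 \<le> dist z w" by (rule sep)
      then show "ball z (\<epsilon> / 2) \<inter> ball w (\<epsilon> / 2) = {}" using \<epsilon> by (intro disjoint_ballI) simp
    qed
    then have "emeasure lborel ?U = (\<Sum>z\<in>F. emeasure lborel (ball z (\<epsilon> / 2)))"
      using F(1) by (intro sum_emeasure[symmetric]) auto
    then show ?thesis using \<epsilon> by (simp add: emeasure_ball ennreal_of_nat_eq_real_of_nat flip: ennreal_mult)
  qed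
  have "ennreal (?k * (?\<omega> * \<epsilon> ^ ?n)) * emeasure lborel ?U = (\<integral>\<^sup>+x. ennreal (?k * (?\<omega> * \<epsilon> ^ ?n)) * indicator ?U x \<partial>lborel)"
    by (intro nn_integral_cmult_indicator[symmetric]) (simp add: borel_open open_UN)
  also have "\<dots> \<le> ?J"
  proof (intro nn_integral_mono)
    fix x
    have "x \<in> ?B" if xU: "x \<in> ?U"
    proof -
      obtain z where "z \<in> F" "dist z x < \<epsilon> / 2" using xU by auto
      then show ?thesis using inB[of z x] \<epsilon> by simp
    qed
    then show "ennreal (?k * (?\<omega> * \<epsilon> ^ ?n)) * indicator ?U x \<le> (\<integral>\<^sup>+y\<in>?B. gagliardo \<alpha> v x y \<partial>lborel) * indicator ?B x"
      using inner by (auto simp: indicator_def)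
  qed
  finally have J: "ennreal (?k * (?\<omega> * \<epsilon> ^ ?n) * (real (card F) * (?\<omega> * (\<epsilon> / 2) ^ ?n))) \<le> ?J"
    unfolding U using \<epsilon> by (subst ennreal_mult) auto
  have "c * real (card F) * R powr (2 * \<alpha> - ?n) * \<epsilon> powr (?n - 2 * \<alpha>)
      = R powr (2 * \<alpha> - ?n) * (?k * (?\<omega> * \<epsilon> ^ ?n) * (real (card F) * (?\<omega> * (\<epsilon> / 2) ^ ?n)))"
  proof -
    have "(3 * \<epsilon>) powr ?q = 3 powr ?q * (\<epsilon> ^ ?n * \<epsilon> powr (2 * \<alpha>))"
      using \<epsilon> by (simp add: powr_mult powr_add powr_realpow)
    moreover have "\<epsilon> powr (?n - 2 * \<alpha>) = \<epsilon> ^ ?n / \<epsilon> powr (2 * \<alpha>)"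
      using \<epsilon> by (simp add: powr_diff powr_realpow)
    ultimately show ?thesis using \<epsilon> by (simp add: c_def power_divide power2_eq_square field_simps)
  qed
  then have "ennreal (c * real (card F) * R powr (2 * \<alpha> - ?n) * \<epsilon> powr (?n - 2 * \<alpha>))
      = ennreal (R powr (2 * \<alpha> - ?n)) * ennreal (?k * (?\<omega> * \<epsilon> ^ ?n) * (real (card F) * (?\<omega> * (\<epsilon> / 2) ^ ?n)))"
    using \<epsilon> by (simp only:) (intro ennreal_mult, auto)
  also have "\<dots> \<le> ennreal (R powr (2 * \<alpha> - ?n)) * ?J" by (intro mult_left_mono J) simp
  finally have "sqrt_ennreal (ennreal (c * real (card F) * R powr (2 * \<alpha> - ?n) * \<epsilon> powr (?n - 2 * \<alpha>)))
      \<le> sqrt_ennreal (ennreal (R powr (2 * \<alpha> - ?n)) * ?J)"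
    by (rule sqrt_ennreal_mono)
  also have "\<dots> \<le> Q_norm \<alpha> v"
    unfolding Q_norm_gagliardo by (rule SUP_upper2[of 0]) (use R in \<open>auto intro!: SUP_upper\<close>)
  finally show ?thesis by (subst (asm) sqrt_ennreal_ennreal) (auto simp: c_def)
qed

section \<open>Unboundedness of the composition operator\<close>

context separated_set
begin

lemma dist_squeeze:
  assumes "z \<in> E" "dist z x < 1/2"
  shows "dist z (squeeze x) = 2 * (dist z x)^2"
proof -
  have "dist z (squeeze x) = norm (radial_square (x - z))"
    using squeeze_eq[of z x] assms by (simp add: dist_norm)
  also have "\<dots> = 2 * norm (x - z) * norm (x - z)"
    using assms(2) unfolding norm_radial_square by (simp add: dist_norm norm_minus_commute)
  finally show ?thesis by (simp add: power2_eq_square dist_norm norm_minus_commute)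
qed

text \<open>The radius \<open>sqrt (\<delta> / 2)\<close> solves \<open>2 s^2 = \<delta>\<close>, so
  it is mapped to \<open>\<delta>\<close>. Half of it is mapped to \<open>\<delta> / 4\<close>,
  where the bump equals 3/4.\<close>

lemma bump_squeeze_high:
  assumes F: "F \<subseteq> E" "z \<in> F" and \<delta>: "0 < \<delta>" "\<delta> \<le> 1/8" and x: "dist z x < sqrt (\<delta> / 2) / 2"
  shows "3/4 \<le> bump \<delta> F (squeeze x)"
proof -
  have "sqrt (\<delta> / 2) \<le> sqrt ((1/4)^2)" using \<delta> by (intro real_sqrt_le_mono) (simp add: power2_eq_square)
  then have "dist z x < 1/2" using x by simp
  then have "dist z (squeeze x) = 2 * (dist z x)^2" using F by (intro dist_squeeze) auto
  also have "\<dots> \<le> 2 * (sqrt (\<delta> / 2) / 2)^2" using x by (intro mult_left_mono power_mono) auto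
  also have "\<dots> = \<delta> / 4" using \<delta> by (simp add: power_divide)
  finally have "infdist (squeeze x) F \<le> \<delta> / 4"
    using infdist_le[OF F(2), of "squeeze x"] by (simp add: dist_commute)
  then have "infdist (squeeze x) F / \<delta> \<le> 1/4" using \<delta> by (simp add: field_simps)
  then show ?thesis unfolding bump_def by linarith
qed

text \<open>The annulus is mapped outside the ball of radius \<open>\<delta>\<close> at
  \<open>z\<close> but stays in the half ball of \<open>z\<close>, so every other point of
  \<open>F\<close> is at distance at least 1/2 from the image.\<close>

lemma bump_squeeze_low:
  assumes F: "F \<subseteq> E" "z \<in> F" and \<delta>: "0 < \<delta>" "\<delta> \<le> 1/8"
    and x: "sqrt (\<delta> / 2) \<le> dist z x" "dist z x < 2 * sqrt (\<delta> / 2)"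
  shows "bump \<delta> F (squeeze x) = 0"
proof -
  have "sqrt (\<delta> / 2) \<le> sqrt ((1/4)^2)" using \<delta> by (intro real_sqrt_le_mono) (simp add: power2_eq_square)
  then have near: "dist z x < 1/2" using x by simp
  have zE: "z \<in> E" using F by auto
  have "\<delta> \<le> dist (squeeze x) w" if w: "w \<in> F" for w
  proof (cases "w = z")
    case True
    have "2 * (sqrt (\<delta> / 2))^2 \<le> 2 * (dist z x)^2"
      using x \<delta> by (intro mult_left_mono power_mono) auto
    then show ?thesis using True dist_squeeze[OF zE near] \<delta> by (simp add: dist_commute)
  next
    case False
    have "dist z (squeeze x) < 1/2" using near dist_squeeze_less_half[OF zE] by simp
    then have "1/2 \<le> dist w (squeeze x)" using ball_disjoint[OF zE, of w] w F False by auto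
    then show ?thesis using \<delta> by (simp add: dist_commute)
  qed
  then have "\<delta> \<le> infdist (squeeze x) F"
    using F by (auto simp: infdist_def intro!: cINF_greatest)
  then show ?thesis by (rule bump_eq_0[OF \<delta>(1)])
qed

end

section \<open>Bumps on the pieces of the grid\<close>

lemma bump_in_L2_loc:
  assumes "0 < \<delta>"
  shows "bump \<delta> F \<in> L2_loc"
proof -
  have [measurable]: "bump \<delta> F \<in> borel_measurable borel"
    by (rule truncated_lipschitz_borel_measurable[OF assms bump_lipschitz[OF assms]])
  have "bump \<delta> F \<in> borel_measurable lebesgue" by (intro measurable_completion) simp
  moreover have "(\<integral>\<^sup>+x\<in>K. ennreal (\<bar>bump \<delta> F x\<bar>^2) \<partial>lebesgue) < \<infinity>" if K: "compact K" for K
  proof -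
    have "\<bar>bump \<delta> F x\<bar> \<le> 1" for x
      using assms infdist_nonneg[of x F] by (simp add: bump_def)
    then have "\<bar>bump \<delta> F x\<bar>^2 \<le> 1" for x by (intro power_le_one) auto
    then have "(\<integral>\<^sup>+x\<in>K. ennreal (\<bar>bump \<delta> F x\<bar>^2) \<partial>lebesgue) \<le> (\<integral>\<^sup>+x. indicator K x \<partial>lebesgue)"
      by (intro nn_integral_mono) (auto simp: indicator_def)
    also have "\<dots> = emeasure lebesgue K"
      using K by (intro nn_integral_indicator) (simp add: compact_imp_closed)
    also have "\<dots> < \<infinity>" using emeasure_compact_finite[OF K] K by (simp add: compact_imp_closed)
    finally show ?thesis .
  qed
  ultimately show ?thesis by (simp add: L2_loc_def)
qed

lemma countable_digit_grid:
  assumes "0 < t" "t < 1"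
  shows "countable (digit_grid t :: (real^'n) set)"
proof (rule countable_subset)
  show "digit_grid t \<subseteq> (\<Union>k. digit_grid t \<inter> ball (0::real^'n) (real (Suc k)))"
  proof
    fix x :: "real^'n" assume x: "x \<in> digit_grid t"
    obtain k where "norm x < real k" using reals_Archimedean2 by blast
    then have "norm x < real (Suc k)" by simp
    then show "x \<in> (\<Union>k. digit_grid t \<inter> ball 0 (real (Suc k)))" using x by auto
  qed
  have "countable (digit_grid t \<inter> ball (0::real^'n) (real (Suc k)))" for k
    by (intro countable_finite digit_grid_card(1) assms) simp
  then show "countable (\<Union>k. digit_grid t \<inter> ball (0::real^'n) (real (Suc k)))" by blast
qed

lemma separated_set_digit_grid:
  assumes "0 < t" "t < 1"
  shows "separated_set (digit_grid t :: (real^'n) set)"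
proof
  show "1 \<le> dist z w" if "z \<in> digit_grid t" "w \<in> digit_grid t" "z \<noteq> w" for z w :: "real^'n"
    using that by (intro Ints_vec_dist_ge_1 digit_grid_integer)
  show "digit_grid t \<noteq> ({} :: (real^'n) set)" using zero_in_digit_grid by blast
qed (rule countable_digit_grid[OF assms])

text \<open>With \<open>\<beta> = n - 2 \<alpha>\<close> and \<open>\<gamma> = \<alpha> - \<alpha>\<^sub>0\<close>, the normalised energy in a ball of radius \<open>2 ^ k\<close> of bumps
  of this width is comparable to one.\<close>

definition bump_scale :: "real \<Rightarrow> real \<Rightarrow> nat \<Rightarrow> real" where
  "bump_scale \<beta> \<gamma> k = (2 ^ k) powr (- 2 * \<gamma> / \<beta>) / 8"

text \<open>The bound 1/8 makes \<open>2 * sqrt (\<delta> / 2) \<le> 1/2\<close>: the widened bumps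
  and their annuli fit into the half balls around the grid points.\<close>

lemma bump_scale_bounds:
  assumes "0 < \<beta>" "0 \<le> \<gamma>"
  shows "0 < bump_scale \<beta> \<gamma> k" "bump_scale \<beta> \<gamma> k \<le> 1/8"
proof -
  have "(2 ^ k) powr (- 2 * \<gamma> / \<beta>) \<le> (2 ^ k) powr (0::real)"
    using assms by (intro powr_mono) auto
  then show "bump_scale \<beta> \<gamma> k \<le> 1/8" by (simp add: bump_scale_def)
qed (simp add: bump_scale_def)

text \<open>Applied with \<open>a = 1\<close> to the bumps themselves and with
  \<open>a = 1/2\<close> to the squeezed ones, whose width is a square root.\<close>

lemma bump_scale_powr:
  assumes "0 < \<beta>"
  shows "bump_scale \<beta> \<gamma> k powr (\<beta> * a) = (2 ^ k) powr (- 2 * \<gamma> * a) * (1/8) powr (\<beta> * a)"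
proof -
  have "bump_scale \<beta> \<gamma> k powr (\<beta> * a) = ((2 ^ k) powr (- 2 * \<gamma> / \<beta>)) powr (\<beta> * a) * (1/8) powr (\<beta> * a)"
    unfolding bump_scale_def by (subst powr_mult[symmetric]) simp
  then show ?thesis using assms by (simp add: powr_powr mult.assoc)
qed

text \<open>This verifies the counting hypothesis of the upper Q-norm bound with a constant
  independent of \<open>k\<close>. The count grows like \<open>r powr (\<beta> + 2 \<gamma>)\<close>
  against \<open>r powr \<beta>\<close>, so the critical radius is \<open>2 ^ k\<close>, where the
  choice of \<open>\<delta>\<close> compensates exactly.\<close>

lemma digit_grid_piece_bump_count:
  fixes x :: "real^'n" and k :: nat
  assumes t: "0 < t" "t < 1" and \<beta>: "0 < \<beta>" and \<gamma>: "0 \<le> \<gamma>" and s: "real CARD('n) * t = \<beta> + 2 * \<gamma>"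
  defines "\<delta> \<equiv> bump_scale \<beta> \<gamma> k"
  assumes r: "\<delta> \<le> r"
  shows "real (card (digit_grid_piece t k \<inter> ball x (r + \<delta>))) * (\<delta> / r) powr \<beta>
    \<le> 64 ^ CARD('n) * (2 * real CARD('n)) powr (real CARD('n) * t)"
proof -
  let ?n = "CARD('n)" and ?s = "real CARD('n) * t" and ?T = "2 ^ k :: real"
  let ?F = "digit_grid_piece t k \<inter> ball x (r + \<delta>)"
  note \<delta> = bump_scale_bounds[OF \<beta> \<gamma>, of k, folded \<delta>_def]
  have s0: "0 < ?s" using t by simp
  \<comment> \<open>The effective radius: below 1 the count is bounded as at radius 1, and above
    \<open>2 ^ k\<close> the piece is exhausted.\<close>
  define \<rho> where "\<rho> = max 1 (min r ?T)"
  have T1: "1 \<le> ?T" by simp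
  have \<rho>: "1 \<le> \<rho>" "\<rho> \<le> ?T" using T1 by (auto simp: \<rho>_def)
  have n1: "1 \<le> real ?n" by (simp add: Suc_leI)
  have card: "real (card ?F) \<le> 64 ^ ?n * (2 * real ?n * \<rho>) powr ?s"
  proof (cases "r \<le> ?T")
    case True
    have "1 * \<rho> \<le> real ?n * \<rho>" using n1 \<rho> by (intro mult_right_mono) auto
    moreover have "r \<le> \<rho>" using True by (simp add: \<rho>_def)
    ultimately have le: "r + 1 \<le> 2 * real ?n * \<rho>" using \<rho>(1) by linarith
    have r1: "1 \<le> r + 1" using r \<delta> by simp
    have "?F \<subseteq> digit_grid t \<inter> ball x (r + 1)"
      using digit_grid_piece_subset[of t k] \<delta> by fastforce
    then have "card ?F \<le> card (digit_grid t \<inter> ball x (r + 1))"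
      by (intro card_mono digit_grid_card(1)[OF t r1])
    then have "real (card ?F) \<le> 64 ^ ?n * (r + 1) powr ?s"
      using digit_grid_card(2)[OF t r1, of x] by linarith
    also have "\<dots> \<le> 64 ^ ?n * (2 * real ?n * \<rho>) powr ?s"
      using le r1 s0 by (intro mult_left_mono powr_mono2) auto
    finally show ?thesis .
  next
    case False
    then have eq: "\<rho> = ?T" using T1 by (simp add: \<rho>_def)
    have nT: "1 \<le> real ?n * ?T" using n1 T1 mult_mono[of 1 "real ?n" 1 ?T] by simp
    have "?F \<subseteq> digit_grid t \<inter> ball (0::real^'n) (real ?n * ?T)"
      using digit_grid_piece_subset[of t k] by blast
    then have "card ?F \<le> card (digit_grid t \<inter> ball (0::real^'n) (real ?n * ?T))"
      by (intro card_mono digit_grid_card(1)[OF t nT])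
    then have "real (card ?F) \<le> 64 ^ ?n * (real ?n * ?T) powr ?s"
      using digit_grid_card(2)[OF t nT, of "0::real^'n"] by linarith
    also have "\<dots> \<le> 64 ^ ?n * (2 * real ?n * \<rho>) powr ?s"
      unfolding eq using s0 nT by (intro mult_left_mono powr_mono2) auto
    finally show ?thesis .
  qed
  \<comment> \<open>For \<open>r > 1\<close>, replacing \<open>r\<close> by
    \<open>\<rho> \<le> r\<close> leaves
    \<open>\<rho> powr (2 * \<gamma>) * \<delta> powr \<beta>\<close>; monotonicity up to
    \<open>2 ^ k\<close> then cancels the power of \<open>2 ^ k\<close> in
    \<open>\<delta>\<close>.\<close>
  have ratio: "\<rho> powr ?s * (\<delta> / r) powr \<beta> \<le> 1"
  proof (cases "r \<le> 1")
    case True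
    then have "\<rho> = 1" using T1 by (simp add: \<rho>_def)
    moreover have "(\<delta> / r) powr \<beta> \<le> 1" using r \<delta> \<beta> by (intro powr_le1) auto
    ultimately show ?thesis by simp
  next
    case False
    then have "\<rho> \<le> r" using T1 by (auto simp: \<rho>_def)
    then have "(\<delta> / r) powr \<beta> \<le> (\<delta> / \<rho>) powr \<beta>"
      using \<delta> \<beta> \<rho> False by (intro powr_mono2 divide_left_mono) auto
    also have "\<dots> = \<delta> powr \<beta> / \<rho> powr \<beta>" using \<delta> \<rho> by (intro powr_divide)
    finally have "\<rho> powr ?s * (\<delta> / r) powr \<beta> \<le> \<rho> powr ?s * (\<delta> powr \<beta> / \<rho> powr \<beta>)"
      by (intro mult_left_mono) auto
    also have "\<dots> = \<rho> powr (2 * \<gamma>) * \<delta> powr \<beta>" using \<rho> by (simp add: s powr_add)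
    also have "\<dots> \<le> ?T powr (2 * \<gamma>) * \<delta> powr \<beta>"
      using \<rho> \<gamma> by (intro mult_right_mono powr_mono2) auto
    also have "\<dots> = ?T powr (2 * \<gamma>) * ?T powr (- 2 * \<gamma>) * (1/8) powr \<beta>"
      using bump_scale_powr[OF \<beta>, of \<gamma> k 1] by (simp add: \<delta>_def)
    also have "?T powr (2 * \<gamma>) * ?T powr (- 2 * \<gamma>) = 1" by (simp flip: powr_add)
    also have "1 * (1/8) powr \<beta> \<le> (1::real)" using \<beta> by (simp add: powr_le1)
    finally show ?thesis .
  qed
  have "real (card ?F) * (\<delta> / r) powr \<beta> \<le> 64 ^ ?n * (2 * real ?n * \<rho>) powr ?s * (\<delta> / r) powr \<beta>"
    using card by (intro mult_right_mono) auto
  also have "\<dots> = 64 ^ ?n * (2 * real ?n) powr ?s * (\<rho> powr ?s * (\<delta> / r) powr \<beta>)"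
    using \<rho> by (simp add: powr_mult)
  also have "\<dots> \<le> 64 ^ ?n * (2 * real ?n) powr ?s * 1"
    using ratio by (intro mult_left_mono) auto
  finally show ?thesis by simp
qed

lemma squeeze_not_bounded_on_Q:
  assumes n: "CARD('n) \<ge> 2" and t: "0 < t" "t < 1" and \<alpha>: "0 < \<alpha>" "\<alpha> < 1"
    and \<gamma>: "real CARD('n) * t = (real CARD('n) - 2 * \<alpha>) + 2 * \<gamma>" "0 < \<gamma>"
  shows "\<not> composition_bounded_on_Q \<alpha> (separated_set.squeeze (digit_grid t :: (real^'n) set))"
proof
  interpret separated_set "digit_grid t :: (real^'n) set" by (rule separated_set_digit_grid[OF t])
  assume "composition_bounded_on_Q \<alpha> squeeze"
  then obtain C where C: "\<And>u. u \<in> Q_space \<alpha> \<Longrightarrow> Q_norm \<alpha> (u \<circ> squeeze) \<le> ennreal C * Q_norm \<alpha> u"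
    unfolding composition_bounded_on_Q_def composition_operator_def by blast
  let ?n = "CARD('n)"
  define \<beta> where "\<beta> = real ?n - 2 * \<alpha>"
  have \<beta>: "0 < \<beta>" using n \<alpha> by (simp add: \<beta>_def)
  have s: "real ?n * t = \<beta> + 2 * \<gamma>" using \<gamma>(1) by (simp add: \<beta>_def)
  define \<delta> where "\<delta> = bump_scale \<beta> \<gamma>"
  have \<delta>: "0 < \<delta> k" "\<delta> k \<le> 1/8" for k
    using bump_scale_bounds[OF \<beta>, of \<gamma>] \<gamma>(2) by (auto simp: \<delta>_def)
  define F where "F k = (digit_grid_piece t k :: (real^'n) set)" for k
  define u where "u k = bump (\<delta> k) (F k)" for k
  have FE: "F k \<subseteq> digit_grid t" for k using digit_grid_piece_subset[of t k] by (auto simp: F_def)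
  have cardF: "finite (F k)" "(2 ^ k) powr (\<beta> + 2 * \<gamma>) / 2 ^ ?n \<le> real (card (F k))" for k
    using digit_grid_piece_card[OF t, of k, where 'n='n] by (simp_all add: F_def s)
  have "0 < real (card (F k))" for k by (rule less_le_trans[OF _ cardF(2)]) simp
  then have F_ne: "F k \<noteq> {}" for k by (metis card.empty less_irrefl of_nat_0)
  obtain C0 where C0: "0 < C0"
    "\<And>(F::(real^'n) set) \<delta> M. 0 < \<delta> \<Longrightarrow> finite F \<Longrightarrow> F \<noteq> {} \<Longrightarrow>
      (\<And>x r. \<delta> \<le> r \<Longrightarrow> real (card (F \<inter> ball x (r + \<delta>))) * (\<delta> / r) powr (real ?n - 2 * \<alpha>) \<le> M) \<Longrightarrow>
      Q_norm \<alpha> (bump \<delta> F) \<le> ennreal (sqrt (C0 * (1 + M)))"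
    by (rule Q_norm_bump_le[OF n \<alpha>]) blast
  define A where "A = sqrt (C0 * (1 + 64 ^ ?n * (2 * real ?n) powr (real ?n * t)))"
  have upper: "Q_norm \<alpha> (u k) \<le> ennreal A" for k
    unfolding u_def A_def
  proof (rule C0(2)[OF \<delta>(1) cardF(1) F_ne])
    show "real (card (F k \<inter> ball x (r + \<delta> k))) * (\<delta> k / r) powr (real ?n - 2 * \<alpha>)
        \<le> 64 ^ ?n * (2 * real ?n) powr (real ?n * t)" if "\<delta> k \<le> r" for x r
      using digit_grid_piece_bump_count[OF t \<beta> less_imp_le[OF \<gamma>(2)] s, of k r x] that
      by (simp add: F_def \<delta>_def \<beta>_def)
  qed
  have "u k \<in> Q_space \<alpha>" for k
    using bump_in_L2_loc[OF \<delta>(1), of k "F k"] upper[of k]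
    by (simp add: Q_space_def u_def le_less_trans[OF _ ennreal_less_top])
  \<comment> \<open>The constant \<open>C\<close> may be negative, in which case
    \<open>ennreal C = 0\<close>; \<open>max C 0\<close> has the same image and multiplies
    correctly.\<close>
  then have comp: "Q_norm \<alpha> (u k \<circ> squeeze) \<le> ennreal (max C 0 * A)" for k
  proof -
    have "Q_norm \<alpha> (u k \<circ> squeeze) \<le> ennreal C * Q_norm \<alpha> (u k)"
      by (rule C) fact
    also have "\<dots> \<le> ennreal (max C 0) * ennreal A"
      by (intro mult_mono upper ennreal_leI) auto
    also have "\<dots> = ennreal (max C 0 * A)" using C0(1) by (intro ennreal_mult[symmetric]) (auto simp: A_def)
    finally show ?thesis .
  qed
  define c where "c = unit_ball_vol (real ?n) ^ 2 / (4 * 2 ^ ?n * 3 powr (real ?n + 2 * \<alpha>))"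
  \<comment> \<open>The 1/16 is the 1/8 of \<open>bump_scale\<close> times the 1/2 in
    \<open>\<delta> / 2\<close>; the exponent is \<open>\<beta> / 2\<close> because the squeezed
    width is a square root.\<close>
  define c1 where "c1 = c / 2 ^ ?n * (2 * real ?n) powr (- \<beta>) * (1/16) powr (\<beta> / 2)"
  have c: "0 < c" unfolding c_def by (intro divide_pos_pos zero_less_power unit_ball_vol_pos) auto
  have c1: "0 < c1" using c by (simp add: c1_def)
  have lower: "ennreal (sqrt (c1 * (2 powr \<gamma>) ^ k)) \<le> Q_norm \<alpha> (u k \<circ> squeeze)" for k
  proof -
    let ?T = "2 ^ k :: real" and ?\<epsilon> = "sqrt (\<delta> k / 2)"
    \<comment> \<open>Doubling the radius that contains the piece leaves room for the annuli of
      width up to \<open>2 * \<epsilon>\<close>.\<close>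
    let ?R = "2 * real ?n * ?T"
    have \<epsilon>: "0 < ?\<epsilon>" "?\<epsilon> \<le> 1/4"
    proof -
      have "?\<epsilon> \<le> sqrt ((1/4)^2)" using \<delta>(2)[of k] by (intro real_sqrt_le_mono) (simp add: power2_eq_square)
      then show "?\<epsilon> \<le> 1/4" by simp
    qed (use \<delta> in simp)
    have "c1 * (2 powr \<gamma>) ^ k = c * (?T powr (\<beta> + 2 * \<gamma>) / 2 ^ ?n) * ?R powr (- \<beta>) * ?\<epsilon> powr \<beta>"
    proof -
      have "?\<epsilon> powr \<beta> = (\<delta> k / 2) powr (\<beta> / 2)"
        using \<delta>(1)[of k] by (simp add: powr_half_sqrt[symmetric] powr_powr)
      also have "\<dots> = \<delta> k powr (\<beta> * (1/2)) * (1/2) powr (\<beta> / 2)"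
        using powr_mult[of "\<delta> k" "1/2" "\<beta> / 2"] by simp
      also have "\<delta> k powr (\<beta> * (1/2)) = ?T powr (- \<gamma>) * (1/8) powr (\<beta> / 2)"
        unfolding \<delta>_def bump_scale_powr[OF \<beta>] by simp
      also have "?T powr (- \<gamma>) * (1/8) powr (\<beta> / 2) * (1/2) powr (\<beta> / 2) = ?T powr (- \<gamma>) * (1/16) powr (\<beta> / 2)"
        by (simp add: mult.assoc flip: powr_mult)
      finally have e: "?\<epsilon> powr \<beta> = ?T powr (- \<gamma>) * (1/16) powr (\<beta> / 2)" .
      have R: "?R powr (- \<beta>) = (2 * real ?n) powr (- \<beta>) * ?T powr (- \<beta>)" by (rule powr_mult)
      \<comment> \<open>The exponents come from the number of bumps, the normalisation and the
        squeezed width, and leave a net growth of \<open>\<gamma>\<close>.\<close>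
      have T: "?T powr (\<beta> + 2 * \<gamma>) * ?T powr (- \<beta>) * ?T powr (- \<gamma>) = ?T powr \<gamma>"
        by (simp flip: powr_add)
      also have "\<dots> = (2 powr \<gamma>) ^ k"
        by (simp add: powr_realpow[symmetric] powr_powr mult.commute)
      finally have power: "(2 powr \<gamma>) ^ k = ?T powr (\<beta> + 2 * \<gamma>) * ?T powr (- \<beta>) * ?T powr (- \<gamma>)" by (rule sym)
      show ?thesis unfolding e R c1_def power by (simp only: mult_ac times_divide_eq_right times_divide_eq_left)
    qed
    also have "\<dots> \<le> c * real (card (F k)) * ?R powr (- \<beta>) * ?\<epsilon> powr \<beta>"
      using c cardF(2)[of k] by (intro mult_right_mono mult_left_mono) auto
    finally have "ennreal (sqrt (c1 * (2 powr \<gamma>) ^ k)) \<le> ennreal (sqrt (c * real (card (F k)) * ?R powr (- \<beta>) * ?\<epsilon> powr \<beta>))"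
      by (intro ennreal_leI real_sqrt_le_mono)
    also have "\<dots> = ennreal (sqrt (c * real (card (F k)) * ?R powr (2 * \<alpha> - real ?n) * ?\<epsilon> powr (real ?n - 2 * \<alpha>)))"
      by (simp add: \<beta>_def)
    also have "\<dots> \<le> Q_norm \<alpha> (u k \<circ> squeeze)"
      unfolding c_def
    proof (rule Q_norm_ge_separated_bumps[OF cardF(1) _ \<epsilon> _ \<alpha>(1)])
      have "1 * 1 \<le> real ?n * ?T" by (intro mult_mono) (auto simp: Suc_leI)
      then have "real ?n * ?T \<le> ?R - 2 * ?\<epsilon>" using \<epsilon> by simp
      then show "F k \<subseteq> ball 0 (?R - 2 * ?\<epsilon>)"
        using digit_grid_piece_subset[of t k, where 'n='n] unfolding F_def by auto
      show "1 \<le> dist z w" if "z \<in> F k" "w \<in> F k" "z \<noteq> w" for z w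
        using that FE separated by blast
      show "3/4 \<le> (u k \<circ> squeeze) x" if "z \<in> F k" "dist z x < ?\<epsilon> / 2" for z x
        unfolding u_def comp_def by (rule bump_squeeze_high[OF FE that(1) \<delta> that(2)])
      show "(u k \<circ> squeeze) x = 0" if "z \<in> F k" "?\<epsilon> \<le> dist z x" "dist z x < 2 * ?\<epsilon>" for z x
        unfolding u_def comp_def by (rule bump_squeeze_low[OF FE that(1) \<delta> that(2,3)])
    qed simp
    finally show ?thesis .
  qed
  have A: "0 \<le> max C 0 * A" using C0(1) by (auto simp: A_def)
  have "c1 * (2 powr \<gamma>) ^ k \<le> (max C 0 * A)^2" for k
  proof -
    have "ennreal (sqrt (c1 * (2 powr \<gamma>) ^ k)) \<le> ennreal (max C 0 * A)"
      using lower comp by (rule order_trans)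
    then have "sqrt (c1 * (2 powr \<gamma>) ^ k) \<le> max C 0 * A" using A by (simp add: ennreal_le_iff)
    then show ?thesis by (rule sqrt_le_D)
  qed
  moreover obtain k where "(max C 0 * A)^2 / c1 < (2 powr \<gamma>) ^ k"
    using real_arch_pow[of "2 powr \<gamma>"] \<gamma>(2) by auto
  then have "(max C 0 * A)^2 < c1 * (2 powr \<gamma>) ^ k" using c1 by (simp add: field_simps)
  ultimately show False by (meson linorder_not_less)
qed

theorem theorem1p7:
  fixes \<alpha>\<^sub>0 :: real
  assumes "CARD('n::finite) \<ge> 2" and "0 < \<alpha>\<^sub>0" and "\<alpha>\<^sub>0 < 1"
  shows "\<exists>E :: (real^'n) set.
    (\<forall>x\<in>E. \<forall>i. x $ i \<in> \<int>) \<and> \<not> bounded E \<and>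
    dim_LG E = ereal (real CARD('n) - 2 * \<alpha>\<^sub>0) \<and> dim_L E = 0 \<and>
    (\<exists>(f :: real^'n \<Rightarrow> real^'n) Df.
      quasiconformal f \<and> (\<exists>L. L-lipschitz_on UNIV f) \<and>
      has_weak_derivative f Df \<and> A1_local E (\<lambda>x. det (Df x)) \<and>
      (\<forall>\<alpha>. \<alpha>\<^sub>0 < \<alpha> \<and> \<alpha> < 1 \<longrightarrow> \<not> composition_bounded_on_Q \<alpha> f))"
proof -
  \<comment> \<open>Chosen so that \<open>n t = n - 2 \<alpha>\<^sub>0\<close>; it is positive
    because \<open>2 \<alpha>\<^sub>0 < 2 \<le> n\<close>.\<close>
  define t where "t = 1 - 2 * \<alpha>\<^sub>0 / real CARD('n)"
  have t: "0 < t" "t < 1" using assms by (simp_all add: t_def field_simps)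
  have nt: "real CARD('n) * t = real CARD('n) - 2 * \<alpha>\<^sub>0" by (simp add: t_def field_simps)
  interpret separated_set "digit_grid t :: (real^'n) set" by (rule separated_set_digit_grid[OF t])
  have "\<not> composition_bounded_on_Q \<alpha> squeeze" if "\<alpha>\<^sub>0 < \<alpha>" "\<alpha> < 1" for \<alpha>
    \<comment> \<open>One set and one map serve all \<open>\<alpha>\<close>; only the excess
      exponent \<open>\<gamma> = \<alpha> - \<alpha>\<^sub>0\<close> and the bumps vary.\<close>
    using assms that by (intro squeeze_not_bounded_on_Q[OF assms(1) t, where \<gamma> = "\<alpha> - \<alpha>\<^sub>0"]) (auto simp: nt)
  then show ?thesis
    using digit_grid_integer digit_grid_unbounded[OF t] dim_LG_digit_grid[OF t, where 'n='n] dim_L_digit_grid[OF t]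
      quasiconformal_squeeze squeeze_lipschitz squeeze_has_weak_derivative A1_local_det_squeeze_deriv nt
    by (intro exI[of _ "digit_grid t"] exI[of _ squeeze] exI[of _ squeeze_deriv] exI[of _ 5] conjI ballI allI impI)
      auto
qed

end
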